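(* Let $M$ be a hyperbolic unimodular $n\times n$ matrix (integer entries, determinant $\pm1$, no eigenvalue of modulus one), and let $f\colon\mathbb{T}^n\to\mathbb{T}^n$, $f(x)=Mx$, be the induced linear Anosov diffeomorphism of $\mathbb{T}^n=\mathbb{R}^n/\mathbb{Z}^n$. Let $R\in C^\beta(\mathbb{T}^n)$ with $\beta>n/2$ satisfy $\int R\,dm=0$, where $m$ is the Haar measure of $\mathbb{T}^n$. Consider the Birkhoff sums $$u_\alpha=-\sum_{j=0}^\infty R\circ f^j,\qquad u_\omega=\sum_{j=1}^\infty R\circ f^{-j}.$$ Then $u_\alpha$ and $u_\omega$ are well defined as distributions and $u_\omega,u_\alpha\in\Lambda^0$, where $\Lambda^0$ is the Zygmund space of order $0$. Moreover they are both weak solutions of the cohomological equation $R=u\circ f-u$.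
   Context: Well defined as distributions means that for every $\phi\in C^\infty(\mathbb{T}^n)$ the series $u_\alpha(\phi)=-\sum_{j\ge0}\int\phi\cdot R\circ f^j\,dm$ and $u_\omega(\phi)=\sum_{j\ge1}\int\phi\cdot R\circ f^{-j}\,dm$ converge and define distributions. A distribution $u$ is a weak solution of $R=u\circ f-u$ if $u(\phi\circ f^{-1})-u(\phi)=\int R\phi\,dm$ for every $\phi\in C^\infty(\mathbb{T}^n)$. Zygmund class: let $\psi_0\in C_c^\infty(\mathbb{R}^n)$ be radial, non-increasing along rays, $\psi_0=1$ for $|x|<1$, $\psi_0=0$ for $|x|>2$; put $\psi(x)=\psi_0(x)-\psi_0(2x)$ and $\psi_\ell(x)=\psi(x/2^\ell)$ for $\ell\ge1$. For a tempered distribution $u$ let $\psi_\ell(D)u=\mathcal{F}^{-1}(\psi_\ell\hat u)$, with $\hat u$ the Fourier transform. For $s\in\mathbb{R}$, $\Lambda^s$ is the set of tempered distributions $u$ with $\sup_{\ell\ge0}2^{\ell s}\sup_x|\psi_\ell(D)u(x)|<\infty$. Distributions on $\mathbb{T}^n$ are identified with $\mathbb{Z}^n$-periodic (tempered) distributions on $\mathbb{R}^n$, and membership in $\Lambda^s$ is understood through this identification. *)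

theory Defs
  imports "HOL-Analysis.Analysis"
begin

section \<open>Differentiability classes on Euclidean space\<close>

definition partial ::
  "'n::finite \<Rightarrow> (real^'n \<Rightarrow> 'b::real_normed_vector) \<Rightarrow> real^'n \<Rightarrow> 'b" where
  "partial i f x = frechet_derivative f (at x) (axis i 1)"

text \<open>Multi-indices are lists of coordinate directions, and the order of a derivative is the
  length of the list. Lists that differ by a permutation give the same derivative of a function
  that is differentiable often enough.\<close>

definition partials ::
  "'n::finite list \<Rightarrow> (real^'n \<Rightarrow> 'b::real_normed_vector) \<Rightarrow> real^'n \<Rightarrow> 'b" where
  "partials ds f = foldr partial ds f"

primrec C_k :: "nat \<Rightarrow> (real^'n::finite \<Rightarrow> 'b::real_normed_vector) \<Rightarrow> bool" where
  "C_k 0 f \<longleftrightarrow> continuous_on UNIV f"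
| "C_k (Suc k) f \<longleftrightarrow> (\<forall>x. f differentiable (at x)) \<and> (\<forall>i. C_k k (partial i f))"

definition C_inf :: "(real^'n::finite \<Rightarrow> 'b::real_normed_vector) \<Rightarrow> bool" where
  "C_inf f \<longleftrightarrow> (\<forall>k. C_k k f)"


section \<open>Functions and distributions on the torus\<close>

text \<open>A function on the torus is a function on Euclidean space that is invariant under integer
  translations; Haar measure is Lebesgue measure on the unit cube.\<close>

definition lattice :: "int^'n \<Rightarrow> real^'n" where
  "lattice k = (\<chi> i. of_int (k $ i))"

definition Z_periodic :: "(real^'n::finite \<Rightarrow> 'b) \<Rightarrow> bool" where
  "Z_periodic f \<longleftrightarrow> (\<forall>k x. f (x + lattice k) = f x)"

definition torus_integral :: "(real^'n::finite \<Rightarrow> complex) \<Rightarrow> complex" where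
  "torus_integral f = (LINT x:cbox 0 1|lborel. f x)"

text \<open>The space of functions of class \<open>\<beta> = k + \<gamma>\<close>, where \<open>k\<close> is the integer part: \<open>k\<close> times
  continuously differentiable with \<open>\<gamma>\<close>-Hoelder derivatives of order \<open>k\<close>. For integral \<open>\<beta>\<close> the last
  condition only bounds the oscillation of these derivatives, which is automatic on the torus.
  For a periodic function the Euclidean distance may be used in place of the distance of the
  torus, as one can choose the representatives of two points at minimal distance.\<close>

definition torus_Holder :: "real \<Rightarrow> (real^'n::finite \<Rightarrow> complex) set" where
  "torus_Holder \<beta> = {f. Z_periodic f \<and> C_k (nat \<lfloor>\<beta>\<rfloor>) f \<and>
     (\<exists>C. \<forall>ds. length ds = nat \<lfloor>\<beta>\<rfloor> \<longrightarrow>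
        (\<forall>x y. norm (partials ds f x - partials ds f y) \<le> C * dist x y powr (\<beta> - \<lfloor>\<beta>\<rfloor>)))}"

definition torus_smooth :: "(real^'n::finite \<Rightarrow> complex) set" where
  "torus_smooth = {\<phi>. Z_periodic \<phi> \<and> C_inf \<phi>}"

definition torus_seminorm :: "nat \<Rightarrow> (real^'n::finite \<Rightarrow> complex) \<Rightarrow> real" where
  "torus_seminorm N \<phi> = (\<Sum>ds | length ds \<le> N. SUP x. norm (partials ds \<phi> x))"

definition linear_functional_on :: "('a \<Rightarrow> complex) set \<Rightarrow> (('a \<Rightarrow> complex) \<Rightarrow> complex) \<Rightarrow> bool" where
  "linear_functional_on V u \<longleftrightarrow>
     (\<forall>\<phi>\<in>V. \<forall>\<eta>\<in>V. u (\<lambda>x. \<phi> x + \<eta> x) = u \<phi> + u \<eta>) \<and>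
     (\<forall>c. \<forall>\<phi>\<in>V. u (\<lambda>x. c * \<phi> x) = c * u \<phi>)"

text \<open>Continuity of a linear functional with respect to an increasing sequence of seminorms is
  expressed by an estimate by one of them. The value of a distribution on a function that is not
  a test function is irrelevant.\<close>

definition torus_distribution :: "((real^'n::finite \<Rightarrow> complex) \<Rightarrow> complex) \<Rightarrow> bool" where
  "torus_distribution u \<longleftrightarrow> linear_functional_on torus_smooth u \<and>
     (\<exists>C N. \<forall>\<phi>\<in>torus_smooth. norm (u \<phi>) \<le> C * torus_seminorm N \<phi>)"


section \<open>Tempered distributions and the Fourier transform\<close>

definition schwartz :: "(real^'n::finite \<Rightarrow> complex) set" where
  "schwartz = {\<phi>. C_inf \<phi> \<and>
     (\<forall>N ds. bdd_above (range (\<lambda>x. (1 + norm x) ^ N * norm (partials ds \<phi> x))))}"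

definition schwartz_seminorm :: "nat \<Rightarrow> (real^'n::finite \<Rightarrow> complex) \<Rightarrow> real" where
  "schwartz_seminorm N \<phi> =
     (\<Sum>ds | length ds \<le> N. SUP x. (1 + norm x) ^ N * norm (partials ds \<phi> x))"

definition tempered_distribution :: "((real^'n::finite \<Rightarrow> complex) \<Rightarrow> complex) \<Rightarrow> bool" where
  "tempered_distribution u \<longleftrightarrow> linear_functional_on schwartz u \<and>
     (\<exists>C N. \<forall>\<phi>\<in>schwartz. norm (u \<phi>) \<le> C * schwartz_seminorm N \<phi>)"

definition fourier :: "(real^'n::finite \<Rightarrow> complex) \<Rightarrow> real^'n \<Rightarrow> complex" where
  "fourier \<phi> \<xi> = (LINT x|lborel. exp (- \<i> * of_real (x \<bullet> \<xi>)) * \<phi> x)"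

definition inv_fourier :: "(real^'n::finite \<Rightarrow> complex) \<Rightarrow> real^'n \<Rightarrow> complex" where
  "inv_fourier \<phi> x =
     (LINT \<xi>|lborel. exp (\<i> * of_real (x \<bullet> \<xi>)) * \<phi> \<xi>) / of_real ((2 * pi) ^ CARD('n))"

definition distr_fourier ::
  "((real^'n::finite \<Rightarrow> complex) \<Rightarrow> complex) \<Rightarrow> (real^'n \<Rightarrow> complex) \<Rightarrow> complex" where
  "distr_fourier u \<phi> = u (fourier \<phi>)"

definition distr_inv_fourier ::
  "((real^'n::finite \<Rightarrow> complex) \<Rightarrow> complex) \<Rightarrow> (real^'n \<Rightarrow> complex) \<Rightarrow> complex" where
  "distr_inv_fourier u \<phi> = u (inv_fourier \<phi>)"

definition distr_mult ::
  "(real^'n::finite \<Rightarrow> real) \<Rightarrow> ((real^'n \<Rightarrow> complex) \<Rightarrow> complex) \<Rightarrow> (real^'n \<Rightarrow> complex) \<Rightarrow> complex" where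
  "distr_mult \<eta> u \<phi> = u (\<lambda>x. of_real (\<eta> x) * \<phi> x)"

definition fourier_multiplier ::
  "(real^'n::finite \<Rightarrow> real) \<Rightarrow> ((real^'n \<Rightarrow> complex) \<Rightarrow> complex) \<Rightarrow> (real^'n \<Rightarrow> complex) \<Rightarrow> complex" where
  "fourier_multiplier \<eta> u = distr_inv_fourier (distr_mult \<eta> (distr_fourier u))"


section \<open>Zygmund classes\<close>

definition radial_cutoff :: "(real^'n::finite \<Rightarrow> real) \<Rightarrow> bool" where
  "radial_cutoff \<psi>0 \<longleftrightarrow>
     C_inf \<psi>0 \<and> compact (closure {x. \<psi>0 x \<noteq> 0}) \<and>
     (\<forall>x y. norm x = norm y \<longrightarrow> \<psi>0 x = \<psi>0 y) \<and>
     (\<forall>x s t. 0 \<le> s \<and> s \<le> t \<longrightarrow> \<psi>0 (t *\<^sub>R x) \<le> \<psi>0 (s *\<^sub>R x)) \<and>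
     (\<forall>x. norm x < 1 \<longrightarrow> \<psi>0 x = 1) \<and> (\<forall>x. norm x > 2 \<longrightarrow> \<psi>0 x = 0)"

definition dyadic_piece :: "(real^'n::finite \<Rightarrow> real) \<Rightarrow> nat \<Rightarrow> real^'n \<Rightarrow> real" where
  "dyadic_piece \<psi>0 l x =
     (if l = 0 then \<psi>0 x
      else let y = (1 / 2 ^ l) *\<^sub>R x in \<psi>0 y - \<psi>0 (2 *\<^sub>R y))"

text \<open>The distribution \<open>\<psi>\<^sub>l(D)u\<close> has a compactly supported Fourier transform, hence it is given by a
  continuous function, which is unique. The function \<open>g\<close> below is this function.\<close>

definition represented_by ::
  "((real^'n::finite \<Rightarrow> complex) \<Rightarrow> complex) \<Rightarrow> (real^'n \<Rightarrow> complex) \<Rightarrow> bool" where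
  "represented_by v g \<longleftrightarrow> (\<forall>\<phi>\<in>schwartz. v \<phi> = (LINT x|lborel. g x * \<phi> x))"

definition Zygmund ::
  "(real^'n::finite \<Rightarrow> real) \<Rightarrow> real \<Rightarrow> ((real^'n \<Rightarrow> complex) \<Rightarrow> complex) set" where
  "Zygmund \<psi>0 s = {u. tempered_distribution u \<and>
     (\<exists>C. \<forall>l. \<exists>g. continuous_on UNIV g \<and>
        represented_by (fourier_multiplier (dyadic_piece \<psi>0 l) u) g \<and>
        (\<forall>x. 2 powr (real l * s) * norm (g x) \<le> C))}"

text \<open>A distribution on the torus, as a periodic distribution on Euclidean space, acts on a
  Schwartz function by acting on its periodization. For an integrable function on the torus this
  is integration against its periodic extension.\<close>

definition periodization :: "(real^'n::finite \<Rightarrow> complex) \<Rightarrow> real^'n \<Rightarrow> complex" where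
  "periodization \<phi> x = (\<Sum>\<^sub>\<infinity>k\<in>UNIV. \<phi> (x + lattice k))"

definition periodic_extension ::
  "((real^'n::finite \<Rightarrow> complex) \<Rightarrow> complex) \<Rightarrow> (real^'n \<Rightarrow> complex) \<Rightarrow> complex" where
  "periodic_extension u \<phi> = u (periodization \<phi>)"


section \<open>The linear Anosov diffeomorphism and the cohomological equation\<close>

definition unimodular :: "int^'n^'n::finite \<Rightarrow> bool" where
  "unimodular M \<longleftrightarrow> det M = 1 \<or> det M = -1"

definition hyperbolic :: "int^'n^'n::finite \<Rightarrow> bool" where
  "hyperbolic M \<longleftrightarrow>
     (\<forall>\<mu>::complex. \<forall>v::complex^'n. v \<noteq> 0 \<and> map_matrix of_int M *v v = \<mu> *s v \<longrightarrow> cmod \<mu> \<noteq> 1)"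

text \<open>The map of the torus is represented by its linear lift, which is a bijection of Euclidean
  space for unimodular \<open>M\<close>.\<close>

definition toral_map :: "int^'n^'n::finite \<Rightarrow> real^'n \<Rightarrow> real^'n" where
  "toral_map M x = map_matrix of_int M *v x"

definition alpha_term ::
  "int^'n^'n::finite \<Rightarrow> (real^'n \<Rightarrow> complex) \<Rightarrow> (real^'n \<Rightarrow> complex) \<Rightarrow> nat \<Rightarrow> complex" where
  "alpha_term M R \<phi> j = torus_integral (\<lambda>x. \<phi> x * R ((toral_map M ^^ j) x))"

definition omega_term ::
  "int^'n^'n::finite \<Rightarrow> (real^'n \<Rightarrow> complex) \<Rightarrow> (real^'n \<Rightarrow> complex) \<Rightarrow> nat \<Rightarrow> complex" where
  "omega_term M R \<phi> j = torus_integral (\<lambda>x. \<phi> x * R ((inv (toral_map M) ^^ j) x))"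

definition u_alpha ::
  "int^'n^'n::finite \<Rightarrow> (real^'n \<Rightarrow> complex) \<Rightarrow> (real^'n \<Rightarrow> complex) \<Rightarrow> complex" where
  "u_alpha M R \<phi> = - (\<Sum>j. alpha_term M R \<phi> j)"

definition u_omega ::
  "int^'n^'n::finite \<Rightarrow> (real^'n \<Rightarrow> complex) \<Rightarrow> (real^'n \<Rightarrow> complex) \<Rightarrow> complex" where
  "u_omega M R \<phi> = (\<Sum>j. omega_term M R \<phi> (Suc j))"

definition weak_solution ::
  "int^'n^'n::finite \<Rightarrow> (real^'n \<Rightarrow> complex) \<Rightarrow> ((real^'n \<Rightarrow> complex) \<Rightarrow> complex) \<Rightarrow> bool" where
  "weak_solution M R u \<longleftrightarrow> torus_distribution u \<and>
     (\<forall>\<phi>\<in>torus_smooth. u (\<phi> \<circ> inv (toral_map M)) - u \<phi> = torus_integral (\<lambda>x. R x * \<phi> x))"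

end

theory Submission
  imports Defs "HOL-Computational_Algebra.Fundamental_Theorem_Algebra"
begin

text \<open>Since \<open>\<beta> > n/2\<close>, Bernstein's theorem gives \<open>R = \<Sum> R\<^sub>k e\<^sub>k\<close> with \<open>\<Sum> \<bar>R\<^sub>k\<bar> < \<infinity>\<close>, and \<open>R \<circ> f\<^sup>j\<close> is the sum
  of \<open>R\<^sub>k e\<^sub>m\<close> with \<open>m = A\<^sup>j k\<close> and \<open>A\<close> the transpose of \<open>M\<close>. By hyperbolicity an orbit \<open>\<bar>A\<^sup>j k\<bar>\<close>, for
  \<open>j\<close> in the integers and \<open>k \<noteq> 0\<close>, first decreases and then increases exponentially, so it spends
  a time bounded independently of \<open>k\<close> and \<open>l\<close> in the dyadic shell \<open>\<bar>x\<bar> \<approx> 2\<^sup>l\<close>. Hence the pieces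
  \<open>\<psi>\<^sub>l(D)u\<close> are bounded by a multiple of \<open>\<Sum> \<bar>R\<^sub>k\<bar>\<close>. The same estimate, with \<open>\<Sum>\<^sub>j 1 / \<bar>A\<^sup>j k\<bar>\<close> in place of
  the number of visits, gives the convergence on test functions, whose Fourier coefficients are
  \<open>O(1 / \<bar>m\<bar>)\<close>.\<close>

section \<open>Orbits of a hyperbolic matrix\<close>

text \<open>Growth comes from compactness: a nonzero vector with a bounded two-sided orbit would
  produce an eigenvalue of modulus one, so every vector doubles its norm within a bounded time,
  forwards or backwards. Visits are counted by the smooth weight \<open>bump t s\<close>, about
  min(t/s, s/t). It is the derivative of t/(t + s) with respect to log t, so its sum along an orbit
  telescopes; up to constants it dominates the multiplier at s = 2^l/(2 pi), and 1/t at s = 1.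
  Bernstein's estimate is proved for a shifted lattice m + a. With a = 0 it applies to R; with a
  arbitrary it bounds the lattice sums of the Fourier transform of a smooth compactly supported
  function, which is therefore integrable. Fourier inversion then follows from Poisson summation and
  identifies psi_l(D)u: the multiplier turns a test function \<phi> into its convolution with the
  transform of psi_l, and the coefficients of the periodization are psi_l(2 pi m) times those of
  \<phi>. For this reason the sums are studied on integrable functions of the torus as well as on
  smooth ones.\<close>

text \<open>\<open>B\<close> stands for an invariant subspace, written as a predicate. Among its
  nonzero vectors v and the nonzero polynomials with p(A)v = 0, a pair of least degree is taken. A
  root \<mu> splits off as p = (X - \<mu>) q, and w = q(A)v is nonzero by minimality, hence an
  eigenvector.\<close>

lemma eigenvector_in_invariant_subspace:
  fixes A :: "complex^'n::finite^'n" and v0 :: "complex^'n"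
  assumes add: "\<And>v w. B v \<Longrightarrow> B w \<Longrightarrow> B (v + w)"
    and scale: "\<And>c v. B v \<Longrightarrow> B (c *s v)"
    and inv: "\<And>v. B v \<Longrightarrow> B (A *v v)"
    and v0: "B v0" "v0 \<noteq> 0"
  shows "\<exists>\<mu> w. w \<noteq> 0 \<and> B w \<and> A *v w = \<mu> *s w"
proof -
  define S where "S N p v = (\<Sum>i\<le>N. coeff p i *s ((*v) A ^^ i) v)" for N p v
  define Q where "Q d \<longleftrightarrow> (\<exists>p v. p \<noteq> 0 \<and> degree p = d \<and> v \<noteq> 0 \<and> B v \<and> S d p v = 0)" for d
  have S_bound: "S N p v = S (degree p) p v" if "degree p \<le> N" for N p v
    unfolding S_def using that
    by (intro sum.mono_neutral_right) (auto simp: coeff_eq_0)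
  have "\<exists>d. Q d"
  proof -
    let ?f = "\<lambda>i. ((*v) A ^^ i) v0"
    let ?D = "DIM(complex^'n)"
    \<comment> \<open>There is one iterate more than the real dimension. Dependence is a notion for
      sets, so two coinciding iterates get a relation of their own.\<close>
    obtain u where u: "\<exists>i\<le>?D. u i \<noteq> (0::real)" "(\<Sum>i\<le>?D. u i *\<^sub>R ?f i) = 0"
    proof (cases "inj_on ?f {..?D}")
      case True
      then have "card (?f ` {..?D}) > ?D"
        by (simp add: card_image)
      then have "dependent (?f ` {..?D})"
        using dependent_biggerset by blast
      then obtain c w where w: "w \<in> ?f ` {..?D}" "c w \<noteq> 0"
        and c: "(\<Sum>v\<in>?f ` {..?D}. c v *\<^sub>R v) = 0"
        unfolding dependent_finite[OF finite_imageI[OF finite_atMost]] by blast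
      show thesis
      proof (rule that[of "c \<circ> ?f"])
        show "\<exists>i\<le>?D. (c \<circ> ?f) i \<noteq> 0" using w by auto
        show "(\<Sum>i\<le>?D. (c \<circ> ?f) i *\<^sub>R ?f i) = 0"
          using c by (subst (asm) sum.reindex[OF True]) (simp add: o_def)
      qed
    next
      case False
      then obtain a b where ab: "a \<le> ?D" "b \<le> ?D" "a \<noteq> b" "?f a = ?f b"
        unfolding inj_on_def by auto
      show thesis
      proof (rule that[of "\<lambda>i. if i = a then 1 else if i = b then -1 else 0"])
        show "\<exists>i\<le>?D. (if i = a then 1 else if i = b then - 1 else 0) \<noteq> (0::real)"
          using ab by auto
        have "(\<Sum>i\<le>?D. (if i = a then 1 else if i = b then - 1 else 0) *\<^sub>R ?f i) =
            (\<Sum>i\<le>?D. (if i = a then ?f a else 0) + (if i = b then - ?f b else 0))"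
          using ab by (intro sum.cong) auto
        also have "\<dots> = ?f a - ?f b"
          using ab(1,2) by (simp only: sum.distrib) simp
        finally show "(\<Sum>i\<le>?D. (if i = a then 1 else if i = b then - 1 else (0::real)) *\<^sub>R ?f i) = 0"
          using ab by simp
      qed
    qed
    define p where "p = (\<Sum>i\<le>?D. monom (complex_of_real (u i)) i)"
    have cp: "coeff p i = (if i \<le> ?D then of_real (u i) else 0)" for i
      unfolding p_def by (simp add: coeff_sum)
    have "p \<noteq> 0"
      using u(1) cp by (metis coeff_0 of_real_eq_0_iff)
    moreover have "degree p \<le> ?D"
      by (rule degree_le) (simp add: cp)
    moreover have "S ?D p v0 = 0"
    proof -
      have "complex_of_real r *s w = r *\<^sub>R w" for r and w :: "complex^'n"
        by (simp add: vec_eq_iff scaleR_conv_of_real[where 'a=complex])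
      then show ?thesis
        using u(2) by (simp add: S_def cp)
    qed
    ultimately show ?thesis
      unfolding Q_def using v0 S_bound by metis
  qed
  then obtain d where d: "Q d" and least: "\<And>e. e < d \<Longrightarrow> \<not> Q e"
    using exists_least_iff[of Q] by blast
  then obtain p v where p: "p \<noteq> 0" "degree p = d" "v \<noteq> 0" "B v" "S d p v = 0"
    unfolding Q_def by blast
  have "d \<noteq> 0"
  proof
    assume "d = 0"
    with p(5) have "coeff p 0 *s v = 0" by (simp add: S_def)
    with p \<open>d = 0\<close> show False
      by (metis leading_coeff_0_iff vector_mul_eq_0)
  qed
  then have "\<not> constant (poly p)"
    using p(2) constant_degree by metis
  then obtain \<mu> where \<mu>: "poly p \<mu> = 0"
    using fundamental_theorem_of_algebra by blast
  then obtain q where q: "p = [:- \<mu>, 1:] * q"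
    using poly_eq_0_iff_dvd by (metis dvdE)
  then have q0: "q \<noteq> 0" using p(1) by auto
  have "degree p = Suc (degree q)"
    unfolding q by (subst degree_mult_eq) (use q0 in auto)
  then have dq: "degree q < d" using p(2) by simp
  have BS: "B (S N r v)" for N r
  proof -
    have 1: "B (((*v) A ^^ i) v)" for i
      by (induction i) (auto intro: inv p(4))
    show ?thesis
      unfolding S_def by (induction N) (use 1 p(4) in \<open>auto intro!: add scale 1 simp del: funpow.simps\<close>)
  qed
  define w where "w = S (degree q) q v"
  have "w \<noteq> 0"
    using least[OF dq] q0 p(3,4) unfolding Q_def w_def by blast
  moreover have "B w"
    unfolding w_def by (rule BS)
  moreover have "A *v w = \<mu> *s w"
  proof -
    have cf: "coeff p i = coeff (pCons 0 q) i - \<mu> * coeff q i" for i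
      unfolding q by simp
    have "S d p v = S d (pCons 0 q) v - \<mu> *s S d q v"
      unfolding S_def cf
      by (simp add: sum_subtractf vec.scale_left_diff_distrib vec.scale_sum_right)
    also have "S d q v = w"
      unfolding w_def using S_bound[of q d v] dq by simp
    also have "S d (pCons 0 q) v = A *v w"
    proof -
      obtain d' where d': "d = Suc d'" using \<open>d \<noteq> 0\<close> by (cases d) auto
      have "S d (pCons 0 q) v = (\<Sum>i\<le>d'. coeff q i *s (A *v ((*v) A ^^ i) v))"
        unfolding S_def d' by (subst sum.atMost_Suc_shift) simp
      also have "\<dots> = A *v (\<Sum>i\<le>d'. coeff q i *s ((*v) A ^^ i) v)"
        by (simp add: vec.sum vec.scale)
      also have "(\<Sum>i\<le>d'. coeff q i *s ((*v) A ^^ i) v) = w"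
        using S_bound[of q d' v] dq d' unfolding w_def S_def by simp
      finally show ?thesis .
    qed
    finally show ?thesis using p(5) by simp
  qed
  ultimately show ?thesis by blast
qed

text \<open>\<open>A'\<close> is the inverse of \<open>A\<close> wherever this is used. Orbits are
  two-sided because a contracted vector grows only in the past.\<close>

definition orbit :: "complex^'n^'n \<Rightarrow> complex^'n^'n \<Rightarrow> complex^'n \<Rightarrow> int \<Rightarrow> complex^'n::finite" where
  "orbit A A' v j = (if j \<ge> 0 then ((*v) A ^^ nat j) v else ((*v) A' ^^ nat (- j)) v)"

lemma orbit_Suc:
  fixes A :: "complex^'n::finite^'n"
  assumes "A ** A' = mat 1"
  shows "orbit A A' v (j + 1) = A *v orbit A A' v j"
proof (cases "j \<ge> 0")
  case True
  then show ?thesis by (simp add: orbit_def nat_add_distrib)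
next
  case False
  then obtain m where m: "j = - int (Suc m)"
    by (metis int_cases linorder_not_le of_nat_0_le_iff)
  then have "orbit A A' v j = A' *v ((*v) A' ^^ m) v"
    by (simp add: orbit_def nat_add_distrib)
  then have *: "A *v orbit A A' v j = ((*v) A' ^^ m) v"
    using assms by (simp add: matrix_vector_mul_assoc)
  show ?thesis
    unfolding * using m by (cases "m = 0") (auto simp: orbit_def)
qed

lemma orbit_pred:
  fixes A :: "complex^'n::finite^'n"
  assumes "A ** A' = mat 1" "A' ** A = mat 1"
  shows "A' *v orbit A A' v j = orbit A A' v (j - 1)"
  using orbit_Suc[OF assms(1), of v "j - 1"] assms(2)
  by (simp add: matrix_vector_mul_assoc)

lemma orbit_add:
  fixes A :: "complex^'n::finite^'n"
  assumes "A ** A' = mat 1" "A' ** A = mat 1"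
  shows "orbit A A' v (j + i) = orbit A A' (orbit A A' v j) i"
proof (induction i rule: int_induct[where k = 0])
  case base
  show ?case by (simp add: orbit_def)
next
  case (step1 i)
  then show ?case
    using orbit_Suc[OF assms(1), of v "j + i"] orbit_Suc[OF assms(1)] by (simp add: add.assoc)
next
  case (step2 i)
  then show ?case
    using orbit_pred[OF assms, of v "j + i"] orbit_pred[OF assms, of _ i] by (simp add: add_diff_eq)
qed

lemma continuous_orbit: "continuous_on S (\<lambda>v. orbit A A' v j)"
  for A :: "complex^'n::finite^'n"
proof -
  have "continuous_on S (\<lambda>v. ((*v) C ^^ k) v)" for C :: "complex^'n^'n" and k
    by (induction k) (auto intro!: continuous_intros matrix_vector_mult_linear_continuous_on[THEN continuous_on_compose2])
  then show ?thesis
    by (cases "j \<ge> 0") (simp_all add: orbit_def)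
qed


lemma norm_vector_scalar_mult: "norm (c *s v) = cmod c * norm v" for v :: "complex^'n::finite"
  by (simp add: norm_vec_def norm_mult L2_set_right_distrib)

lemma orbit_plus:
  fixes v w :: "complex^'n::finite"
  shows "orbit A A' (v + w) j = orbit A A' v j + orbit A A' w j"
proof -
  have "((*v) C ^^ k) (v + w) = ((*v) C ^^ k) v + ((*v) C ^^ k) w" for C :: "complex^'n^'n" and k
    by (induction k) (auto simp: matrix_vector_right_distrib)
  then show ?thesis by (simp add: orbit_def)
qed

lemma orbit_scale:
  fixes v :: "complex^'n::finite"
  shows "orbit A A' (c *s v) j = c *s orbit A A' v j"
proof -
  have "((*v) C ^^ k) (c *s v) = c *s ((*v) C ^^ k) v" for C :: "complex^'n^'n" and k
    by (induction k) (auto simp: vec.scale)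
  then show ?thesis by (simp add: orbit_def)
qed

text \<open>The vectors with bounded two-sided orbit form an invariant subspace. If it is nonzero it
  contains an eigenvector, whose orbit has norm |\<mu>|^j |w|; boundedness for all integers j leaves
  only |\<mu>| = 1.\<close>

lemma hyperbolic_orbit_unbounded:
  fixes A :: "complex^'n::finite^'n"
  assumes inv: "A ** A' = mat 1" "A' ** A = mat 1"
    and hyp: "\<forall>\<mu> v. v \<noteq> 0 \<and> A *v v = \<mu> *s v \<longrightarrow> cmod \<mu> \<noteq> 1"
    and "v \<noteq> 0"
  shows "\<exists>j. norm (orbit A A' v j) > C"
proof (rule ccontr)
  assume "\<not> ?thesis"
  then have C: "norm (orbit A A' v j) \<le> C" for j
    by (meson linorder_not_le)
  define B where "B w \<longleftrightarrow> (\<exists>C. \<forall>j. norm (orbit A A' w j) \<le> C)" for w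
  have step: "orbit A A' w (j + 1) = orbit A A' (A *v w) j" for w j
    using orbit_add[OF inv, of w 1 j] by (simp add: orbit_def add.commute)
  have "\<exists>\<mu> w. w \<noteq> 0 \<and> B w \<and> A *v w = \<mu> *s w"
  proof (rule eigenvector_in_invariant_subspace[of B _ v])
    show "B (x + y)" if "B x" "B y" for x y
      using that unfolding B_def orbit_plus by (meson add_mono norm_triangle_le)
    show "B (c *s x)" if "B x" for c x
      using that unfolding B_def orbit_scale norm_vector_scalar_mult
      by (meson mult_left_mono norm_ge_zero)
    show "B (A *v x)" if "B x" for x
      using that unfolding B_def step[symmetric] by blast
    show "B v" unfolding B_def using C by blast
  qed fact
  then obtain \<mu> w D where w: "w \<noteq> 0" "A *v w = \<mu> *s w" and D: "\<And>j. norm (orbit A A' w j) \<le> D"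
    unfolding B_def by blast
  have mult: "norm (orbit A A' w (j + int k)) = cmod \<mu> ^ k * norm (orbit A A' w j)" for j k
  proof (induction k)
    case (Suc k)
    have "orbit A A' w (j + int (Suc k)) = \<mu> *s orbit A A' w (j + int k)"
      using step[of w "j + int k"] by (simp add: w(2) orbit_scale algebra_simps)
    with Suc show ?case by (simp add: norm_vector_scalar_mult)
  qed simp
  have w0: "orbit A A' w 0 = w" by (simp add: orbit_def)
  consider "cmod \<mu> > 1" | "cmod \<mu> < 1"
    using hyp w by (meson linorder_neqE_linordered_idom)
  then show False
  proof cases
    case 1
    then obtain k where "D / norm w < cmod \<mu> ^ k"
      using real_arch_pow by blast
    then have "D < cmod \<mu> ^ k * norm w"
      using w by (simp add: field_simps)
    with mult[of 0 k] D[of "int k"] show False by (simp add: w0)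
  next
    case 2
    have "D \<ge> norm w" using D[of 0] w0 by simp
    then have "D > 0" using w by (smt (verit) zero_less_norm_iff)
    then obtain k where k: "cmod \<mu> ^ k < norm w / D"
      using real_arch_pow_inv[OF _ 2, of "norm w / D"] w by auto
    \<comment> \<open>For |\<mu>| < 1 the orbit blows up at negative times.\<close>
    have "norm w = cmod \<mu> ^ k * norm (orbit A A' w (- int k))"
      using mult[of "- int k" k] w0 by simp
    also have "\<dots> \<le> cmod \<mu> ^ k * D"
      by (intro mult_left_mono D) auto
    also have "\<dots> < norm w" using k \<open>D > 0\<close> by (simp add: field_simps)
    finally show False by simp
  qed
qed

text \<open>Each unit vector exceeds norm 2 at some time, which is an open condition; finitely many
  times therefore cover the sphere, and homogeneity extends the bound to all vectors.\<close>

lemma hyperbolic_uniform_growth: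
  fixes A :: "complex^'n::finite^'n"
  assumes inv: "A ** A' = mat 1" "A' ** A = mat 1"
    and hyp: "\<forall>\<mu> v. v \<noteq> 0 \<and> A *v v = \<mu> *s v \<longrightarrow> cmod \<mu> \<noteq> 1"
  shows "\<exists>N::nat. \<forall>v. \<exists>i. \<bar>i\<bar> \<le> int N \<and> norm (orbit A A' v i) \<ge> 2 * norm v"
proof -
  let ?S = "sphere (0::complex^'n) 1"
  have cover: "?S \<subseteq> (\<Union>j\<in>UNIV. {v. norm (orbit A A' v j) > 2})"
  proof
    fix v :: "complex^'n" assume "v \<in> ?S"
    then have "v \<noteq> 0" by auto
    with hyperbolic_orbit_unbounded[OF inv hyp] show "v \<in> (\<Union>j\<in>UNIV. {v. norm (orbit A A' v j) > 2})"
      by auto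
  qed
  have "open {v. norm (orbit A A' v j) > 2}" for j
    by (intro open_Collect_less continuous_intros continuous_orbit)
  then have "\<exists>F\<subseteq>UNIV. finite F \<and> ?S \<subseteq> (\<Union>j\<in>F. {v. norm (orbit A A' v j) > 2})"
    using compactE_image[OF compact_sphere _ cover] by metis
  then obtain F where F: "finite F" "\<And>v. norm v = 1 \<Longrightarrow> \<exists>j\<in>F. norm (orbit A A' v j) > 2"
    by (auto simp: subset_iff)
  define N where "N = nat (Max (insert 0 (abs ` F)))"
  have N: "\<bar>j\<bar> \<le> int N" if "j \<in> F" for j
    proof -
    have "\<bar>j\<bar> \<le> Max (insert 0 (abs ` F))" using F(1) that by (intro Max_ge) auto
    then show ?thesis by (simp add: N_def le_nat_iff order_trans[OF abs_ge_zero])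
  qed
  have "\<exists>i. \<bar>i\<bar> \<le> int N \<and> norm (orbit A A' v i) \<ge> 2 * norm v" for v
  proof (cases "v = 0")
    case True
    then show ?thesis by (intro exI[of _ 0]) simp
  next
    case False
    define u where "u = complex_of_real (1 / norm v) *s v"
    have "norm u = 1" using False by (simp add: u_def norm_vector_scalar_mult norm_divide)
    then obtain j where j: "j \<in> F" "norm (orbit A A' u j) > 2" using F by blast
    then show ?thesis
      using N[of j] False
      by (intro exI[of _ j]) (auto simp: u_def orbit_scale norm_vector_scalar_mult norm_divide field_simps)
  qed
  then show ?thesis by blast
qed

section \<open>Counting the visits of an orbit to a given scale\<close>

text \<open>Comparable to min(t/s, s/t), and equal to the derivative of t/(t + s) with respect to
  log t. It is bounded below where t and s agree up to a factor, which counts visits, and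
  \<open>bump t 1\<close> is about 1/t for t \<ge> 1.\<close>

definition bump :: "real \<Rightarrow> real \<Rightarrow> real" where
  "bump t s = t * s / (t + s)\<^sup>2"

text \<open>The function t/(t + s) increases in t, so the worst case is t' = 2 t, where its
  increment is t s/((2 t + s)(t + s)), at least half of \<open>bump t s\<close>.\<close>

lemma bump_le_increment:
  assumes "t > 0" "s > 0" "t' \<ge> 2 * t"
  shows "bump t s \<le> 2 * (t' / (t' + s) - t / (t + s))"
proof -
  have 1: "2 * t / (2 * t + s) \<le> t' / (t' + s)"
    using assms by (simp add: field_simps)
  have 2: "2 * t / (2 * t + s) - t / (t + s) = t * s / ((2 * t + s) * (t + s))"
    using assms by (simp add: field_simps)
  have 3: "t * s / (2 * (t + s)\<^sup>2) \<le> t * s / ((2 * t + s) * (t + s))"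
  proof (intro divide_left_mono)
    show "(2 * t + s) * (t + s) \<le> 2 * (t + s)\<^sup>2"
      using assms by (simp add: power2_eq_square algebra_simps)
    have "2 * t + s > 0" "t + s > 0" using assms by auto
    then show "0 < 2 * (t + s)\<^sup>2 * ((2 * t + s) * (t + s))" by (simp add: power2_eq_square)
  qed (use assms in auto)
  have "bump t s = 2 * (t * s / (2 * (t + s)\<^sup>2))"
    by (simp add: bump_def)
  also have "\<dots> \<le> 2 * (2 * t / (2 * t + s) - t / (t + s))"
    unfolding 2 using 3 by (rule mult_left_mono) simp
  also have "\<dots> \<le> 2 * (t' / (t' + s) - t / (t + s))"
    using 1 by (intro mult_left_mono) auto
  finally show ?thesis .
qed

text \<open>The sequence first decreases and then increases, in both cases at least by the factor 2.
  Hence \<open>c\<^sub>m / (c\<^sub>m + s)\<close>, with the sign reversed on the decreasing part, is a monotone bounded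
  function whose increments dominate the terms of the sum.\<close>

lemma sum_bump_doubling:
  fixes c :: "int \<Rightarrow> real"
  assumes pos: "\<And>m. c m > 0" and s: "s > 0"
    and dbl: "\<And>m. c (m - 1) \<ge> 2 * c m \<or> c (m + 1) \<ge> 2 * c m"
  shows "(\<Sum>m = -int P..int P. bump (c m) s) \<le> 8"
proof -
  define U where "U = {m. c (m + 1) \<ge> 2 * c m}"
  define \<Phi> where "\<Phi> m = (if m \<in> U then c m / (c m + s) else - c m / (c m + s))" for m
  have F01: "0 \<le> c m / (c m + s)" "c m / (c m + s) \<le> 1" for m
    using pos[of m] s by (auto simp: field_simps)
  have \<Phi>1: "\<bar>\<Phi> m\<bar> \<le> 1" for m
    using F01[of m] unfolding \<Phi>_def abs_le_iff by auto
  \<comment> \<open>Doubling forwards at m rules out doubling backwards at m + 1, so growth, once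
    started, continues.\<close>
  have up: "m + 1 \<in> U" if "m \<in> U" for m
    using that dbl[of "m + 1"] pos[of m] by (auto simp: U_def)
  have D: "c (m - 1) \<ge> 2 * c m" if "m \<notin> U" for m
    using that dbl[of m] by (auto simp: U_def)
  have incr: "\<Phi> (m + 1) - \<Phi> m \<ge> (if m \<in> U then bump (c m) s / 2 else 0)"
    "\<Phi> (m + 1) - \<Phi> m \<ge> (if m + 1 \<notin> U then bump (c (m + 1)) s / 2 else 0)" for m
  proof -
    have b0: "bump (c m) s \<ge> 0" for m
      using pos[of m] s by (simp add: bump_def)
    consider "m \<in> U" "m + 1 \<in> U" | "m \<notin> U" "m + 1 \<in> U" | "m \<notin> U" "m + 1 \<notin> U"
      using up by blast
    then have "\<Phi> (m + 1) - \<Phi> m \<ge> (if m \<in> U then bump (c m) s / 2 else 0) \<and>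
      \<Phi> (m + 1) - \<Phi> m \<ge> (if m + 1 \<notin> U then bump (c (m + 1)) s / 2 else 0)"
    proof cases
      case 1
      then have "bump (c m) s \<le> 2 * (\<Phi> (m + 1) - \<Phi> m)"
        using bump_le_increment[OF pos s, of m "c (m + 1)"] by (simp add: U_def \<Phi>_def)
      with 1 b0[of m] show ?thesis by auto
    next
      case 2
      then show ?thesis using F01[of m] F01[of "m + 1"] by (simp add: \<Phi>_def)
    next
      case 3
      then have "bump (c (m + 1)) s \<le> 2 * (\<Phi> (m + 1) - \<Phi> m)"
        using bump_le_increment[OF pos s, of "m + 1" "c m"] D[of "m + 1"] by (simp add: \<Phi>_def)
      with 3 b0[of "m + 1"] show ?thesis by auto
    qed
    then show "\<Phi> (m + 1) - \<Phi> m \<ge> (if m \<in> U then bump (c m) s / 2 else 0)"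
      "\<Phi> (m + 1) - \<Phi> m \<ge> (if m + 1 \<notin> U then bump (c (m + 1)) s / 2 else 0)" by blast+
  qed
  \<comment> \<open>The bump at m is paid by the increment from m to m + 1 if m is in
    \<open>U\<close>, and by the one from m - 1 to m otherwise; the other increment is nonnegative.
    These differences of step two telescope to four boundary values of modulus at most 1, and the
    factor 2 gives the bound 8.\<close>
  have summand: "bump (c m) s \<le> 2 * (\<Phi> (m + 1) - \<Phi> (m - 1))" for m
    using incr(1)[of m] incr(2)[of "m - 1"] incr(2)[of m] incr(1)[of "m - 1"]
    by (auto split: if_splits simp: bump_def)
  have "(\<Sum>m = -int P..int P. bump (c m) s) \<le>
      2 * (\<Phi> (int P + 1) + \<Phi> (int P) - \<Phi> (- int P) - \<Phi> (- int P - 1))"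
  proof (induction P)
    case 0
    then show ?case using summand[of 0] by simp
  next
    case (Suc P)
    have "{- int (Suc P)..int (Suc P)} =
        insert (int P + 1) (insert (- int P - 1) {- int P..int P})" by auto
    then have "(\<Sum>m = - int (Suc P)..int (Suc P). bump (c m) s) =
        bump (c (int P + 1)) s + bump (c (- int P - 1)) s + (\<Sum>m = -int P..int P. bump (c m) s)"
      by simp
    moreover have "bump (c (int P + 1)) s \<le> 2 * (\<Phi> (int P + 2) - \<Phi> (int P))"
      "bump (c (- int P - 1)) s \<le> 2 * (\<Phi> (- int P) - \<Phi> (- int P - 2))"
      using summand[of "int P + 1"] summand[of "- int P - 1"] by (simp_all add: add.commute diff_diff_eq)
    moreover have "int (Suc P) = int P + 1" "int P + 1 + 1 = int P + 2"
      "- (int P + 1) = - int P - 1" "- int P - 1 - 1 = - int P - 2" by auto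
    moreover have "b1 + b2 + S \<le> 2 * (f2 + f1 - g1 - g2)"
      if "b1 \<le> 2 * (f2 - f0)" "b2 \<le> 2 * (g0 - g2)" "S \<le> 2 * (f1 + f0 - g0 - g1)"
      for b1 b2 S f0 f1 f2 g0 g1 g2 :: real
      using that by (simp add: algebra_simps)
    ultimately show ?case using Suc by (simp only:)
  qed
  also have "\<dots> \<le> 8"
    using \<Phi>1[of "int P + 1"] \<Phi>1[of "int P"] \<Phi>1[of "- int P"] \<Phi>1[of "- int P - 1"] by (simp add: abs_le_iff)
  finally show ?thesis .
qed


text \<open>Growth happens at an unspecified time within N, so time is cut into blocks of length N
  and the sequence is replaced by its block maxima. From the place of its maximum a block doubles
  into a neighbouring one, so the maxima satisfy the hypothesis of \<open>sum_bump_doubling\<close>;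
  inside a block all values agree up to the factor K^N, whose square enters the bound.\<close>

lemma sum_bump_recurrent:
  fixes a :: "int \<Rightarrow> real"
  assumes pos: "\<And>j. a j > 0" and K: "K \<ge> 1"
    and up: "\<And>j. a (j + 1) \<le> K * a j" and down: "\<And>j. a j \<le> K * a (j + 1)"
    and growth: "\<And>j. \<exists>i. \<bar>i\<bar> \<le> int N \<and> a (j + i) \<ge> 2 * a j"
    and s: "s > 0" and F: "finite F"
  shows "(\<Sum>j\<in>F. bump (a j) s) \<le> (K ^ N)\<^sup>2 * real N * 8"
proof -
  have N: "N > 0"
  proof (rule ccontr)
    assume "\<not> ?thesis"
    with growth[of 0] pos[of 0] show False by auto
  qed
  define I where "I m = {m * int N..<m * int N + int N}" for m
  have I: "finite (I m)" "I m \<noteq> {}" for m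
    using N by (auto simp: I_def)
  have in_I: "j \<in> I m \<longleftrightarrow> j div int N = m" for j m
  proof
    assume "j \<in> I m"
    then show "j div int N = m"
      by (intro int_div_pos_eq[of _ _ _ "j - m * int N"]) (auto simp: I_def algebra_simps)
  next
    assume "j div int N = m"
    moreover have "j = (j div int N) * int N + j mod int N" by simp
    moreover have "0 \<le> j mod int N" "j mod int N < int N" using N by auto
    ultimately show "j \<in> I m" unfolding I_def by auto
  qed
  define c where "c m = Max (a ` I m)" for m
  have c_ge: "a j \<le> c m" if "j \<in> I m" for j m
    unfolding c_def using that I by auto
  have c_attained: "\<exists>j\<in>I m. c m = a j" for m
  proof -
    have "c m \<in> a ` I m"
      unfolding c_def by (rule Max_in) (use I in auto)
    then show ?thesis by blast
  qed
  have cpos: "c m > 0" for m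
    using c_attained[of m] pos by auto
  have iter: "a (j + int k) \<le> K ^ k * a j" "a j \<le> K ^ k * a (j + int k)" for j k
  proof (induction k)
    case (Suc k)
    {
      case 1
      have "a (j + int (Suc k)) \<le> K * a (j + int k)"
        using up[of "j + int k"] by (simp add: algebra_simps)
      also have "\<dots> \<le> K * (K ^ k * a j)"
        using Suc K by (intro mult_left_mono) auto
      finally show ?case by simp
    next
      case 2
      have "a j \<le> K ^ k * a (j + int k)" by fact
      also have "\<dots> \<le> K ^ k * (K * a (j + int (Suc k)))"
        using down[of "j + int k"] K by (intro mult_left_mono) (auto simp: algebra_simps)
      finally show ?case by (simp add: algebra_simps)
    }
  qed auto
  have c_le: "c m \<le> K ^ N * a j" if "j \<in> I m" for j m
  proof -
    obtain i where i: "i \<in> I m" "c m = a i" using c_attained by blast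
    have le: "K ^ nat \<bar>i - j\<bar> * a j \<le> K ^ N * a j"
      using i that K pos[of j] by (intro mult_right_mono power_increasing) (auto simp: I_def)
    have "a i \<le> K ^ nat \<bar>i - j\<bar> * a j"
    proof (cases "i \<ge> j")
      case True
      with iter(1)[of j "nat (i - j)"] show ?thesis by simp
    next
      case False
      with iter(2)[of i "nat (j - i)"] show ?thesis by simp
    qed
    with le i show ?thesis by simp
  qed
  have dbl: "c (m - 1) \<ge> 2 * c m \<or> c (m + 1) \<ge> 2 * c m" for m
  proof -
    obtain j where j: "j \<in> I m" "c m = a j" using c_attained by blast
    obtain i where i: "\<bar>i\<bar> \<le> int N" "a (j + i) \<ge> 2 * a j" using growth by blast
    \<comment> \<open>A move by at most N stays in the block or reaches an adjacent one; the former
      is excluded since \<open>c m\<close> is the maximum of its block.\<close>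
    have "j + i \<in> I (m - 1) \<or> j + i \<in> I m \<or> j + i \<in> I (m + 1)"
      using j i by (auto simp: I_def algebra_simps)
    then show ?thesis
      using c_ge[of "j + i"] j i cpos[of m] by fastforce
  qed
  define L where "L = K ^ N"
  have L: "L \<ge> 1" using K by (simp add: L_def)
  \<comment> \<open>The numerator grows from \<open>a j\<close> to \<open>c m\<close>, and c m + s
    \<le> L (a j + s) because L \<ge> 1; the squared denominator costs L^2.\<close>
  have cmp: "bump (a j) s \<le> L\<^sup>2 * bump (c m) s" if "j \<in> I m" "s > 0" for j m s
  proof -
    have *: "1 / x \<le> l / y" if "y \<le> l * x" "x > 0" "y > 0" for x y l :: real
      using that by (simp add: field_simps)
    have 1: "a j \<le> c m" "c m \<le> L * a j" using c_ge c_le that by (auto simp: L_def)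
    have "s \<le> L * s" using that L by simp
    with 1 have "c m + s \<le> L * (a j + s)" by (simp add: algebra_simps)
    then have "(c m + s)\<^sup>2 \<le> (L * (a j + s))\<^sup>2"
      using cpos[of m] that by (intro power_mono) auto
    then have "(c m + s)\<^sup>2 \<le> L\<^sup>2 * (a j + s)\<^sup>2" by (simp only: power_mult_distrib)
    then have 2: "1 / (a j + s)\<^sup>2 \<le> L\<^sup>2 / (c m + s)\<^sup>2"
      using pos[of j] cpos[of m] that by (intro *) (simp_all add: add_pos_pos)
    have "(a j * s) * (1 / (a j + s)\<^sup>2) \<le> (c m * s) * (L\<^sup>2 / (c m + s)\<^sup>2)"
      using 1 2 that pos[of j] cpos[of m] by (intro mult_mono) auto
    then show ?thesis by (simp add: bump_def mult.commute)
  qed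
  have b0: "bump (c m) s \<ge> 0" if "s > 0" for m s
    using cpos[of m] that by (simp add: bump_def)
  show ?thesis
  proof -
    let ?M = "(\<lambda>j. j div int N) ` F"
    have "(\<Sum>j\<in>F. bump (a j) s) \<le> (\<Sum>j\<in>F. L\<^sup>2 * bump (c (j div int N)) s)"
      using cmp s by (intro sum_mono) (auto simp: in_I)
    also have "\<dots> = (\<Sum>m\<in>?M. \<Sum>j\<in>{j\<in>F. j div int N = m}. L\<^sup>2 * bump (c (j div int N)) s)"
      using F by (rule sum.image_gen)
    also have "\<dots> = (\<Sum>m\<in>?M. real (card {j\<in>F. j div int N = m}) * (L\<^sup>2 * bump (c m) s))"
      by (intro sum.cong) auto
    also have "\<dots> \<le> (\<Sum>m\<in>?M. real N * (L\<^sup>2 * bump (c m) s))"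
    proof (intro sum_mono mult_right_mono)
      fix m
      have "card {j\<in>F. j div int N = m} \<le> card (I m)"
        by (intro card_mono) (auto simp: in_I I)
      then show "real (card {j\<in>F. j div int N = m}) \<le> real N"
        by (simp add: I_def)
    qed (use b0 s in auto)
    also have "\<dots> = L\<^sup>2 * real N * (\<Sum>m\<in>?M. bump (c m) s)"
      by (simp add: sum_distrib_left mult_ac)
    also have "\<dots> \<le> L\<^sup>2 * real N * 8"
    proof (intro mult_left_mono)
      define P where "P = nat (Max (insert 0 (abs ` ?M)))"
      have "\<bar>m\<bar> \<le> int P" if "m \<in> ?M" for m
      proof -
        have "\<bar>m\<bar> \<le> Max (insert 0 (abs ` ?M))" using F that by (intro Max_ge) auto
        then show ?thesis by (simp add: P_def le_nat_iff order_trans[OF abs_ge_zero])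
      qed
      then have "?M \<subseteq> {- int P..int P}" by (force simp: abs_le_iff)
      then have "(\<Sum>m\<in>?M. bump (c m) s) \<le> (\<Sum>m = -int P..int P. bump (c m) s)"
        using b0 s by (intro sum_mono2) auto
      also have "\<dots> \<le> 8" by (rule sum_bump_doubling[OF cpos s dbl])
      finally show "(\<Sum>m\<in>?M. bump (c m) s) \<le> 8" .
    qed simp
    finally show ?thesis by (simp add: L_def)
  qed
qed

text \<open>The doubling time N and the common Lipschitz constant K of \<open>A\<close> and its
  inverse are the same along every orbit, so C is independent of v and s.\<close>

lemma hyperbolic_sum_bump:
  fixes A :: "complex^'n::finite^'n"
  assumes inv: "A ** A' = mat 1" "A' ** A = mat 1"
    and hyp: "\<forall>\<mu> v. v \<noteq> 0 \<and> A *v v = \<mu> *s v \<longrightarrow> cmod \<mu> \<noteq> 1"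
  shows "\<exists>C. \<forall>v s F. v \<noteq> 0 \<longrightarrow> s > 0 \<longrightarrow> finite F \<longrightarrow> (\<Sum>j\<in>F. bump (norm (orbit A A' v j)) s) \<le> C"
proof -
  obtain N where N: "\<And>v. \<exists>i. \<bar>i\<bar> \<le> int N \<and> norm (orbit A A' v i) \<ge> 2 * norm v"
    using hyperbolic_uniform_growth[OF inv hyp] by blast
  have "\<exists>K. \<forall>v. norm (C *v v) \<le> K * norm v" for C :: "complex^'n^'n"
    using bounded_linear.bounded[OF matrix_vector_mul_bounded_linear, of C] by (simp add: mult.commute)
  then obtain K1 K2 where K12: "\<And>v. norm (A *v v) \<le> K1 * norm v" "\<And>v. norm (A' *v v) \<le> K2 * norm v"
    by metis
  \<comment> \<open>K \<ge> 1 makes its powers increase with the distance of two times, so K^N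
    controls a whole block.\<close>
  define K where "K = max 1 (max K1 K2)"
  have K: "norm (A *v v) \<le> K * norm v" "norm (A' *v v) \<le> K * norm v" for v
    using order_trans[OF K12(1) mult_right_mono[of K1 K]] order_trans[OF K12(2) mult_right_mono[of K2 K]]
    by (simp_all add: K_def)
  have "(\<Sum>j\<in>F. bump (norm (orbit A A' v j)) s) \<le> (K ^ N)\<^sup>2 * real N * 8"
    if v: "v \<noteq> 0" and s: "s > 0" and F: "finite F" for v s F
  proof (rule sum_bump_recurrent[OF _ _ _ _ _ s F])
    show "K \<ge> 1" by (simp add: K_def)
    show "norm (orbit A A' v (j + 1)) \<le> K * norm (orbit A A' v j)" for j
      unfolding orbit_Suc[OF inv(1)] by (rule K)
    show "norm (orbit A A' v j) \<le> K * norm (orbit A A' v (j + 1))" for j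
      using K(2)[of "orbit A A' v (j + 1)"] orbit_pred[OF inv, of v "j + 1"] by simp
    show "\<exists>i. \<bar>i\<bar> \<le> int N \<and> 2 * norm (orbit A A' v j) \<le> norm (orbit A A' v (j + i))" for j
      unfolding orbit_add[OF inv] by (rule N)
    have "orbit A A' v j \<noteq> 0" for j
    proof
      assume "orbit A A' v j = 0"
      then have "orbit A A' v (j + - j) = orbit A A' 0 (- j)"
        unfolding orbit_add[OF inv] by simp
      also have "\<dots> = 0"
        using orbit_scale[of A A' 0 0] by simp
      finally show False using v by (simp add: orbit_def)
    qed
    then show "norm (orbit A A' v j) > 0" for j by simp
  qed
  then show ?thesis by blast
qed

section \<open>Sums over countable index sets\<close>

text \<open>The convergence theorems for integrals of series are indexed by natural numbers, Fourier
  series by integer vectors; on an infinite countable type this enumeration is a bijection.\<close>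

abbreviation enum :: "nat \<Rightarrow> 'i::countable" where
  "enum \<equiv> from_nat_into UNIV"

lemma bij_enum: "infinite (UNIV :: 'i::countable set) \<Longrightarrow> bij_betw (enum :: nat \<Rightarrow> 'i) UNIV UNIV"
  by (rule bij_betw_from_nat_into) auto

lemma summable_enum_iff:
  fixes f :: "'i::countable \<Rightarrow> real"
  assumes "infinite (UNIV :: 'i set)" "\<And>i. f i \<ge> 0"
  shows "summable (\<lambda>n. f (enum n)) \<longleftrightarrow> f summable_on UNIV"
proof -
  have "f summable_on UNIV \<longleftrightarrow> (\<lambda>n. f (enum n)) summable_on UNIV"
    using summable_on_reindex_bij_betw[OF bij_enum[OF assms(1)], of f] by simp
  also have "\<dots> \<longleftrightarrow> summable (\<lambda>n. f (enum n))"
    using norm_summable_imp_summable_on[of "\<lambda>n. f (enum n)"] assms(2)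
    by (auto dest: summable_on_imp_summable)
  finally show ?thesis by simp
qed

lemma infsum_enum:
  fixes f :: "'i::countable \<Rightarrow> 'b::banach"
  assumes "infinite (UNIV :: 'i set)" "(\<lambda>i. norm (f i)) summable_on UNIV"
  shows "infsum f UNIV = (\<Sum>n. f (enum n))"
proof -
  have *: "(\<lambda>n. f (enum n)) summable_on UNIV"
    using summable_on_reindex_bij_betw[OF bij_enum[OF assms(1)], of f] abs_summable_summable[OF assms(2)]
    by simp
  have "infsum f UNIV = infsum (\<lambda>n. f (enum n)) UNIV"
    using infsum_reindex_bij_betw[OF bij_enum[OF assms(1)], of f] by simp
  also have "\<dots> = (\<Sum>n. f (enum n))"
    using has_sum_imp_sums[OF has_sum_infsum[OF *]] by (simp add: sums_iff)
  finally show ?thesis .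
qed

lemma infinite_vec: "infinite (UNIV :: (int^'n::finite) set)"
proof
  assume "finite (UNIV :: (int^'n) set)"
  then have "finite (range (\<lambda>j. (\<chi> i. j) :: int^'n))"
    by (rule finite_subset[rotated]) simp
  moreover have "inj (\<lambda>j. (\<chi> i. j) :: int^'n)"
    by (auto simp: inj_def vec_eq_iff)
  ultimately show False
    using finite_imageD infinite_UNIV_int by metis
qed

lemma abs_summable_bounded:
  fixes q :: "'i \<Rightarrow> complex"
  assumes "(\<lambda>i. norm (q i)) summable_on UNIV" "\<And>i. norm (g i) \<le> C"
  shows "(\<lambda>i. norm (q i * g i)) summable_on UNIV"
proof (rule Infinite_Sum.abs_summable_on_comparison_test[of "\<lambda>i. of_real C * q i"])
  show "(\<lambda>i. norm (of_real C * q i)) summable_on UNIV"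
    using summable_on_cmult_right[OF assms(1), of "\<bar>C\<bar>"] by (simp add: norm_mult)
  show "norm (q i * g i) \<le> norm (of_real C * q i)" for i
    using mult_right_mono[OF order_trans[OF assms(2)[of i] abs_ge_self], of "norm (q i)"]
    by (simp add: norm_mult mult.commute)
qed

text \<open>The terms are dominated by |q i| |\<phi>|, whose integrals are summable. On the torus
  this is applied with \<phi> cut off to the cube, for multipliers with \<phi> on the whole
  space.\<close>

lemma integral_infsum:
  fixes q :: "'i::countable \<Rightarrow> complex" and E :: "'i \<Rightarrow> 'a \<Rightarrow> complex"
  assumes inf: "infinite (UNIV :: 'i set)" and q: "(\<lambda>i. norm (q i)) summable_on UNIV"
    and E: "\<And>i. E i \<in> borel_measurable M" "\<And>i x. norm (E i x) \<le> 1"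
    and \<phi>: "integrable M \<phi>"
  shows "integrable M (\<lambda>x. (\<Sum>\<^sub>\<infinity>i. q i * E i x) * \<phi> x)"
    and "(\<integral>x. (\<Sum>\<^sub>\<infinity>i. q i * E i x) * \<phi> x \<partial>M) = (\<Sum>\<^sub>\<infinity>i. q i * (\<integral>x. E i x * \<phi> x \<partial>M))"
proof -
  define f where "f n x = q (enum n) * (E (enum n) x * \<phi> x)" for n x
  have E\<phi>: "integrable M (\<lambda>x. E i x * \<phi> x)" for i
  proof (rule Bochner_Integration.integrable_bound[OF \<phi>])
    show "(\<lambda>x. E i x * \<phi> x) \<in> borel_measurable M" using E \<phi> by auto
    show "AE x in M. norm (E i x * \<phi> x) \<le> norm (\<phi> x)"
      using E(2)[of i] by (auto simp: norm_mult intro!: mult_left_le_one_le)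
  qed
  have sq: "summable (\<lambda>n. norm (q (enum n)))"
    using q summable_enum_iff[OF inf, of "\<lambda>i. norm (q i)"] by simp
  have f: "integrable M (f n)" for n
    unfolding f_def using E\<phi> by (rule integrable_mult_right)
  have nf: "norm (f n x) \<le> norm (q (enum n)) * norm (\<phi> x)" for n x
    unfolding f_def using E(2)[of "enum n" x] by (auto simp: norm_mult intro!: mult_left_mono mult_left_le_one_le)
  have s1: "summable (\<lambda>n. norm (f n x))" for x
    by (rule summable_comparison_test[OF _ summable_mult2[OF sq, of "norm (\<phi> x)"]]) (use nf in auto)
  have s2: "summable (\<lambda>n. \<integral>x. norm (f n x) \<partial>M)"
  proof (rule summable_comparison_test[OF _ summable_mult2[OF sq, of "\<integral>x. norm (\<phi> x) \<partial>M"]], intro exI allI impI)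
    fix n
    have "(\<integral>x. norm (f n x) \<partial>M) \<le> (\<integral>x. norm (q (enum n)) * norm (\<phi> x) \<partial>M)"
      using f \<phi> nf by (intro integral_mono) auto
    then show "norm (\<integral>x. norm (f n x) \<partial>M) \<le> norm (q (enum n)) * (\<integral>x. norm (\<phi> x) \<partial>M)"
      using \<phi> by (simp add: abs_of_nonneg integral_nonneg_AE)
  qed
  have eq: "(\<Sum>\<^sub>\<infinity>i. q i * E i x) * \<phi> x = (\<Sum>n. f n x)" for x
  proof -
    have "(\<Sum>\<^sub>\<infinity>i. q i * E i x) * \<phi> x = (\<Sum>\<^sub>\<infinity>i. q i * E i x * \<phi> x)"
      by (simp add: infsum_cmult_left')
    also have "\<dots> = (\<Sum>\<^sub>\<infinity>i. q i * (E i x * \<phi> x))" by (simp add: mult.assoc)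
    also have "\<dots> = (\<Sum>n. f n x)"
      unfolding f_def
      by (rule infsum_enum[OF inf abs_summable_bounded[OF q, where C = "norm (\<phi> x)"]])
         (use E(2) in \<open>auto simp: norm_mult intro!: mult_left_le_one_le\<close>)
    finally show ?thesis .
  qed
  show "integrable M (\<lambda>x. (\<Sum>\<^sub>\<infinity>i. q i * E i x) * \<phi> x)"
    unfolding eq by (rule integrable_suminf[OF f _ s2]) (use s1 in auto)
  have "(\<integral>x. (\<Sum>\<^sub>\<infinity>i. q i * E i x) * \<phi> x \<partial>M) = (\<Sum>n. \<integral>x. f n x \<partial>M)"
    unfolding eq by (rule integral_suminf[OF f _ s2]) (use s1 in auto)
  also have "\<dots> = (\<Sum>n. q (enum n) * (\<integral>x. E (enum n) x * \<phi> x \<partial>M))"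
    unfolding f_def by simp
  also have "\<dots> = (\<Sum>\<^sub>\<infinity>i. q i * (\<integral>x. E i x * \<phi> x \<partial>M))"
  proof (rule infsum_enum[symmetric, OF inf abs_summable_bounded[OF q]])
    fix i
    have "norm (\<integral>x. E i x * \<phi> x \<partial>M) \<le> (\<integral>x. norm (E i x * \<phi> x) \<partial>M)"
      by (rule integral_norm_bound)
    also have "\<dots> \<le> (\<integral>x. norm (\<phi> x) \<partial>M)"
      using E(2)[of i] integrable_norm[OF E\<phi>[of i]] integrable_norm[OF \<phi>]
      by (intro integral_mono) (simp_all add: norm_mult mult_left_le_one_le)
    finally show "norm (\<integral>x. E i x * \<phi> x \<partial>M) \<le> (\<integral>x. norm (\<phi> x) \<partial>M)" .
  qed
  finally show "(\<integral>x. (\<Sum>\<^sub>\<infinity>i. q i * E i x) * \<phi> x \<partial>M) = (\<Sum>\<^sub>\<infinity>i. q i * (\<integral>x. E i x * \<phi> x \<partial>M))" .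
qed

section \<open>Unfolding integrals over the lattice\<close>

lemma lattice_simps [simp]:
  "lattice 0 = 0" "lattice (k + l) = lattice k + lattice l"
  "lattice (- k) = - lattice k" "lattice (k - l) = lattice k - lattice l" "lattice k $ i = of_int (k $ i)"
  by (simp_all add: lattice_def vec_eq_iff)

text \<open>The half-open cube contains exactly one point of each lattice coset, so its translates
  tile the space without overlaps; it differs from the closed cube of \<open>torus_integral\<close>
  by a null set.\<close>

definition unit_cell :: "(real^'n::finite) set" where
  "unit_cell = {x. \<forall>i. 0 \<le> x $ i \<and> x $ i < 1}"

lemma unit_cell_translate: "x + lattice k \<in> unit_cell \<longleftrightarrow> k = (\<chi> i. - \<lfloor>x $ i\<rfloor>)"
proof -
  have "0 \<le> x $ i + of_int (k $ i) \<and> x $ i + of_int (k $ i) < 1 \<longleftrightarrow> k $ i = - \<lfloor>x $ i\<rfloor>" for i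
    by linarith
  then show ?thesis
    by (simp add: unit_cell_def vec_eq_iff)
qed

lemma unit_cell_borel [measurable]: "(unit_cell :: (real^'n::finite) set) \<in> sets borel"
proof -
  have "{x :: real^'n. 0 \<le> x $ i} \<in> sets borel" "{x :: real^'n. x $ i < 1} \<in> sets borel" for i
    by (intro borel_closed borel_open closed_Collect_le open_Collect_less continuous_intros)+
  then have "(\<Inter>i. {x :: real^'n. 0 \<le> x $ i} \<inter> {x. x $ i < 1}) \<in> sets borel"
    by (intro sets.finite_INT sets.Int) auto
  also have "(\<Inter>i. {x :: real^'n. 0 \<le> x $ i} \<inter> {x. x $ i < 1}) = unit_cell"
    by (auto simp: unit_cell_def)
  finally show ?thesis .
qed

lemma AE_unit_cell: "AE x::real^'n::finite in lborel. x \<in> unit_cell \<longleftrightarrow> x \<in> cbox 0 1"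
proof -
  let ?N = "cbox 0 (1::real^'n) - box 0 1"
  have "?N \<in> null_sets (completion lborel)"
    using negligible_frontier_interval[of "0::real^'n" 1] negligible_iff_null_sets by blast
  then have "?N \<in> null_sets lborel"
    by (simp add: null_sets_completion_iff)
  then show ?thesis
    by (rule AE_I') (auto simp: unit_cell_def mem_box_cart less_imp_le)
qed

text \<open>Exactly one translate of the cell contains y, so each series has a single term that can
  be nonzero.\<close>

lemma sum_indicator_unit_cell:
  "(\<lambda>n. indicator unit_cell (y - lattice (enum n)) * (c::ennreal)) sums c"
  "(\<lambda>n. indicat_real unit_cell (y - lattice (enum n)) *\<^sub>R (z::'b::real_normed_vector)) sums z"
proof -
  define k where "k = (\<chi> i. \<lfloor>y $ i\<rfloor>)"
  obtain m where m: "enum m = k"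
    using bij_enum[OF infinite_vec] by (metis bij_betw_def rangeE UNIV_I)
  have inj: "enum n = k \<longleftrightarrow> n = m" for n
    using bij_enum[OF infinite_vec] m by (metis bij_betw_def injD)
  have "y - lattice l \<in> unit_cell \<longleftrightarrow> l = k" for l
    using unit_cell_translate[of y "- l"] by (auto simp: k_def vec_eq_iff)
  then have *: "y - lattice (enum n) \<in> unit_cell \<longleftrightarrow> n = m" for n
    using inj by simp
  show "(\<lambda>n. indicator unit_cell (y - lattice (enum n)) * c) sums c"
    using sums_single[of m "\<lambda>_. c"] by (rule sums_cong[THEN iffD1, rotated]) (auto simp: indicator_def *)
  show "(\<lambda>n. indicat_real unit_cell (y - lattice (enum n)) *\<^sub>R z) sums z"
    using sums_single[of m "\<lambda>_. z"] by (rule sums_cong[THEN iffD1, rotated]) (auto simp: indicator_def *)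
qed

lemma lborel_translate:
  fixes c :: "'a::euclidean_space"
  shows "f \<in> borel_measurable borel \<Longrightarrow> (\<integral>\<^sup>+ x. f (x + c) \<partial>lborel) = (\<integral>\<^sup>+ x. f x \<partial>lborel)"
    and "g \<in> borel_measurable borel \<Longrightarrow> (\<integral>x. g (x + c) \<partial>lborel) = (\<integral>x. (g x :: complex) \<partial>lborel)"
    and "integrable lborel g \<Longrightarrow> integrable lborel (\<lambda>x. g (x + c) :: complex)"
proof -
  have eq: "(\<lambda>x. x + c) = (+) c" by (rule ext) (rule add.commute)
  have d: "distr lborel borel (\<lambda>x. x + c) = lborel"
    unfolding eq by (rule lborel_distr_plus)
  have [measurable]: "(\<lambda>x. x + c) \<in> borel_measurable lborel" by simp
  show "(\<integral>\<^sup>+ x. f (x + c) \<partial>lborel) = (\<integral>\<^sup>+ x. f x \<partial>lborel)" if "f \<in> borel_measurable borel"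
    using nn_integral_distr[of "\<lambda>x. x + c" lborel borel f] that unfolding d by simp
  show "(\<integral>x. g (x + c) \<partial>lborel) = (\<integral>x. g x \<partial>lborel)" if "g \<in> borel_measurable borel"
    using integral_distr[of "\<lambda>x. x + c" lborel borel g] that unfolding d by simp
  show "integrable lborel (\<lambda>x. g (x + c))" if "integrable lborel g"
    using integrable_distr[of "\<lambda>x. x + c" lborel borel g] that unfolding d by simp
qed

text \<open>By Tonelli and translation invariance the left-hand side is the sum of the integrals of
  f over the translated cells, which tile the space.\<close>

lemma nn_integral_unfold:
  fixes f :: "real^'n::finite \<Rightarrow> ennreal"
  assumes [measurable]: "f \<in> borel_measurable borel"
  shows "(\<integral>\<^sup>+ x. indicator unit_cell x * (\<Sum>n. f (x + lattice (enum n))) \<partial>lborel) = (\<integral>\<^sup>+ x. f x \<partial>lborel)"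
proof -
  have "(\<integral>\<^sup>+ x. indicator unit_cell x * (\<Sum>n. f (x + lattice (enum n))) \<partial>lborel) =
      (\<integral>\<^sup>+ x. (\<Sum>n. indicator unit_cell x * f (x + lattice (enum n))) \<partial>lborel)"
    by (simp add: ennreal_suminf_cmult)
  also have "\<dots> = (\<Sum>n. \<integral>\<^sup>+ x. indicator unit_cell x * f (x + lattice (enum n)) \<partial>lborel)"
    by (intro nn_integral_suminf) measurable
  also have "\<dots> = (\<Sum>n. \<integral>\<^sup>+ y. indicator unit_cell (y - lattice (enum n)) * f y \<partial>lborel)"
  proof (intro suminf_cong)
    fix n
    show "(\<integral>\<^sup>+ x. indicator unit_cell x * f (x + lattice (enum n)) \<partial>lborel) =
        (\<integral>\<^sup>+ y. indicator unit_cell (y - lattice (enum n)) * f y \<partial>lborel)"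
      using lborel_translate(1)[of "\<lambda>y. indicator unit_cell (y - lattice (enum n)) * f y" "lattice (enum n)"]
      by simp
  qed
  also have "\<dots> = (\<integral>\<^sup>+ y. (\<Sum>n. indicator unit_cell (y - lattice (enum n)) * f y) \<partial>lborel)"
    by (intro nn_integral_suminf[symmetric]) measurable
  also have "\<dots> = (\<integral>\<^sup>+ y. f y \<partial>lborel)"
    by (simp only: sums_unique[OF sum_indicator_unit_cell(1), symmetric])
  finally show ?thesis .
qed

text \<open>An infinite sum that does not converge has the value 0, and for complex terms unordered
  convergence is absolute. Making this case distinction explicit shows that the periodization of a
  measurable function is measurable.\<close>

lemma periodization_enum:
  fixes f :: "real^'n::finite \<Rightarrow> complex"
  shows "periodization f x = (if (\<Sum>n. ennreal (norm (f (x + lattice (enum n))))) = top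
    then 0 else (\<Sum>n. f (x + lattice (enum n))))"
proof -
  let ?s = "\<lambda>n. norm (f (x + lattice (enum n)))"
  have "(\<Sum>n. ennreal (?s n)) \<noteq> top \<longleftrightarrow> summable ?s"
    by (rule iffI) (erule summable_suminf_not_top[rotated] ennreal_suminf_neq_top, rule norm_ge_zero)+
  also have "\<dots> \<longleftrightarrow> (\<lambda>k. norm (f (x + lattice k))) summable_on UNIV"
    using summable_enum_iff[OF infinite_vec, of "\<lambda>k. norm (f (x + lattice k))"] by simp
  finally have *: "(\<Sum>n. ennreal (?s n)) = top \<longleftrightarrow> \<not> (\<lambda>k. norm (f (x + lattice k))) summable_on UNIV" by blast
  show ?thesis
  proof (cases "(\<lambda>k. norm (f (x + lattice k))) summable_on UNIV")
    case True
    then show ?thesis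
      unfolding * periodization_def by (simp only: if_False not_not if_True simp_thms infsum_enum[OF infinite_vec True])
  next
    case False
    then have "\<not> (\<lambda>k. f (x + lattice k)) summable_on UNIV"
      by (simp add: summable_on_iff_abs_summable_on_complex)
    with False show ?thesis
      unfolding * periodization_def by (simp only: if_True simp_thms infsum_not_exists)
  qed
qed

lemma periodization_measurable [measurable]:
  fixes f :: "real^'n::finite \<Rightarrow> complex"
  assumes [measurable]: "f \<in> borel_measurable borel"
  shows "periodization f \<in> borel_measurable borel"
  unfolding periodization_enum[abs_def] by measurable

lemma torus_integral_unit_cell:
  assumes [measurable]: "f \<in> borel_measurable borel"
  shows "torus_integral f = (\<integral>x. indicat_real unit_cell x *\<^sub>R f x \<partial>lborel)"
    and "set_integrable lborel (cbox 0 1) f \<longleftrightarrow> integrable lborel (\<lambda>x. indicat_real unit_cell x *\<^sub>R f x)"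
proof -
  have *: "AE x in lborel. indicat_real (cbox 0 1) x *\<^sub>R f x = indicat_real unit_cell x *\<^sub>R f x"
    using AE_unit_cell by eventually_elim (auto simp: indicator_def)
  show "torus_integral f = (\<integral>x. indicat_real unit_cell x *\<^sub>R f x \<partial>lborel)"
    unfolding torus_integral_def set_lebesgue_integral_def
    by (rule integral_cong_AE[OF _ _ *]) measurable
  show "set_integrable lborel (cbox 0 1) f \<longleftrightarrow> integrable lborel (\<lambda>x. indicat_real unit_cell x *\<^sub>R f x)"
    unfolding set_integrable_def by (rule integrable_cong_AE[OF _ _ *]) measurable
qed

text \<open>\<open>F\<close> are the pieces of f moved to the unit cell, \<open>G\<close> the same
  pieces in place. Unfolding |f| makes the integrals of the norms summable for both families, so
  integral and sum may be exchanged on either side.\<close>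

lemma torus_integral_periodization:
  fixes f :: "real^'n::finite \<Rightarrow> complex"
  assumes f: "integrable lborel f"
  shows "set_integrable lborel (cbox 0 1) (periodization f)"
    and "torus_integral (periodization f) = (\<integral>x. f x \<partial>lborel)"
proof -
  have [measurable]: "f \<in> borel_measurable borel" using f by auto
  define F where "F n x = indicat_real unit_cell x *\<^sub>R f (x + lattice (enum n))" for n x
  define G where "G n y = indicat_real unit_cell (y - lattice (enum n)) *\<^sub>R f y" for n y
  have GF: "F n x = G n (x + lattice (enum n))" for n x
    by (simp add: F_def G_def)
  have G: "integrable lborel (G n)" for n
    unfolding G_def by (rule Bochner_Integration.integrable_bound[OF f]) (auto simp: indicator_def)
  have F: "integrable lborel (F n)" for n
    unfolding GF[abs_def] by (rule lborel_translate(3)[OF G])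
  have [measurable]: "F n \<in> borel_measurable borel" "G n \<in> borel_measurable borel" for n
    using borel_measurable_integrable[OF F] borel_measurable_integrable[OF G] by simp_all
  have int_norm: "ennreal (\<integral>x. norm (F n x) \<partial>lborel) = (\<integral>\<^sup>+ x. norm (F n x) \<partial>lborel)"
    "ennreal (\<integral>x. norm (G n x) \<partial>lborel) = (\<integral>\<^sup>+ x. norm (G n x) \<partial>lborel)" for n
    by (rule nn_integral_eq_integral[symmetric]; simp add: F G)+
  have FG: "(\<integral>\<^sup>+ x. norm (F n x) \<partial>lborel) = (\<integral>\<^sup>+ x. norm (G n x) \<partial>lborel)" for n
    using lborel_translate(1)[of "\<lambda>x. ennreal (norm (G n x))" "lattice (enum n)"]
      borel_measurable_integrable[OF G[of n]] by (simp add: GF)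
  have suminf_F: "(\<Sum>n. \<integral>\<^sup>+ x. norm (F n x) \<partial>lborel) = (\<integral>\<^sup>+ x. (\<Sum>n. ennreal (norm (F n x))) \<partial>lborel)"
    by (rule nn_integral_suminf[symmetric]) measurable
  have "(\<Sum>n. ennreal (norm (F n x))) = indicator unit_cell x * (\<Sum>n. ennreal (norm (f (x + lattice (enum n)))))" for x
  proof -
    have "ennreal (norm (F n x)) = indicator unit_cell x * ennreal (norm (f (x + lattice (enum n))))" for n
      by (simp add: F_def indicator_def)
    then show ?thesis unfolding ennreal_suminf_cmult[symmetric] by (rule suminf_cong)
  qed
  then have "(\<integral>\<^sup>+ x. (\<Sum>n. ennreal (norm (F n x))) \<partial>lborel) =
      (\<integral>\<^sup>+ x. indicator unit_cell x * (\<Sum>n. ennreal (norm (f (x + lattice (enum n))))) \<partial>lborel)"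
    by (rule nn_integral_cong)
  also have "\<dots> = (\<integral>\<^sup>+ x. norm (f x) \<partial>lborel)"
    by (rule nn_integral_unfold) measurable
  finally have "(\<integral>\<^sup>+ x. (\<Sum>n. ennreal (norm (F n x))) \<partial>lborel) = (\<integral>\<^sup>+ x. norm (f x) \<partial>lborel)" .
  moreover have "(\<integral>\<^sup>+ x. norm (f x) \<partial>lborel) < \<infinity>"
    using f by (simp add: integrable_iff_bounded)
  ultimately have fin: "(\<Sum>n. \<integral>\<^sup>+ x. norm (F n x) \<partial>lborel) < \<infinity>"
    unfolding suminf_F by (simp only:)
  have sF: "summable (\<lambda>n. \<integral>x. norm (F n x) \<partial>lborel)"
    using fin by (intro summable_suminf_not_top)
      (simp, simp only: int_norm infinity_ennreal_def less_top)
  have sG: "summable (\<lambda>n. \<integral>x. norm (G n x) \<partial>lborel)"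
    using fin by (intro summable_suminf_not_top)
      (simp, simp only: int_norm FG infinity_ennreal_def less_top)
  have "AE x in lborel. (\<Sum>n. ennreal (norm (F n x))) \<noteq> \<infinity>"
  proof (rule nn_integral_noteq_infinite)
    show "(\<integral>\<^sup>+ x. (\<Sum>n. ennreal (norm (F n x))) \<partial>lborel) \<noteq> \<infinity>"
      using fin unfolding suminf_F by (simp only: infinity_ennreal_def less_top)
  qed measurable
  then have AEF: "AE x in lborel. summable (\<lambda>n. norm (F n x))"
    by eventually_elim (rule summable_suminf_not_top, rule norm_ge_zero, simp only: infinity_ennreal_def not_False_eq_True)
  have Gsums: "(\<lambda>n. G n y) sums f y" for y
    unfolding G_def by (rule sum_indicator_unit_cell)
  have AEG: "summable (\<lambda>n. norm (G n y))" for y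
    using sums_summable[OF sum_indicator_unit_cell(2)[of y "norm (f y)"]] by (simp add: G_def)
  \<comment> \<open>The equality is claimed almost everywhere: at points of divergence the
    periodization is 0 by convention.\<close>
  have eq: "AE x in lborel. (\<Sum>n. F n x) = indicat_real unit_cell x *\<^sub>R periodization f x"
    using AEF
  proof eventually_elim
    case (elim x)
    show ?case
    proof (cases "x \<in> unit_cell")
      case True
      with elim have "summable (\<lambda>n. norm (f (x + lattice (enum n))))" by (simp add: F_def)
      then have "(\<Sum>n. ennreal (norm (f (x + lattice (enum n))))) \<noteq> top"
        by (intro ennreal_suminf_neq_top norm_ge_zero)
      with True show ?thesis by (simp only: F_def periodization_enum if_False indicator_simps scaleR_one)
    qed (simp add: F_def)
  qed
  have 1: "integrable lborel (\<lambda>x. indicat_real unit_cell x *\<^sub>R periodization f x)"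
  proof (rule integrable_cong_AE_imp[OF integrable_suminf[OF F AEF sF]])
    show "(\<lambda>x. indicat_real unit_cell x *\<^sub>R periodization f x) \<in> borel_measurable lborel"
      by measurable
  qed (use eq in eventually_elim, simp)
  then show "set_integrable lborel (cbox 0 1) (periodization f)"
    by (simp add: torus_integral_unit_cell(2))
  have "torus_integral (periodization f) = (\<integral>x. indicat_real unit_cell x *\<^sub>R periodization f x \<partial>lborel)"
    by (rule torus_integral_unit_cell) measurable
  also have "\<dots> = (\<integral>x. (\<Sum>n. F n x) \<partial>lborel)"
  proof (rule integral_cong_AE)
    show "(\<lambda>x. indicat_real unit_cell x *\<^sub>R periodization f x) \<in> borel_measurable lborel"
      by measurable
    show "(\<lambda>x. \<Sum>n. F n x) \<in> borel_measurable lborel"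
      using integrable_suminf[OF F AEF sF] by (rule borel_measurable_integrable)
  qed (use eq in eventually_elim, simp)
  also have "\<dots> = (\<Sum>n. \<integral>x. F n x \<partial>lborel)"
    by (rule integral_suminf[OF F AEF sF])
  also have "\<dots> = (\<Sum>n. \<integral>x. G n x \<partial>lborel)"
  proof (intro suminf_cong)
    show "(\<integral>x. F n x \<partial>lborel) = (\<integral>x. G n x \<partial>lborel)" for n
      using lborel_translate(2)[of "G n" "lattice (enum n)"] borel_measurable_integrable[OF G[of n]]
      by (simp add: GF)
  qed
  also have "\<dots> = (\<integral>x. (\<Sum>n. G n x) \<partial>lborel)"
    by (rule integral_suminf[symmetric, OF G _ sG]) (use AEG in auto)
  also have "\<dots> = (\<integral>x. f x \<partial>lborel)"
    using Gsums by (simp add: sums_iff)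
  finally show "torus_integral (periodization f) = (\<integral>x. f x \<partial>lborel)" .
qed

lemma continuous_on_infsum:
  fixes q :: "'i::countable \<Rightarrow> complex" and E :: "'i \<Rightarrow> 'a::topological_space \<Rightarrow> complex"
  assumes inf: "infinite (UNIV :: 'i set)" and q: "(\<lambda>i. norm (q i)) summable_on UNIV"
    and E: "\<And>i. continuous_on S (E i)" "\<And>i x. norm (E i x) \<le> 1"
  shows "continuous_on S (\<lambda>x. \<Sum>\<^sub>\<infinity>i. q i * E i x)"
proof -
  have sq: "summable (\<lambda>n. norm (q (enum n)))"
    using q summable_enum_iff[OF inf, of "\<lambda>i. norm (q i)"] by simp
  have "norm (q (enum n) * E (enum n) x) \<le> norm (q (enum n))" for n x
    using E(2)[of "enum n" x] by (auto simp: norm_mult intro!: mult_right_le_one_le)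
  then have "uniform_limit S (\<lambda>n x. \<Sum>i<n. q (enum i) * E (enum i) x)
      (\<lambda>x. \<Sum>i. q (enum i) * E (enum i) x) sequentially"
    by (intro Weierstrass_m_test[OF _ sq])
  then have "continuous_on S (\<lambda>x. \<Sum>i. q (enum i) * E (enum i) x)"
    by (rule uniform_limit_theorem[rotated]) (auto intro!: always_eventually continuous_intros E)
  moreover have "(\<Sum>\<^sub>\<infinity>i. q i * E i x) = (\<Sum>i. q (enum i) * E (enum i) x)" for x
    by (rule infsum_enum[OF inf abs_summable_bounded[OF q E(2)]])
  ultimately show ?thesis by simp
qed

section \<open>Fourier coefficients on the torus\<close>

text \<open>The frequency is a real vector, not just a lattice point, since Poisson summation will
  use shifts of the frequency lattice.\<close>

definition ech :: "real^'n::finite \<Rightarrow> real^'n \<Rightarrow> complex" where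
  "ech v x = cis (2 * pi * (v \<bullet> x))"

lemma ech_simps [simp]:
  "norm (ech v x) = 1" "ech 0 = (\<lambda>x. 1)" "ech v 0 = 1" "ech v x \<noteq> 0"
  by (simp_all add: ech_def fun_eq_iff)

lemma ech_commute: "ech v x = ech x v"
  by (simp add: ech_def inner_commute)

lemma ech_add_left: "ech (v + w) x = ech v x * ech w x"
  by (simp add: ech_def inner_add_left distrib_left cis_mult)

lemma ech_add_right: "ech v (x + y) = ech v x * ech v y"
  by (simp add: ech_def inner_add_right distrib_left cis_mult)

lemma cnj_ech: "cnj (ech v x) = ech (- v) x"
  by (simp add: ech_def cis_cnj)

lemma ech_cancel [simp]: "ech (- v) x * ech v x = 1" "ech v x * ech (- v) x = 1"
  using ech_add_left[of "- v" v x] ech_add_left[of v "- v" x] by simp_all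

lemma ech_lattice [simp]: "ech (lattice m) (lattice k) = 1"
proof -
  have "lattice m \<bullet> lattice k = of_int (\<Sum>i\<in>UNIV. m $ i * k $ i)"
    by (simp add: inner_vec_def)
  then show ?thesis
    unfolding ech_def by (metis Ints_of_int cis_multiple_2pi)
qed

lemma continuous_ech [continuous_intros]:
  "continuous_on S f \<Longrightarrow> continuous_on S (\<lambda>x. ech v (f x))"
  unfolding ech_def cis_conv_exp by (intro continuous_intros)

lemma ech_measurable [measurable]: "ech v \<in> borel_measurable borel"
  by (intro borel_measurable_continuous_onI continuous_ech continuous_on_id)

lemma periodic_ech: "Z_periodic (ech (lattice m))"
  by (simp add: Z_periodic_def ech_add_right)

section \<open>Integration over the torus\<close>

lemma torus_integrable_continuous:
  "continuous_on UNIV f \<Longrightarrow> set_integrable lborel (cbox 0 1) (f :: real^'n::finite \<Rightarrow> complex)"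
  unfolding set_integrable_def
  by (rule borel_integrable_compact) (auto intro: continuous_on_subset)

lemma torus_integral_linear:
  assumes "set_integrable lborel (cbox 0 1) f"
  shows "set_integrable lborel (cbox 0 1) g \<Longrightarrow>
      torus_integral (\<lambda>x. f x + g x) = torus_integral f + torus_integral g"
    and "set_integrable lborel (cbox 0 1) g \<Longrightarrow>
      torus_integral (\<lambda>x. f x - g x) = torus_integral f - torus_integral g"
    and "torus_integral (\<lambda>x. c * f x) = c * torus_integral f"
    and "torus_integral (\<lambda>x. cnj (f x)) = cnj (torus_integral f)"
  using assms unfolding torus_integral_def
  using Bochner_Integration.integral_cnj[of lborel "\<lambda>x. indicator (cbox 0 1) x *\<^sub>R f x"]
  by (simp_all add: set_lebesgue_integral_def set_integrable_def scaleR_conv_of_real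
      distrib_left right_diff_distrib)

lemma one_eq_One: "(1 :: real^'n::finite) = One"
proof (rule euclidean_eqI)
  fix b :: "real^'n" assume "b \<in> Basis"
  then have "(One :: real^'n) \<bullet> b = 1" by (simp add: inner_sum_left_Basis)
  moreover have "(1 :: real^'n) \<bullet> b = 1"
    using \<open>b \<in> Basis\<close> by (auto simp: Basis_vec_def inner_axis)
  ultimately show "1 \<bullet> b = (One :: real^'n) \<bullet> b" by simp
qed

lemma norm_torus_integral_le:
  fixes f :: "real^'n::finite \<Rightarrow> complex"
  assumes "set_integrable lborel (cbox 0 1) f" "\<And>x. norm (f x) \<le> B"
  shows "norm (torus_integral f) \<le> B"
proof -
  have c1: "measure lborel (cbox 0 (1::real^'n)) = 1"
    unfolding one_eq_One by (simp add: measure_lborel_cbox_eq)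
  have "norm (torus_integral f) \<le> (LINT x:cbox 0 1|lborel. norm (f x))"
    unfolding torus_integral_def set_lebesgue_integral_def
    using integral_norm_bound[of lborel "\<lambda>x. indicat_real (cbox 0 1) x *\<^sub>R f x"] by simp
  also have "\<dots> \<le> (LINT x:cbox 0 (1::real^'n)|lborel. B)"
  proof (rule set_integral_mono)
    show "set_integrable lborel (cbox 0 1) (\<lambda>x. norm (f x))"
      using assms(1) by (rule set_integrable_norm)
    show "set_integrable lborel (cbox 0 (1::real^'n)) (\<lambda>x. B)"
      unfolding set_integrable_def by (rule borel_integrable_compact) auto
  qed (rule assms)
  also have "\<dots> = B"
    using c1 by (simp add: set_lebesgue_integral_def)
  finally show ?thesis .
qed

lemma torus_integral_one [simp]: "torus_integral (\<lambda>x::real^'n::finite. c) = c"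
proof -
  have c1: "measure lborel (cbox 0 (1::real^'n)) = 1"
    unfolding one_eq_One by (simp add: measure_lborel_cbox_eq)
  then show ?thesis
    by (simp add: torus_integral_def set_lebesgue_integral_def scaleR_conv_of_real)
qed

text \<open>The part of f on the cell shifted by h has f itself as its periodization, so both sides
  are the integral of this part over the whole space.\<close>

lemma torus_integral_translate:
  fixes f :: "real^'n::finite \<Rightarrow> complex"
  assumes cont: "continuous_on UNIV f" and per: "Z_periodic f"
  shows "torus_integral (\<lambda>x. f (x + h)) = torus_integral f"
proof -
  have cont': "continuous_on UNIV (\<lambda>x. f (x + h))"
    by (rule continuous_on_compose2[OF cont]) (auto intro!: continuous_intros)
  have meas: "f \<in> borel_measurable borel" "(\<lambda>x. f (x + h)) \<in> borel_measurable borel"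
    using cont cont' by (auto intro: borel_measurable_continuous_onI)
  define \<Psi> where "\<Psi> x = indicat_real unit_cell (x - h) *\<^sub>R f x" for x
  have "integrable lborel (\<lambda>x. indicat_real unit_cell x *\<^sub>R f (x + h))"
    using torus_integrable_continuous[OF cont'] torus_integral_unit_cell(2)[OF meas(2)] by simp
  from lborel_translate(3)[OF this, of "- h"] have \<Psi>: "integrable lborel \<Psi>"
    by (simp add: \<Psi>_def[abs_def])
  have "periodization \<Psi> x = f x" for x
  proof -
    define k where "k = (\<chi> i. - \<lfloor>(x - h) $ i\<rfloor>)"
    have *: "x - h + lattice l \<in> unit_cell \<longleftrightarrow> l = k" for l
      using unit_cell_translate[of "x - h" l] by (simp add: k_def)
    have "periodization \<Psi> x = (\<Sum>\<^sub>\<infinity>l\<in>{k}. \<Psi> (x + lattice l))"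
      unfolding periodization_def
      by (rule infsum_cong_neutral) (use * in \<open>auto simp: \<Psi>_def indicator_def algebra_simps\<close>)
    also have "\<dots> = f x"
      using *[of k] per by (simp add: \<Psi>_def Z_periodic_def algebra_simps)
    finally show ?thesis .
  qed
  then have "torus_integral f = torus_integral (periodization \<Psi>)" by presburger
  also have "\<dots> = (\<integral>x. \<Psi> x \<partial>lborel)"
    by (rule torus_integral_periodization[OF \<Psi>])
  also have "\<dots> = (\<integral>x. \<Psi> (x + h) \<partial>lborel)"
    using \<Psi> by (intro lborel_translate(2)[symmetric]) auto
  also have "\<dots> = torus_integral (\<lambda>x. f (x + h))"
    using torus_integral_unit_cell(1)[OF meas(2)] by (simp add: \<Psi>_def)
  finally show ?thesis by simp
qed

text \<open>Translation by half a period, where the character takes the value -1, changes the sign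
  of the integral and by invariance preserves it.\<close>

lemma torus_integral_ech: "torus_integral (ech (lattice m)) = (if m = 0 then 1 else 0)"
proof (cases "m = 0")
  case True
  then show ?thesis by simp
next
  case False
  then obtain i where i: "m $ i \<noteq> 0" by (auto simp: vec_eq_iff)
  define h where "h = axis i (1 / (2 * of_int (m $ i)) :: real)"
  have half: "lattice m \<bullet> h = 1 / 2"
    using i by (simp add: h_def inner_axis)
  then have e: "ech (lattice m) h = -1"
    unfolding ech_def half by simp
  have "torus_integral (ech (lattice m)) = torus_integral (\<lambda>x. ech (lattice m) (x + h))"
    by (intro torus_integral_translate[symmetric] periodic_ech continuous_intros)
  also have "\<dots> = torus_integral (\<lambda>x. (-1) * ech (lattice m) x)"
    by (simp add: ech_add_right e)
  also have "\<dots> = (-1) * torus_integral (ech (lattice m))"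
    by (intro torus_integral_linear(3) torus_integrable_continuous continuous_intros)
  finally show ?thesis using False by simp
qed

section \<open>Fourier coefficients and Bessel's inequality\<close>

definition fcoef :: "(real^'n::finite \<Rightarrow> complex) \<Rightarrow> int^'n \<Rightarrow> complex" where
  "fcoef f m = torus_integral (\<lambda>x. ech (- lattice m) x * f x)"

lemma continuous_on_diff_ech:
  "continuous_on S f \<Longrightarrow> continuous_on S (\<lambda>x. f x - c * ech v x)"
  by (intro continuous_intros)

lemma fcoef_translate:
  assumes "continuous_on UNIV f" "Z_periodic f"
  shows "fcoef (\<lambda>x. f (x + h)) m = ech (lattice m) h * fcoef f m"
proof -
  let ?g = "\<lambda>x. ech (- lattice m) x * f x"
  have "Z_periodic ?g"
    using assms(2) periodic_ech[of "- m"] by (simp add: Z_periodic_def)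
  moreover have cont: "continuous_on UNIV ?g"
    using assms(1) by (intro continuous_intros)
  ultimately have "torus_integral (\<lambda>x. ?g (x + h)) = fcoef f m"
    unfolding fcoef_def by (intro torus_integral_translate)
  moreover have "(\<lambda>x. ech (- lattice m) x * f (x + h)) = (\<lambda>x. ech (lattice m) h * ?g (x + h))"
  proof
    fix x
    have "ech (lattice m) h * ?g (x + h) =
        (ech (lattice m) h * ech (- lattice m) h) * (ech (- lattice m) x * f (x + h))"
      by (simp only: ech_add_right mult_ac)
    then show "ech (- lattice m) x * f (x + h) = ech (lattice m) h * ?g (x + h)" by auto
  qed
  moreover have "continuous_on UNIV (\<lambda>x. ?g (x + h))"
    by (rule continuous_on_compose2[OF cont]) (auto intro!: continuous_intros)
  ultimately show ?thesis
    unfolding fcoef_def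
    by (simp only: torus_integral_linear(3)[OF torus_integrable_continuous])
qed

text \<open>Induction on \<open>F\<close> with varying g: subtracting the component of g at m lowers
  the square norm by exactly |c|^2 and leaves the coefficients at all other frequencies
  unchanged.\<close>

lemma bessel:
  fixes g :: "real^'n::finite \<Rightarrow> complex"
  assumes "finite F" "continuous_on UNIV g"
  shows "(\<Sum>m\<in>F. (norm (fcoef g m))\<^sup>2) \<le> Re (torus_integral (\<lambda>x. g x * cnj (g x)))"
  using assms
proof (induction F arbitrary: g)
  case empty
  have "0 \<le> (LINT x:cbox 0 1|lborel. (norm (g x))\<^sup>2)"
    by (simp add: set_lebesgue_integral_def integral_nonneg_AE)
  also have "\<dots> = Re (torus_integral (\<lambda>x. g x * cnj (g x)))"
  proof -
    have "complex_of_real (LINT x:cbox 0 1|lborel. (norm (g x))\<^sup>2) = torus_integral (\<lambda>x. g x * cnj (g x))"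
      unfolding torus_integral_def set_lebesgue_integral_def
      by (subst integral_complex_of_real[symmetric])
         (simp add: complex_norm_square[symmetric] scaleR_conv_of_real)
    then show ?thesis by (metis Re_complex_of_real)
  qed
  finally show ?case by simp
next
  case (insert m F)
  define c where "c = fcoef g m"
  define h where "h x = g x - c * ech (lattice m) x" for x
  have h: "continuous_on UNIV h"
    unfolding h_def using insert.prems by (rule continuous_on_diff_ech)
  note ti = torus_integrable_continuous
  note ci = continuous_intros insert.prems
  have coef: "fcoef h l = fcoef g l - (if l = m then c else 0)" for l
  proof -
    have "fcoef h l = torus_integral (\<lambda>x. ech (- lattice l) x * g x - c * ech (lattice (m - l)) x)"
      unfolding fcoef_def h_def using ech_add_left[of "lattice m" "- lattice l"]
      by (simp add: algebra_simps)
    also have "\<dots> = fcoef g l - torus_integral (\<lambda>x. c * ech (lattice (m - l)) x)"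
      unfolding fcoef_def by (intro torus_integral_linear(2) ti ci)
    also have "torus_integral (\<lambda>x. c * ech (lattice (m - l)) x) = c * torus_integral (ech (lattice (m - l)))"
      by (intro torus_integral_linear(3) ti ci)
    finally show ?thesis by (simp add: torus_integral_ech del: lattice_simps)
  qed
  \<comment> \<open>The square is expanded so that every mixed term is a multiple of
    \<open>ech (- lattice m) x * g x\<close> or of its conjugate, whose integrals are c and the
    conjugate of c.\<close>
  have "torus_integral (\<lambda>x. h x * cnj (h x)) =
      torus_integral (\<lambda>x. g x * cnj (g x) - (cnj c * (ech (- lattice m) x * g x)
        + (c * cnj (ech (- lattice m) x * g x) - c * cnj c)))"
    using complex_norm_square by (simp add: h_def algebra_simps cnj_ech)
  also have "\<dots> = torus_integral (\<lambda>x. g x * cnj (g x)) - (cnj c * c + (c * cnj c - c * cnj c))"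
  proof -
    have "torus_integral (\<lambda>x. c * cnj (ech (- lattice m) x * g x)) = c * cnj c"
      by (subst torus_integral_linear(3), intro ti ci, subst torus_integral_linear(4), intro ti ci)
         (simp add: c_def fcoef_def)
    moreover have "torus_integral (\<lambda>x. cnj c * (ech (- lattice m) x * g x)) = cnj c * c"
      by (subst torus_integral_linear(3), intro ti ci) (simp add: c_def fcoef_def)
    ultimately show ?thesis
      by (subst torus_integral_linear(2), intro ti ci, intro ti ci,
          subst torus_integral_linear(1), intro ti ci, intro ti ci,
          subst torus_integral_linear(2), intro ti ci, intro ti ci) simp
  qed
  finally have "Re (torus_integral (\<lambda>x. h x * cnj (h x))) =
      Re (torus_integral (\<lambda>x. g x * cnj (g x))) - (norm c)\<^sup>2"
    by (simp add: cmod_power2) (simp add: power2_eq_square)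
  moreover have "(\<Sum>l\<in>F. (norm (fcoef h l))\<^sup>2) = (\<Sum>l\<in>F. (norm (fcoef g l))\<^sup>2)"
    using insert.hyps by (intro sum.cong) (auto simp: coef)
  ultimately show ?case
    using insert.IH[OF h] insert.hyps by (simp add: c_def)
qed

lemma bessel_bound:
  fixes g :: "real^'n::finite \<Rightarrow> complex"
  assumes "finite F" "continuous_on UNIV g" "\<And>x. norm (g x) \<le> B"
  shows "(\<Sum>m\<in>F. (norm (fcoef g m))\<^sup>2) \<le> B\<^sup>2"
proof -
  have "(\<Sum>m\<in>F. (norm (fcoef g m))\<^sup>2) \<le> Re (torus_integral (\<lambda>x. g x * cnj (g x)))"
    by (rule bessel) fact+
  also have "\<dots> \<le> norm (torus_integral (\<lambda>x. g x * cnj (g x)))"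
    by (rule complex_Re_le_cmod)
  also have "\<dots> \<le> B\<^sup>2"
  proof (rule norm_torus_integral_le)
    show "norm (g x * cnj (g x)) \<le> B\<^sup>2" for x
      using power_mono[OF assms(3)[of x], of 2] by (simp add: norm_mult power2_eq_square)
  qed (intro torus_integrable_continuous continuous_intros assms(2))
  finally show ?thesis .
qed

section \<open>Completeness of the trigonometric system\<close>

inductive_set trig_poly :: "(real^'n::finite \<Rightarrow> complex) set" where
  ech: "(\<lambda>x. c * ech (lattice m) x) \<in> trig_poly"
| add: "p \<in> trig_poly \<Longrightarrow> q \<in> trig_poly \<Longrightarrow> (\<lambda>x. p x + q x) \<in> trig_poly"

lemma trig_poly_const: "(\<lambda>x. c) \<in> trig_poly"
  using trig_poly.ech[of c 0] by simp

lemma trig_poly_mult: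
  assumes "p \<in> trig_poly" "q \<in> trig_poly"
  shows "(\<lambda>x. p x * q x) \<in> trig_poly"
  using assms(1)
proof induction
  case (ech c m)
  from assms(2) show ?case
  proof induction
    case (ech d k)
    have "(\<lambda>x. c * ech (lattice m) x * (d * ech (lattice k) x)) = (\<lambda>x. c * d * ech (lattice (m + k)) x)"
      by (simp add: ech_add_left mult_ac)
    then show ?case by (simp only: trig_poly.ech)
  next
    case (add q1 q2)
    then show ?case using trig_poly.add[OF add.IH] by (simp add: distrib_left)
  qed
next
  case (add p1 p2)
  then show ?case using trig_poly.add[OF add.IH] by (simp add: distrib_right)
qed

lemma continuous_trig_poly: "p \<in> trig_poly \<Longrightarrow> continuous_on S p"
  by (induction rule: trig_poly.induct) (intro continuous_intros; assumption?)+

lemma torus_integral_mult_trig_poly: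
  assumes "p \<in> trig_poly" "continuous_on UNIV f" "\<And>m. fcoef f m = 0"
  shows "torus_integral (\<lambda>x. f x * p x) = 0"
  using assms(1)
proof induction
  case (ech c m)
  have "torus_integral (\<lambda>x. f x * (c * ech (lattice m) x)) =
      torus_integral (\<lambda>x. c * (ech (- lattice (- m)) x * f x))"
    by (simp add: mult_ac)
  also have "\<dots> = c * fcoef f (- m)"
    unfolding fcoef_def
    by (intro torus_integral_linear(3) torus_integrable_continuous continuous_intros assms(2))
  finally show ?case by (simp add: assms(3))
next
  case (add p q)
  have "torus_integral (\<lambda>x. f x * p x + f x * q x) =
      torus_integral (\<lambda>x. f x * p x) + torus_integral (\<lambda>x. f x * q x)"
    by (intro torus_integral_linear(1) torus_integrable_continuous continuous_intros assms(2)
        continuous_trig_poly add.hyps)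
  then show ?case using add.IH by (simp add: distrib_left)
qed

lemma reduce_to_cube:
  obtains k where "x + lattice k \<in> cbox 0 (1 :: real^'n::finite)"
proof -
  have "x + lattice (\<chi> i. - \<lfloor>x $ i\<rfloor>) \<in> unit_cell"
    by (simp add: unit_cell_translate)
  then show thesis
    by (intro that[of "\<chi> i. - \<lfloor>x $ i\<rfloor>"]) (auto simp: unit_cell_def mem_box_cart less_imp_le)
qed

text \<open>Realizes the torus as a compact subset of complex space. On the cube itself periodic
  functions cannot separate corresponding points of opposite faces, as the Stone-Weierstrass theorem
  requires.\<close>

definition torus_embed :: "real^'n::finite \<Rightarrow> complex^'n" where
  "torus_embed x = (\<chi> i. ech (axis i 1) x)"

lemma lattice_axis: "lattice (axis i 1) = axis i 1"
  by (simp add: vec_eq_iff axis_def)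

lemma torus_embed_lattice: "torus_embed (x + lattice k) = torus_embed x"
  unfolding torus_embed_def lattice_axis[symmetric] by (simp add: ech_add_right)

lemma torus_embed_eq:
  assumes "torus_embed x = torus_embed y"
  obtains k where "x = y + lattice k"
proof -
  have "\<exists>k::int. x $ i = y $ i + of_int k" for i
  proof -
    have "cis (2 * pi * x $ i) = cis (2 * pi * y $ i)"
      using assms by (simp add: torus_embed_def vec_eq_iff ech_def inner_axis' )
    then have "sin (2 * pi * x $ i) = sin (2 * pi * y $ i) \<and> cos (2 * pi * x $ i) = cos (2 * pi * y $ i)"
      by (simp add: complex_eq_iff)
    then obtain n :: int where "2 * pi * x $ i = 2 * pi * y $ i + 2 * pi * n"
      unfolding sin_cos_eq_iff by auto
    then have "2 * pi * (x $ i) = 2 * pi * (y $ i + n)"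
      by (simp add: algebra_simps)
    then have "x $ i = y $ i + n"
      by (simp only: mult_cancel_left) simp
    then show ?thesis by blast
  qed
  then obtain k where "\<And>i. x $ i = y $ i + of_int (k i)" by metis
  then show thesis
    by (intro that[of "\<chi> i. k i"]) (simp add: vec_eq_iff)
qed

lemma trig_poly_dense_real:
  fixes g :: "real^'n::finite \<Rightarrow> real"
  assumes cont: "continuous_on UNIV g" and per: "Z_periodic g" and e: "e > 0"
  obtains p where "p \<in> trig_poly" "\<And>x. norm (of_real (g x) - p x) < e"
proof -
  define S where "S = torus_embed ` cbox (0::real^'n) 1"
  have cE: "continuous_on A torus_embed" for A :: "(real^'n) set"
    unfolding torus_embed_def by (intro continuous_on_vec_lambda continuous_intros)
  have S: "compact S"
    unfolding S_def by (intro compact_continuous_image cE compact_cbox)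
  have inS: "torus_embed x \<in> S" for x :: "real^'n"
  proof -
    obtain k where "x + lattice k \<in> cbox 0 1" by (rule reduce_to_cube)
    then show ?thesis
      unfolding S_def using torus_embed_lattice[of x k] by (metis imageI)
  qed
  \<comment> \<open>\<open>G\<close> is g as a function on the embedded torus; by periodicity its
    value is the same for every preimage.\<close>
  define G where "G z = g (SOME x. torus_embed x = z)" for z
  have G: "G (torus_embed x) = g x" for x
  proof -
    have "torus_embed (SOME y. torus_embed y = torus_embed x) = torus_embed x"
      by (rule someI[where P = "\<lambda>y. torus_embed y = torus_embed x"]) simp
    then obtain k where "(SOME y. torus_embed y = torus_embed x) = x + lattice k"
      by (rule torus_embed_eq)
    then show ?thesis using per by (simp add: G_def Z_periodic_def)
  qed
  \<comment> \<open>The preimage of a closed set under \<open>G\<close> is the image of a compact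
    subset of the cube, hence closed.\<close>
  have contG: "continuous_on S G"
    unfolding continuous_on_closed_vimage[OF compact_imp_closed[OF S]]
  proof (intro allI impI)
    fix T :: "real set" assume T: "closed T"
    have "G -` T \<inter> S = torus_embed ` (cbox 0 1 \<inter> g -` T)"
      unfolding S_def by (auto simp: G)
    moreover have "compact (cbox 0 1 \<inter> g -` T)"
      by (intro compact_Int_closed compact_cbox closed_vimage T cont)
    ultimately show "closed (G -` T \<inter> S)"
      by (metis cE compact_continuous_image compact_imp_closed)
  qed
  define R where "R = {F :: complex^'n \<Rightarrow> real. continuous_on S F \<and>
    (\<lambda>x. complex_of_real (F (torus_embed x))) \<in> trig_poly}"
  interpret function_ring_on R S
  proof
    show "continuous_on S f" if "f \<in> R" for f using that by (simp add: R_def)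
    show "(\<lambda>x. f x + g x) \<in> R" if "f \<in> R" "g \<in> R" for f g
      using that trig_poly.add by (auto simp: R_def intro!: continuous_intros)
    show "(\<lambda>x. f x * g x) \<in> R" if "f \<in> R" "g \<in> R" for f g
      using that trig_poly_mult by (auto simp: R_def intro!: continuous_intros)
    show "(\<lambda>_. c) \<in> R" for c
      using trig_poly_const by (auto simp: R_def intro!: continuous_intros)
    fix x y :: "complex^'n" assume "x \<in> S" "y \<in> S" "x \<noteq> y"
    then obtain i where i: "x $ i \<noteq> y $ i" by (auto simp: vec_eq_iff)
    \<comment> \<open>The ring consists of real functions, so the coordinates enter through their
      real and imaginary parts; these are combinations of a character and its conjugate, and they
      separate points.\<close>
    have "of_real (Re (ech v x)) = (1/2) * ech v x + (1/2) * ech (- v) x"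
      "of_real (Im (ech v x)) = (-\<i>/2) * ech v x + (\<i>/2) * ech (- v) x" for v x :: "real^'n"
      unfolding cnj_ech[symmetric] by (simp_all add: complex_eq_iff)
    note ReIm = this[of "lattice (axis i 1)"]
    have "(\<lambda>x. of_real (Re (ech (lattice (axis i 1)) x))) \<in> (trig_poly :: (real^'n \<Rightarrow> complex) set)"
      unfolding ReIm lattice_simps(3)[symmetric] by (intro trig_poly.intros)
    moreover have "(\<lambda>x. of_real (Im (ech (lattice (axis i 1)) x))) \<in> (trig_poly :: (real^'n \<Rightarrow> complex) set)"
      unfolding ReIm lattice_simps(3)[symmetric] by (intro trig_poly.intros)
    ultimately have "(\<lambda>z. Re (z $ i)) \<in> R" "(\<lambda>z. Im (z $ i)) \<in> R"
      by (auto simp: R_def torus_embed_def lattice_axis intro!: continuous_intros)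
    moreover have "Re (x $ i) \<noteq> Re (y $ i) \<or> Im (x $ i) \<noteq> Im (y $ i)"
      using i by (simp add: complex_eq_iff)
    ultimately show "\<exists>f\<in>R. f x \<noteq> f y" by (elim disjE) (rule bexI, assumption+)+
  qed (rule S)
  obtain F where F: "F \<in> R" "\<And>z. z \<in> S \<Longrightarrow> \<bar>G z - F z\<bar> < e"
    using Stone_Weierstrass_basic[OF contG e] by (elim bexE) simp
  show thesis
  proof (rule that)
    show "(\<lambda>x. complex_of_real (F (torus_embed x))) \<in> trig_poly"
      using F(1) by (simp add: R_def)
    show "norm (complex_of_real (g x) - complex_of_real (F (torus_embed x))) < e" for x
      using F(2)[OF inS, of x] unfolding of_real_diff[symmetric] norm_of_real by (simp add: G)
  qed
qed

lemma periodic_bounded: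
  fixes f :: "real^'n::finite \<Rightarrow> 'b::real_normed_vector"
  assumes "continuous_on UNIV f" "Z_periodic f"
  obtains B where "B \<ge> 0" "\<And>x. norm (f x) \<le> B"
proof -
  have "bounded (f ` cbox 0 1)"
    by (intro compact_imp_bounded compact_continuous_image compact_cbox continuous_on_subset[OF assms(1)]) auto
  then obtain B where B: "\<And>x. x \<in> cbox 0 1 \<Longrightarrow> norm (f x) \<le> B"
    by (auto simp: bounded_iff)
  have "norm (f x) \<le> B" for x
  proof -
    obtain k where "x + lattice k \<in> cbox 0 1" by (rule reduce_to_cube)
    then show ?thesis using B[of "x + lattice k"] assms(2) by (simp add: Z_periodic_def)
  qed
  then show thesis using that[of B] norm_ge_zero order_trans by blast
qed

text \<open>The integral of f against every trigonometric polynomial vanishes, and these approximate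
  the conjugate of f uniformly. So the integral of |f|^2 is 0, and by continuity f is 0.\<close>

lemma fcoef_zero_imp_zero:
  fixes f :: "real^'n::finite \<Rightarrow> complex"
  assumes cont: "continuous_on UNIV f" and per: "Z_periodic f" and z: "\<And>m. fcoef f m = 0"
  shows "f x = 0"
proof -
  obtain B where B: "B \<ge> 0" "\<And>x. norm (f x) \<le> B"
    using periodic_bounded[OF cont per] by blast
  have small: "norm (torus_integral (\<lambda>x. f x * cnj (f x))) \<le> B * (2 * e)" if e: "e > 0" for e
  proof -
    obtain p where p: "p \<in> trig_poly" "\<And>x. norm (of_real (Re (f x)) - p x) < e"
      by (rule trig_poly_dense_real[of "\<lambda>x. Re (f x)" e])
         (use cont per e in \<open>auto simp: Z_periodic_def intro!: continuous_intros\<close>)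
    obtain q where q: "q \<in> trig_poly" "\<And>x. norm (of_real (Im (f x)) - q x) < e"
      by (rule trig_poly_dense_real[of "\<lambda>x. Im (f x)" e])
         (use cont per e in \<open>auto simp: Z_periodic_def intro!: continuous_intros\<close>)
    define r where "r x = p x + (- \<i>) * q x" for x
    have r: "r \<in> trig_poly"
      unfolding r_def by (intro trig_poly.add p trig_poly_mult trig_poly_const q)
    have close: "norm (cnj (f x) - r x) \<le> 2 * e" for x
    proof -
      have "cnj (f x) - r x = (of_real (Re (f x)) - p x) + (- \<i>) * (of_real (Im (f x)) - q x)"
        by (simp add: r_def complex_eq_iff)
      also have "norm \<dots> \<le> norm (of_real (Re (f x)) - p x) + norm ((- \<i>) * (of_real (Im (f x)) - q x))"
        by (rule norm_triangle_ineq)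
      also have "\<dots> \<le> 2 * e"
        using p(2)[of x] q(2)[of x] by (simp add: norm_mult del: mult_minus_left)
      finally show ?thesis .
    qed
    have "torus_integral (\<lambda>x. f x * (cnj (f x) - r x)) =
        torus_integral (\<lambda>x. f x * cnj (f x)) - torus_integral (\<lambda>x. f x * r x)"
      unfolding right_diff_distrib
      by (intro torus_integral_linear(2) torus_integrable_continuous continuous_intros cont
          continuous_trig_poly r)
    also have "torus_integral (\<lambda>x. f x * r x) = 0"
      by (rule torus_integral_mult_trig_poly[OF r cont z])
    finally have "torus_integral (\<lambda>x. f x * cnj (f x)) = torus_integral (\<lambda>x. f x * (cnj (f x) - r x))"
      by simp
    also have "norm \<dots> \<le> B * (2 * e)"
    proof (rule norm_torus_integral_le)
      show "norm (f x * (cnj (f x) - r x)) \<le> B * (2 * e)" for x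
        unfolding norm_mult using B close e by (intro mult_mono) auto
    qed (intro torus_integrable_continuous continuous_intros cont continuous_trig_poly r)
    finally show ?thesis .
  qed
  have "norm (torus_integral (\<lambda>x. f x * cnj (f x))) \<le> 0"
  proof (rule field_le_epsilon)
    fix e :: real assume "e > 0"
    \<comment> \<open>The denominator contains B + 1 rather than B to cover B = 0.\<close>
    have "norm (torus_integral (\<lambda>x. f x * cnj (f x))) \<le> B * (2 * (e / (2 * (B + 1))))"
      using \<open>e > 0\<close> B(1) by (intro small) auto
    also have "\<dots> \<le> e"
      using \<open>e > 0\<close> B(1) by (simp add: field_simps)
    finally show "norm (torus_integral (\<lambda>x. f x * cnj (f x))) \<le> 0 + e" by simp
  qed
  then have "torus_integral (\<lambda>x. complex_of_real ((norm (f x))\<^sup>2)) = 0"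
    by (simp only: complex_norm_square norm_le_zero_iff)
  moreover have "complex_of_real (LINT x:cbox 0 1|lborel. (norm (f x))\<^sup>2) =
      torus_integral (\<lambda>x. complex_of_real ((norm (f x))\<^sup>2))"
    unfolding torus_integral_def set_lebesgue_integral_def
    by (subst integral_complex_of_real[symmetric]) (simp add: scaleR_conv_of_real)
  ultimately have 0: "(LINT x:cbox 0 1|lborel. (norm (f x))\<^sup>2) = 0"
    by (metis of_real_eq_0_iff)
  have "set_integrable lborel (cbox 0 1) (\<lambda>x. (norm (f x))\<^sup>2)"
    unfolding set_integrable_def
    by (rule borel_integrable_compact)
       (auto intro!: continuous_intros continuous_on_subset[OF cont])
  then have "((\<lambda>x. (norm (f x))\<^sup>2) has_integral 0) (cbox 0 1)"
    using set_borel_integral_eq_integral[of "cbox 0 1" "\<lambda>x. (norm (f x))\<^sup>2"] 0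
    by (metis integrable_integral)
  moreover have "box 0 (1::real^'n) \<noteq> {}"
    by (simp add: one_eq_One)
  moreover have "continuous_on (cbox 0 1) (\<lambda>x. (norm (f x))\<^sup>2)"
    by (intro continuous_intros continuous_on_subset[OF cont]) auto
  ultimately have zero: "f y = 0" if "y \<in> cbox 0 1" for y
    using has_integral_0_cbox_imp_0[of 0 1 "\<lambda>x. (norm (f x))\<^sup>2" y] that by simp
  obtain k where "x + lattice k \<in> cbox 0 1" by (rule reduce_to_cube)
  then show ?thesis using zero[of "x + lattice k"] per by (simp add: Z_periodic_def)
qed

lemma torus_integral_infsum:
  fixes q :: "'i::countable \<Rightarrow> complex" and E :: "'i \<Rightarrow> real^'n::finite \<Rightarrow> complex"
  assumes "infinite (UNIV :: 'i set)" "(\<lambda>i. norm (q i)) summable_on UNIV"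
    and "\<And>i. E i \<in> borel_measurable borel" "\<And>i x. norm (E i x) \<le> 1"
    and "set_integrable lborel (cbox 0 1) \<phi>"
  shows "torus_integral (\<lambda>x. (\<Sum>\<^sub>\<infinity>i. q i * E i x) * \<phi> x) = (\<Sum>\<^sub>\<infinity>i. q i * torus_integral (\<lambda>x. E i x * \<phi> x))"
  using integral_infsum(2)[OF assms(1,2), of E lborel "\<lambda>x. indicator (cbox 0 1) x *\<^sub>R \<phi> x"] assms(3-)
  unfolding set_integrable_def torus_integral_def set_lebesgue_integral_def
  by simp

text \<open>The series converges uniformly to a continuous periodic function with the same
  coefficients, and its difference from f vanishes by completeness.\<close>

lemma fourier_series:
  fixes f :: "real^'n::finite \<Rightarrow> complex"
  assumes cont: "continuous_on UNIV f" and per: "Z_periodic f"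
    and sum: "(\<lambda>m. norm (fcoef f m)) summable_on UNIV"
  shows "f x = (\<Sum>\<^sub>\<infinity>m. fcoef f m * ech (lattice m) x)"
proof -
  define s where "s x = (\<Sum>\<^sub>\<infinity>m. fcoef f m * ech (lattice m) x)" for x
  have s: "continuous_on UNIV s"
    unfolding s_def by (rule continuous_on_infsum[OF infinite_vec sum]) (auto intro!: continuous_intros)
  have "fcoef s l = fcoef f l" for l
  proof -
    have "fcoef s l = torus_integral (\<lambda>x. s x * ech (- lattice l) x)"
      by (simp add: fcoef_def mult.commute)
    also have "\<dots> = (\<Sum>\<^sub>\<infinity>m. fcoef f m * torus_integral (\<lambda>x. ech (lattice m) x * ech (- lattice l) x))"
      unfolding s_def
      by (rule torus_integral_infsum[OF infinite_vec sum])
         (auto intro!: torus_integrable_continuous continuous_intros)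
    also have "\<dots> = (\<Sum>\<^sub>\<infinity>m. if m = l then fcoef f l else 0)"
    proof (rule infsum_cong)
      fix m
      have "(\<lambda>x. ech (lattice m) x * ech (- lattice l) x) = ech (lattice (m - l))"
        by (auto simp: ech_add_left[symmetric])
      then show "fcoef f m * torus_integral (\<lambda>x. ech (lattice m) x * ech (- lattice l) x) =
          (if m = l then fcoef f l else 0)"
        by (simp only: torus_integral_ech) simp
    qed
    also have "\<dots> = (\<Sum>\<^sub>\<infinity>m\<in>{l}. fcoef f l)"
      by (rule infsum_cong_neutral) auto
    finally show ?thesis by simp
  qed
  moreover have "fcoef (\<lambda>x. f x - s x) l = fcoef f l - fcoef s l" for l
    unfolding fcoef_def right_diff_distrib
    by (intro torus_integral_linear(2) torus_integrable_continuous continuous_intros cont s)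
  moreover have "Z_periodic (\<lambda>x. f x - s x)"
    using per by (simp add: Z_periodic_def s_def ech_add_right)
  ultimately have "f x - s x = 0"
    by (intro fcoef_zero_imp_zero[of "\<lambda>x. f x - s x"]) (auto intro!: continuous_intros cont s)
  then show ?thesis by (simp add: s_def)
qed

section \<open>Bernstein's theorem\<close>

text \<open>An interval of length 2 r contains at most 2 r + 1 integers wherever it lies, which
  makes the count uniform in the shift a.\<close>

lemma card_lattice_box_le:
  fixes a :: "real^'n::finite"
  assumes "r \<ge> 0"
  shows "finite {m :: int^'n. \<forall>j. \<bar>of_int (m $ j) + a $ j\<bar> \<le> r}"
    and "real (card {m :: int^'n. \<forall>j. \<bar>of_int (m $ j) + a $ j\<bar> \<le> r}) \<le> (2 * r + 1) ^ CARD('n)"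
proof -
  define S where "S j = {\<lceil>- r - a $ j\<rceil>..\<lfloor>r - a $ j\<rfloor>}" for j
  have sub: "{m :: int^'n. \<forall>j. \<bar>of_int (m $ j) + a $ j\<bar> \<le> r} \<subseteq> vec_lambda ` PiE UNIV S"
  proof
    fix m :: "int^'n" assume "m \<in> {m. \<forall>j. \<bar>of_int (m $ j) + a $ j\<bar> \<le> r}"
    then have le: "\<bar>of_int (m $ j) + a $ j\<bar> \<le> r" for j
      by simp
    have "- r - a $ j \<le> of_int (m $ j)" "of_int (m $ j) \<le> r - a $ j" for j
      using le[of j] by linarith+
    then have "m $ j \<in> S j" for j
      by (simp add: S_def ceiling_le_iff le_floor_iff)
    then show "m \<in> vec_lambda ` PiE UNIV S"
      by (intro image_eqI[of _ _ "vec_nth m"]) auto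
  qed
  have fin: "finite (PiE UNIV S)"
    by (intro finite_PiE) (auto simp: S_def)
  show "finite {m :: int^'n. \<forall>j. \<bar>of_int (m $ j) + a $ j\<bar> \<le> r}"
    by (rule finite_subset[OF sub finite_imageI[OF fin]])
  have "card {m :: int^'n. \<forall>j. \<bar>of_int (m $ j) + a $ j\<bar> \<le> r} \<le> card (vec_lambda ` PiE UNIV S)"
    by (rule card_mono[OF finite_imageI[OF fin] sub])
  also have "\<dots> \<le> card (PiE UNIV S)"
    by (rule card_image_le[OF fin])
  also have "\<dots> = (\<Prod>j\<in>UNIV. card (S j))"
    by (rule card_PiE) simp
  finally have "real (card {m :: int^'n. \<forall>j. \<bar>of_int (m $ j) + a $ j\<bar> \<le> r}) \<le> real (\<Prod>j\<in>UNIV. card (S j))"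
    by (simp only: of_nat_le_iff)
  also have "\<dots> = (\<Prod>j\<in>UNIV. real (card (S j)))" by simp
  also have "\<dots> \<le> (\<Prod>j\<in>(UNIV::'n set). 2 * r + 1)"
  proof (intro prod_mono conjI)
    fix j
    have "real_of_int (\<lfloor>r - a $ j\<rfloor> - \<lceil>- r - a $ j\<rceil> + 1) \<le> 2 * r + 1" by linarith
    then show "real (card (S j)) \<le> 2 * r + 1"
      using assms by (cases "\<lfloor>r - a $ j\<rfloor> - \<lceil>- r - a $ j\<rceil> + 1 \<ge> 0") (simp_all add: S_def)
  qed simp
  finally show "real (card {m :: int^'n. \<forall>j. \<bar>of_int (m $ j) + a $ j\<bar> \<le> r}) \<le> (2 * r + 1) ^ CARD('n)"
    by simp
qed

lemma dyadic_exponent: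
  fixes y :: real
  assumes "y \<ge> 1"
  obtains l :: nat where "2 ^ l \<le> y" "y < 2 ^ Suc l"
proof -
  define n where "n = (LEAST n. y < 2 ^ n)"
  have n: "y < 2 ^ n"
    unfolding n_def by (rule LeastI_ex) (use real_arch_pow[of 2 y] in simp)
  with assms obtain l where l: "n = Suc l" by (cases n) auto
  have "\<not> y < 2 ^ l"
    using not_less_Least[of l "\<lambda>n. y < 2 ^ n"] l by (simp add: n_def)
  then show thesis using that[of l] n l by simp
qed

lemma cis_minus_one_ge:
  assumes "pi / 2 \<le> \<bar>\<theta>\<bar>" "\<bar>\<theta>\<bar> \<le> pi"
  shows "1 \<le> norm (cis \<theta> - 1)"
proof -
  have "cos \<theta> \<le> 0"
    using cos_monotone_0_pi_le[of "pi / 2" "\<bar>\<theta>\<bar>"] assms by simp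
  then have "Re (cis \<theta> - 1) \<le> -1" by simp
  then have "1 \<le> \<bar>Re (cis \<theta> - 1)\<bar>" by linarith
  then show ?thesis using abs_Re_le_cmod order_trans by blast
qed

text \<open>3^n counts the lattice points of the central box and the factor n the choices of the
  largest coordinate. The rest is a geometric series over the shells: shell k has at most 2^((k + 3)
  n) points, and the square root of this, against the decay 2^(-k \<beta>), leaves 2^(3 n/2) and the
  ratio 2^(n/2 - \<beta>).\<close>

definition bernstein_const :: "nat \<Rightarrow> real \<Rightarrow> real" where
  "bernstein_const n \<beta> =
     3 ^ n + real n * 2 powr (3 * n / 2) / (1 - 2 powr (n / 2 - \<beta>))"

text \<open>In the dyadic shell \<open>2\<^sup>l \<le> \<bar>m + a\<bar>\<^sub>\<infinity> < 2\<^sup>l\<^sup>+\<^sup>1\<close> the multiplier \<open>exp(2\<pi>\<i>t(m\<^sub>i + a\<^sub>i)) - 1\<close>, with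
  \<open>t = 2\<^sup>-\<^sup>l\<^sup>-\<^sup>2\<close> and \<open>i\<close> the index of the largest coordinate, has modulus at least 1.\<close>

lemma bernstein_sum:
  fixes c :: "int^'n::finite \<Rightarrow> complex" and a :: "real^'n"
  assumes \<beta>: "\<beta> > real CARD('n) / 2" and B: "B \<ge> 0" and F: "finite F"
    and c: "\<And>m. norm (c m) \<le> B"
    and diff: "\<And>i t. 0 < t \<Longrightarrow> t \<le> 1/4 \<Longrightarrow>
      (\<Sum>m\<in>F. norm (cis (2 * pi * (t * (of_int (m $ i) + a $ i))) - 1) ^ (2 * K) * (norm (c m))\<^sup>2)
        \<le> (B * t powr \<beta>)\<^sup>2"
  shows "(\<Sum>m\<in>F. norm (c m)) \<le> B * bernstein_const CARD('n) \<beta>"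
proof -
  define n where "n = CARD('n)"
  define x where "x m j = of_int (m $ j) + a $ j" for m :: "int^'n" and j
  define D where "D = 2 powr (3 * n / 2)"
  define r where "r = 2 powr (n / 2 - \<beta>)"
  have r: "0 < r" "r < 1"
    unfolding r_def using \<beta> powr_less_mono[of "n / 2 - \<beta>" 0 2] by (auto simp: n_def)
  define F1 where "F1 = {m \<in> F. \<forall>j. \<bar>x m j\<bar> \<le> 1}"
  define F2 where "F2 = F - F1"
  define sh where "sh l i = {m. 2 ^ l \<le> \<bar>x m i\<bar> \<and> \<bar>x m i\<bar> < 2 ^ Suc l \<and> (\<forall>j. \<bar>x m j\<bar> \<le> \<bar>x m i\<bar>)}"
    for l :: nat and i
  have "\<exists>l i. m \<in> sh l i" if "m \<in> F2" for m
  proof -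
    obtain i where i: "\<And>j. \<bar>x m j\<bar> \<le> \<bar>x m i\<bar>"
    proof -
      have "Max (range (\<lambda>j. \<bar>x m j\<bar>)) \<in> range (\<lambda>j. \<bar>x m j\<bar>)"
        by (rule Max_in) auto
      then obtain i where "Max (range (\<lambda>j. \<bar>x m j\<bar>)) = \<bar>x m i\<bar>" by (elim rangeE)
      then have "\<bar>x m j\<bar> \<le> \<bar>x m i\<bar>" for j
        using Max_ge[of "range (\<lambda>j. \<bar>x m j\<bar>)" "\<bar>x m j\<bar>"] by simp
      then show thesis by (rule that)
    qed
    have "\<bar>x m i\<bar> \<ge> 1"
    proof (rule ccontr)
      assume "\<not> \<bar>x m i\<bar> \<ge> 1"
      then have "\<bar>x m j\<bar> \<le> 1" for j using i[of j] by simp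
      with that show False by (auto simp: F1_def F2_def)
    qed
    then obtain l where "2 ^ l \<le> \<bar>x m i\<bar>" "\<bar>x m i\<bar> < 2 ^ Suc l"
      by (rule dyadic_exponent)
    with i show ?thesis by (auto simp: sh_def)
  qed
  \<comment> \<open>Each m outside the central box is given a single pair of shell and largest
    coordinate, so nothing is summed twice.\<close>
  then obtain l i where li: "\<And>m. m \<in> F2 \<Longrightarrow> m \<in> sh (l m) (i m)" by metis
  have shell: "(\<Sum>m\<in>S. norm (c m)) \<le> B * D * r ^ k" if S: "S \<subseteq> F" "S \<subseteq> sh k j" for S k j
  proof -
    define t :: real where "t = 1 / 2 ^ (k + 2)"
    have t: "0 < t" "t \<le> 1/4"
      by (auto simp: t_def divide_simps)
    have tp: "t = 2 powr (- real (k + 2))"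
      unfolding t_def by (simp only: powr_minus powr_realpow[symmetric] zero_less_numeral inverse_eq_divide)
    have fS: "finite S" using S F finite_subset by blast
    have "real (card S) \<le> real (card {m :: int^'n. \<forall>j. \<bar>of_int (m $ j) + a $ j\<bar> \<le> 2 ^ Suc k})"
      unfolding of_nat_le_iff
    proof (rule card_mono[OF card_lattice_box_le(1)])
      show "S \<subseteq> {m. \<forall>j. \<bar>of_int (m $ j) + a $ j\<bar> \<le> 2 ^ Suc k}"
      proof (intro subsetI CollectI allI)
        fix m j' assume "m \<in> S"
        then have "m \<in> sh k j" using S(2) by auto
        then have "\<bar>x m j'\<bar> \<le> \<bar>x m j\<bar>" "\<bar>x m j\<bar> < 2 ^ Suc k" by (auto simp: sh_def)
        then show "\<bar>of_int (m $ j') + a $ j'\<bar> \<le> 2 ^ Suc k" unfolding x_def by linarith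
      qed
    qed simp
    also have "\<dots> \<le> (2 * 2 ^ Suc k + 1) ^ n"
      unfolding n_def by (rule card_lattice_box_le(2)) simp
    also have "\<dots> \<le> (2 ^ (k + 3)) ^ n"
    proof (intro power_mono)
      have "(1::real) \<le> 4 * 2 ^ k" by (rule order_trans[of _ "2 ^ k"]) simp_all
      then show "(2 * 2 ^ Suc k + 1 :: real) \<le> 2 ^ (k + 3)" by (simp add: power_add)
    qed simp
    also have "\<dots> = 2 powr (real (k + 3) * n)"
      by (simp add: powr_realpow[symmetric] powr_powr power_mult[symmetric] del: power_add of_nat_add)
    finally have card: "real (card S) \<le> 2 powr (real (k + 3) * n)" .
    have "(\<Sum>m\<in>S. (norm (c m))\<^sup>2) \<le>
        (\<Sum>m\<in>S. norm (cis (2 * pi * (t * (of_int (m $ j) + a $ j))) - 1) ^ (2 * K) * (norm (c m))\<^sup>2)"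
    proof (rule sum_mono)
      fix m assume "m \<in> S"
      then have m: "2 ^ k \<le> \<bar>x m j\<bar>" "\<bar>x m j\<bar> \<le> 2 ^ Suc k"
        using S(2) by (auto simp: sh_def)
      have "1 / 4 \<le> t * \<bar>x m j\<bar>" "t * \<bar>x m j\<bar> \<le> 1 / 2"
        using m by (auto simp: t_def power_add field_simps)
      then have "pi * (1 / 4) \<le> pi * (t * \<bar>x m j\<bar>)" "pi * (t * \<bar>x m j\<bar>) \<le> pi * (1 / 2)"
        by (simp_all only: mult_le_cancel_left_pos pi_gt_zero)
      then have "1 \<le> norm (cis (2 * pi * (t * x m j)) - 1)"
        using t by (intro cis_minus_one_ge) (simp_all add: abs_mult)
      then have "1 \<le> norm (cis (2 * pi * (t * (of_int (m $ j) + a $ j))) - 1) ^ (2 * K)"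
        by (simp add: x_def)
      from mult_right_mono[OF this, of "(norm (c m))\<^sup>2"]
      show "(norm (c m))\<^sup>2 \<le> norm (cis (2 * pi * (t * (of_int (m $ j) + a $ j))) - 1) ^ (2 * K) * (norm (c m))\<^sup>2"
        by simp
    qed
    also have "\<dots> \<le> (\<Sum>m\<in>F. norm (cis (2 * pi * (t * (of_int (m $ j) + a $ j))) - 1) ^ (2 * K) * (norm (c m))\<^sup>2)"
      by (rule sum_mono2[OF F S(1)]) simp
    also have "\<dots> \<le> (B * t powr \<beta>)\<^sup>2"
      by (rule diff[OF t])
    finally have sq: "(\<Sum>m\<in>S. (norm (c m))\<^sup>2) \<le> (B * t powr \<beta>)\<^sup>2" .
    \<comment> \<open>Cauchy-Schwarz against the number of lattice points of the shell: the gain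
      t^\<beta> has to beat the factor 2^(k n/2), and for \<beta> > n/2 it does so
      geometrically.\<close>
    have "(\<Sum>m\<in>S. norm (c m))\<^sup>2 \<le> (\<Sum>m\<in>S. (norm (c m))\<^sup>2) * real (card S)"
      by (rule sum_squared_le_sum_of_squares)
    also have "\<dots> \<le> (B * t powr \<beta>)\<^sup>2 * 2 powr (real (k + 3) * n)"
      by (intro mult_mono sq card) auto
    also have "\<dots> = B\<^sup>2 * (2 powr (- real (k + 2) * \<beta> * 2) * 2 powr (real (k + 3) * n))"
      unfolding tp powr_powr power_mult_distrib by (simp add: powr_power mult.commute)
    also have "\<dots> = B\<^sup>2 * 2 powr (- real (k + 2) * \<beta> * 2 + real (k + 3) * n)"
      by (simp only: powr_add)
    \<comment> \<open>The exponent on the left is smaller by 4 \<beta>.\<close>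
    also have "\<dots> \<le> B\<^sup>2 * 2 powr (3 * n + 2 * (real k * (n / 2 - \<beta>)))"
      using \<beta> by (intro mult_left_mono powr_mono) (auto simp: n_def algebra_simps)
    also have "\<dots> = (B * D * r ^ k)\<^sup>2"
      unfolding D_def r_def power_mult_distrib powr_add
      by (simp add: powr_power mult.commute mult.left_commute)
    finally show ?thesis
      by (rule power2_le_imp_le) (use B r in \<open>auto simp: D_def\<close>)
  qed
  have "(\<Sum>m\<in>F1. norm (c m)) \<le> real (card F1) * B"
    using sum_bounded_above[of F1 "\<lambda>m. norm (c m)" B] c by simp
  also have "real (card F1) \<le> real (card {m :: int^'n. \<forall>j. \<bar>of_int (m $ j) + a $ j\<bar> \<le> 1})"
    unfolding of_nat_le_iff
    by (rule card_mono[OF card_lattice_box_le(1)]) (auto simp: F1_def x_def)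
  then have "real (card F1) * B \<le> 3 ^ n * B"
    using card_lattice_box_le(2)[of 1 a] B by (intro mult_right_mono) (auto simp: n_def)
  finally have part1: "(\<Sum>m\<in>F1. norm (c m)) \<le> 3 ^ n * B" .
  have fF2: "finite F2" "F2 \<subseteq> F" using F by (auto simp: F2_def)
  define L where "L = Suc (Max (insert 0 (l ` F2)))"
  have lL: "l m < L" if "m \<in> F2" for m
    unfolding L_def using fF2 that by (auto simp: less_Suc_eq_le intro!: Max_ge)
  let ?g = "\<lambda>m. (l m, i m)"
  have "(\<Sum>m\<in>F2. norm (c m)) = (\<Sum>p\<in>?g ` F2. \<Sum>m\<in>{m \<in> F2. ?g m = p}. norm (c m))"
    by (rule sum.image_gen[OF fF2(1)])
  also have "\<dots> \<le> (\<Sum>p\<in>?g ` F2. B * D * r ^ fst p)"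
  proof (rule sum_mono)
    fix p assume "p \<in> ?g ` F2"
    show "(\<Sum>m\<in>{m \<in> F2. ?g m = p}. norm (c m)) \<le> B * D * r ^ fst p"
      by (rule shell[of _ _ "snd p"]) (use li fF2 in auto)
  qed
  also have "\<dots> \<le> (\<Sum>p\<in>{..<L} \<times> (UNIV :: 'n set). B * D * r ^ fst p)"
  proof (rule sum_mono2)
    show "?g ` F2 \<subseteq> {..<L} \<times> (UNIV :: 'n set)" using lL by auto
  qed (use B r in \<open>auto simp: D_def\<close>)
  also have "\<dots> = (\<Sum>k<L. \<Sum>j\<in>(UNIV::'n set). B * D * r ^ k)"
    by (subst sum.cartesian_product) (simp add: case_prod_beta)
  also have "\<dots> = real n * B * D * (\<Sum>k<L. r ^ k)"
    by (simp add: n_def sum_distrib_left mult_ac)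
  also have "\<dots> \<le> real n * B * D * (1 / (1 - r))"
  proof (intro mult_left_mono)
    have "(\<Sum>k<L. r ^ k) \<le> (\<Sum>k. r ^ k)"
      using r by (intro sum_le_suminf summable_geometric) auto
    then show "(\<Sum>k<L. r ^ k) \<le> 1 / (1 - r)"
      using r by (simp add: suminf_geometric)
  qed (use B in \<open>auto simp: D_def\<close>)
  finally have part2: "(\<Sum>m\<in>F2. norm (c m)) \<le> real n * B * D * (1 / (1 - r))" .
  have "(\<Sum>m\<in>F. norm (c m)) = (\<Sum>m\<in>F1. norm (c m)) + (\<Sum>m\<in>F2. norm (c m))"
    unfolding F2_def using F by (intro sum.subset_diff[of F1, THEN trans] add.commute) (auto simp: F1_def)
  also have "\<dots> \<le> B * bernstein_const n \<beta>"
  proof -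
    have "bernstein_const n \<beta> = 3 ^ n + real n * D / (1 - r)"
      by (simp add: bernstein_const_def D_def r_def)
    with part1 part2 show ?thesis by (simp add: algebra_simps)
  qed
  finally show ?thesis by (simp add: n_def)
qed

section \<open>Finite differences\<close>

text \<open>Differences stand in for derivatives because smoothness of fractional order \<beta> is
  measured by them, while on the Fourier side a difference is multiplication by exp(2 pi i t m_i) -
  1.\<close>

definition shift_diff :: "'n \<Rightarrow> real \<Rightarrow> (real^'n::finite \<Rightarrow> 'b::real_normed_vector) \<Rightarrow> real^'n \<Rightarrow> 'b" where
  "shift_diff i t f x = f (x + axis i t) - f x"

lemma has_derivative_translate:
  assumes "(f has_derivative f') (at (x + h))"
  shows "((\<lambda>x. f (x + h)) has_derivative f') (at x)"
proof -
  have "((\<lambda>x. x + h) has_derivative (\<lambda>x. x)) (at x)"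
    by (auto intro!: derivative_eq_intros)
  from has_derivative_compose[OF this assms] show ?thesis .
qed

lemma partial_translate:
  assumes "\<And>x. f differentiable (at x)"
  shows "(\<lambda>x. f (x + h)) differentiable (at x)"
    and "partial i (\<lambda>x. f (x + h)) = (\<lambda>x. partial i f (x + h))"
proof -
  have d: "(f has_derivative frechet_derivative f (at x)) (at x)" for x
    using assms by (simp add: frechet_derivative_works)
  show "(\<lambda>x. f (x + h)) differentiable (at x)"
    using has_derivative_translate[OF d] by (auto simp: differentiable_def)
  show "partial i (\<lambda>x. f (x + h)) = (\<lambda>x. partial i f (x + h))"
    by (rule ext) (simp add: partial_def frechet_derivative_at[OF has_derivative_translate[OF d], symmetric])
qed

lemma partial_diff:
  assumes "\<And>x. f differentiable (at x)" "\<And>x. g differentiable (at x)"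
  shows "partial i (\<lambda>x. f x - g x) = (\<lambda>x. partial i f x - partial i g x)"
proof
  fix x
  have "((\<lambda>x. f x - g x) has_derivative
      (\<lambda>h. frechet_derivative f (at x) h - frechet_derivative g (at x) h)) (at x)"
    using assms by (intro has_derivative_diff) (simp_all add: frechet_derivative_works)
  from frechet_derivative_at[OF this, symmetric]
  show "partial i (\<lambda>x. f x - g x) x = partial i f x - partial i g x"
    by (simp add: partial_def)
qed

lemma shift_diff_differentiable:
  assumes "\<And>x. f differentiable (at x)"
  shows "shift_diff i t f differentiable (at x)"
    and "partial j (shift_diff i t f) = shift_diff i t (partial j f)"
proof -
  note * = partial_translate[OF assms]
  show "shift_diff i t f differentiable (at x)"
    unfolding shift_diff_def by (intro differentiable_diff * assms)
  show "partial j (shift_diff i t f) = shift_diff i t (partial j f)"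
    unfolding shift_diff_def by (subst partial_diff[OF *(1) assms]) (simp add: *(2))
qed

lemma C_k_shift_diff: "C_k k f \<Longrightarrow> C_k k (shift_diff i t f)"
proof (induction k arbitrary: f)
  case 0
  then have "continuous_on UNIV (\<lambda>x. f (x + axis i t))"
    by (auto intro!: continuous_on_compose2[of UNIV f UNIV] continuous_intros)
  with 0 show ?case
    unfolding shift_diff_def C_k.simps by (intro continuous_intros)
next
  case (Suc k)
  then have d: "\<And>x. f differentiable (at x)" and C: "\<And>i. C_k k (partial i f)" by simp_all
  show ?case
    unfolding C_k.simps shift_diff_differentiable(2)[OF d]
    by (intro conjI allI shift_diff_differentiable(1) Suc.IH d C)
qed

lemma C_k_continuous: "C_k k f \<Longrightarrow> continuous_on UNIV f"
  by (cases k) (simp_all add: differentiable_imp_continuous_on differentiable_on_def)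

lemma partials_Cons_snoc: "partials (replicate (Suc k) i) f = partials (replicate k i) (partial i f)"
  by (simp add: partials_def foldr_replicate funpow_swap1)

lemma partials_shift_diff:
  "C_k k f \<Longrightarrow> partials (replicate k j) (shift_diff i t f) = shift_diff i t (partials (replicate k j) f)"
proof (induction k arbitrary: f)
  case 0
  then show ?case by (simp add: partials_def)
next
  case (Suc k)
  then show ?case
    unfolding partials_Cons_snoc by (subst shift_diff_differentiable(2)) (simp_all only: C_k.simps)
qed

lemma shift_diff_iter:
  assumes "C_k (Suc k) f"
  shows "(shift_diff i t ^^ K) f differentiable (at x)"
    and "partial j ((shift_diff i t ^^ K) f) = (shift_diff i t ^^ K) (partial j f)"
proof -
  have "(\<forall>x. (shift_diff i t ^^ K) f differentiable (at x)) \<and>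
    partial j ((shift_diff i t ^^ K) f) = (shift_diff i t ^^ K) (partial j f)"
  proof (induction K)
    case 0
    then show ?case using assms by simp
  next
    case (Suc K)
    then have d: "\<And>x. (shift_diff i t ^^ K) f differentiable (at x)" by blast
    from Suc show ?case
      by (simp add: shift_diff_differentiable(1)[OF d] shift_diff_differentiable(2)[OF d])
  qed
  then show "(shift_diff i t ^^ K) f differentiable (at x)"
    "partial j ((shift_diff i t ^^ K) f) = (shift_diff i t ^^ K) (partial j f)" by auto
qed

lemma norm_shift_diff_le:
  fixes f :: "real^'n::finite \<Rightarrow> 'b::real_normed_vector"
  assumes d: "\<And>x. f differentiable (at x)" and t: "t \<ge> 0" and M: "M \<ge> 0"
    and bound: "\<And>s. 0 \<le> s \<Longrightarrow> s \<le> t \<Longrightarrow> norm (partial i f (x + axis i s)) \<le> M"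
  shows "norm (shift_diff i t f x) \<le> M * t"
proof -
  define g where "g s = f (x + axis i s)" for s
  have g: "(g has_derivative (\<lambda>h. h *\<^sub>R partial i f (x + axis i s))) (at s within {0..t})" for s
  proof -
    have ax: "axis i h = h *\<^sub>R axis i (1::real)" for h
      by (simp add: vec_eq_iff axis_def)
    have "((\<lambda>s. x + s *\<^sub>R axis i 1) has_derivative (\<lambda>h. h *\<^sub>R axis i 1)) (at s within {0..t})"
      by (auto intro!: derivative_eq_intros)
    then have 1: "((\<lambda>s. x + axis i s) has_derivative (\<lambda>h. axis i h)) (at s within {0..t})"
      by (simp only: ax[symmetric])
    have 2: "(f has_derivative frechet_derivative f (at (x + axis i s))) (at (x + axis i s))"
      using d by (simp add: frechet_derivative_works)
    have "linear (frechet_derivative f (at (x + axis i s)))"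
      using 2 by (rule has_derivative_linear)
    then have 3: "frechet_derivative f (at (x + axis i s)) (axis i h) = h *\<^sub>R partial i f (x + axis i s)" for h
      unfolding partial_def by (subst ax[of h]) (rule linear_scale)
    show ?thesis
      unfolding g_def using has_derivative_compose[OF 1 2] by (simp add: 3)
  qed
  have "norm (g t - g 0) \<le> M * norm (t - 0)"
  proof (rule differentiable_bound[of "{0..t}" g])
    show "onorm (\<lambda>h. h *\<^sub>R partial i f (x + axis i s)) \<le> M" if "s \<in> {0..t}" for s
    proof (rule onorm_bound[OF M])
      show "norm (h *\<^sub>R partial i f (x + axis i s)) \<le> M * norm h" for h
        using mult_left_mono[OF bound[of s], of "\<bar>h\<bar>"] that by (simp add: mult.commute)
    qed
  qed (use g t in auto)
  then show ?thesis
    using t by (simp add: g_def shift_diff_def axis_eq_0_iff[THEN iffD2])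
qed

text \<open>Differences commute with partial derivatives, and each costs a factor t by the mean
  value inequality. The derivative is evaluated along a segment of length at most 1, hence the
  factor \<Lambda> by which w may change there. For Hoelder functions w is 1, for decaying functions
  it is \<open>weight\<close>.\<close>

lemma norm_shift_diff_iter_le:
  fixes f :: "real^'n::finite \<Rightarrow> 'b::real_normed_vector"
  assumes w: "\<And>x. w x \<ge> 0" "\<And>x s. 0 \<le> s \<Longrightarrow> s \<le> 1 \<Longrightarrow> w (x + axis i s) \<le> \<Lambda> * w x"
    and t: "0 \<le> t" "t \<le> 1" and C: "C \<ge> 0" "\<Lambda> \<ge> 0"
  shows "C_k K f \<Longrightarrow> (\<And>x. norm (partials (replicate K i) f x) \<le> C * w x) \<Longrightarrow>
    norm ((shift_diff i t ^^ K) f x) \<le> C * \<Lambda> ^ K * t ^ K * w x"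
proof (induction K arbitrary: f x)
  case 0
  then show ?case by (simp add: partials_def)
next
  case (Suc K)
  let ?g = "(shift_diff i t ^^ K) f"
  have IH: "norm (partial i ?g y) \<le> C * \<Lambda> ^ K * t ^ K * w y" for y
    unfolding shift_diff_iter[OF Suc.prems(1)]
    using Suc.prems by (intro Suc.IH) (auto simp: partials_Cons_snoc simp del: replicate_Suc)
  have "norm (shift_diff i t ?g x) \<le> (C * \<Lambda> ^ K * t ^ K * (\<Lambda> * w x)) * t"
  proof (rule norm_shift_diff_le)
    show "?g differentiable (at y)" for y
      by (rule shift_diff_iter[OF Suc.prems(1)])
    show "norm (partial i ?g (x + axis i s)) \<le> C * \<Lambda> ^ K * t ^ K * (\<Lambda> * w x)"
      if "0 \<le> s" "s \<le> t" for s
      by (rule order_trans[OF IH], intro mult_left_mono w(2)) (use that t C in auto)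
  qed (use t C w in auto)
  then show ?case by (simp add: mult_ac)
qed

text \<open>Of the k + 1 differences, with k the integer part of \<beta>, k are converted into
  derivatives and give t^k; the last one meets the Hoelder condition and gives t^(\<beta> -
  k).\<close>

lemma norm_shift_diff_Holder_le:
  assumes R: "R \<in> torus_Holder \<beta>" and \<beta>: "\<beta> > 0"
  obtains C where "C \<ge> 0"
    "\<And>i t x. 0 < t \<Longrightarrow> t \<le> 1 \<Longrightarrow> norm ((shift_diff i t ^^ Suc (nat \<lfloor>\<beta>\<rfloor>)) R x) \<le> C * t powr \<beta>"
proof -
  define k where "k = nat \<lfloor>\<beta>\<rfloor>"
  obtain C where C: "C_k k R" "\<And>ds x y. length ds = k \<Longrightarrow>
      norm (partials ds R x - partials ds R y) \<le> C * dist x y powr (\<beta> - \<lfloor>\<beta>\<rfloor>)"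
    using R unfolding torus_Holder_def k_def by blast
  have "norm ((shift_diff i t ^^ Suc k) R x) \<le> \<bar>C\<bar> * t powr \<beta>" if t: "0 < t" "t \<le> 1" for i t x
  proof -
    have "norm ((shift_diff i t ^^ k) (shift_diff i t R) x) \<le>
        \<bar>C\<bar> * t powr (\<beta> - \<lfloor>\<beta>\<rfloor>) * 1 ^ k * t ^ k * 1"
    proof (rule norm_shift_diff_iter_le[where w = "\<lambda>x. 1"])
      show "C_k k (shift_diff i t R)" by (rule C_k_shift_diff[OF C(1)])
      fix y
      have "norm (partials (replicate k i) (shift_diff i t R) y) \<le>
          C * dist (y + axis i t) y powr (\<beta> - \<lfloor>\<beta>\<rfloor>)"
        unfolding partials_shift_diff[OF C(1)] unfolding shift_diff_def by (rule C(2)) simp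
      also have "\<dots> \<le> \<bar>C\<bar> * t powr (\<beta> - \<lfloor>\<beta>\<rfloor>)"
        using t by (simp add: dist_norm norm_eq_sqrt_inner inner_axis mult_right_mono)
      finally show "norm (partials (replicate k i) (shift_diff i t R) y) \<le> \<bar>C\<bar> * t powr (\<beta> - \<lfloor>\<beta>\<rfloor>) * 1"
        by simp
    qed (use t in auto)
    also have "\<dots> = \<bar>C\<bar> * (t powr (\<beta> - \<lfloor>\<beta>\<rfloor>) * t powr \<lfloor>\<beta>\<rfloor>)"
      using t \<beta> by (simp add: k_def powr_real_of_int)
    also have "\<dots> = \<bar>C\<bar> * t powr \<beta>"
      by (simp add: powr_add[symmetric])
    finally show ?thesis by (simp add: funpow_Suc_right del: funpow.simps)
  qed
  then show thesis using that[of "\<bar>C\<bar>"] by (simp add: k_def)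
qed

lemma shift_diff_periodic: "Z_periodic f \<Longrightarrow> Z_periodic (shift_diff i t f)"
  unfolding Z_periodic_def shift_diff_def by (metis add.assoc add.commute)

lemma fcoef_shift_diff:
  assumes "continuous_on UNIV f" "Z_periodic f"
  shows "fcoef (shift_diff i t f) m = (cis (2 * pi * (t * of_int (m $ i))) - 1) * fcoef f m"
proof -
  have cont: "continuous_on UNIV (\<lambda>x. f (x + axis i t))"
    by (rule continuous_on_compose2[OF assms(1)]) (auto intro!: continuous_intros)
  have "fcoef (shift_diff i t f) m = fcoef (\<lambda>x. f (x + axis i t)) m - fcoef f m"
    unfolding fcoef_def shift_diff_def right_diff_distrib
    by (intro torus_integral_linear(2) torus_integrable_continuous continuous_intros cont assms)
  also have "\<dots> = (ech (lattice m) (axis i t) - 1) * fcoef f m"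
    by (simp add: fcoef_translate[OF assms] algebra_simps)
  also have "ech (lattice m) (axis i t) = cis (2 * pi * (t * of_int (m $ i)))"
    by (simp add: ech_def inner_axis mult.commute)
  finally show ?thesis .
qed

lemma fcoef_shift_diff_iter:
  assumes "continuous_on UNIV f" "Z_periodic f"
  shows "continuous_on UNIV ((shift_diff i t ^^ K) f) \<and> Z_periodic ((shift_diff i t ^^ K) f) \<and>
    fcoef ((shift_diff i t ^^ K) f) m = (cis (2 * pi * (t * of_int (m $ i))) - 1) ^ K * fcoef f m"
proof (induction K)
  case (Suc K)
  then show ?case
    using C_k_shift_diff[of 0] by (auto simp: fcoef_shift_diff shift_diff_periodic)
qed (use assms in simp)

text \<open>Bessel's inequality for the iterated difference of R is the hypothesis of
  \<open>bernstein_sum\<close>; max B C is a common constant for the coefficients and the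
  differences.\<close>

lemma Holder_fcoef_summable:
  fixes R :: "real^'n::finite \<Rightarrow> complex"
  assumes R: "R \<in> torus_Holder \<beta>" and \<beta>: "\<beta> > real CARD('n) / 2"
  shows "(\<lambda>m. norm (fcoef R m)) summable_on UNIV"
proof -
  have \<beta>0: "\<beta> > 0" using \<beta> by (rule le_less_trans[rotated]) simp
  have cont: "continuous_on UNIV R" and per: "Z_periodic R"
    using R C_k_continuous by (auto simp: torus_Holder_def)
  obtain C where C: "C \<ge> 0" "\<And>i t x. 0 < t \<Longrightarrow> t \<le> 1 \<Longrightarrow>
      norm ((shift_diff i t ^^ Suc (nat \<lfloor>\<beta>\<rfloor>)) R x) \<le> C * t powr \<beta>"
    using norm_shift_diff_Holder_le[OF R \<beta>0] by blast
  obtain B where B: "B \<ge> 0" "\<And>x. norm (R x) \<le> B"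
    using periodic_bounded[OF cont per] by blast
  define K where "K = Suc (nat \<lfloor>\<beta>\<rfloor>)"
  have "(\<Sum>m\<in>F. norm (fcoef R m)) \<le> max B C * bernstein_const CARD('n) \<beta>" if F: "finite F" for F
  proof (rule bernstein_sum[OF \<beta> _ F, where a = 0 and K = K])
    show "norm (fcoef R m) \<le> max B C" for m
    proof (rule order_trans)
      show "norm (fcoef R m) \<le> B"
        unfolding fcoef_def using B
        by (intro norm_torus_integral_le torus_integrable_continuous continuous_intros cont)
           (simp add: norm_mult)
    qed simp
    fix i :: 'n and t :: real assume t: "0 < t" "t \<le> 1/4"
    note fc = fcoef_shift_diff_iter[OF cont per, where i = i and t = t and K = K]
    have "(\<Sum>m\<in>F. norm (cis (2 * pi * (t * (of_int (m $ i) + (0 :: real^'n) $ i))) - 1) ^ (2 * K) * (norm (fcoef R m))\<^sup>2)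
        = (\<Sum>m\<in>F. (norm (fcoef ((shift_diff i t ^^ K) R) m))\<^sup>2)"
      using fc by (intro sum.cong) (auto simp: norm_mult norm_power power_mult_distrib power_mult[symmetric] mult.commute)
    also have "\<dots> \<le> (C * t powr \<beta>)\<^sup>2"
      by (rule bessel_bound[OF F]) (use fc C(2) t in \<open>auto simp: K_def simp del: funpow.simps\<close>)
    also have "\<dots> \<le> (max B C * t powr \<beta>)\<^sup>2"
      using C(1) by (intro power_mono mult_right_mono) auto
    finally show "(\<Sum>m\<in>F. norm (cis (2 * pi * (t * (of_int (m $ i) + (0 :: real^'n) $ i))) - 1) ^ (2 * K) * (norm (fcoef R m))\<^sup>2)
        \<le> (max B C * t powr \<beta>)\<^sup>2" .
  qed (use B in auto)
  then show ?thesis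
    by (intro nonneg_bdd_above_summable_on bdd_aboveI2) auto
qed

section \<open>Periodization of decaying functions\<close>

text \<open>A product over the coordinates instead of a power of the norm, so that lattice sums
  factor into one-dimensional sums of inverse squares. It is bounded below by (1 + |x|)^(-2n), which
  links it to the Schwartz seminorms.\<close>

definition weight :: "real^'n::finite \<Rightarrow> real" where
  "weight x = (\<Prod>i\<in>UNIV. 1 / (1 + \<bar>x $ i\<bar>)\<^sup>2)"

lemma weight_pos: "weight x > 0"
  by (auto simp: weight_def intro!: prod_pos)

lemma inverse_square_shift:
  fixes y z :: real
  assumes "\<bar>z\<bar> \<le> 1"
  shows "1 / (1 + \<bar>y + z\<bar>)\<^sup>2 \<le> 4 * (1 / (1 + \<bar>y\<bar>)\<^sup>2)"
proof -
  have "1 + \<bar>y\<bar> \<le> 1 + \<bar>y + z\<bar> + (1 + \<bar>y + z\<bar>)" using assms by arith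
  then have "1 + \<bar>y\<bar> \<le> 2 * (1 + \<bar>y + z\<bar>)" by (simp only: mult_2)
  then have "(1 + \<bar>y\<bar>)\<^sup>2 \<le> (2 * (1 + \<bar>y + z\<bar>))\<^sup>2" by (intro power_mono) auto
  then have "(1 + \<bar>y\<bar>)\<^sup>2 \<le> 4 * (1 + \<bar>y + z\<bar>)\<^sup>2" by (simp only: power_mult_distrib) simp
  moreover have "(1 + \<bar>y\<bar>)\<^sup>2 > 0" "(1 + \<bar>y + z\<bar>)\<^sup>2 > 0" by (simp_all add: add_pos_nonneg)
  moreover have "1 / p \<le> 4 * (1 / q)" if "q \<le> 4 * p" "q > 0" "p > 0" for p q :: real
    using that by (simp add: field_simps)
  ultimately show ?thesis by blast
qed

lemma weight_shift:
  assumes "0 \<le> s" "s \<le> 1"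
  shows "weight (x + axis i s) \<le> 4 * weight x"
proof -
  have "weight (x + axis i s) \<le> (\<Prod>j\<in>UNIV. (if j = i then 4 else 1) * (1 / (1 + \<bar>x $ j\<bar>)\<^sup>2))"
    unfolding weight_def
  proof (rule prod_mono, intro conjI)
    fix j
    show "1 / (1 + \<bar>(x + axis i s) $ j\<bar>)\<^sup>2 \<le> (if j = i then 4 else 1) * (1 / (1 + \<bar>x $ j\<bar>)\<^sup>2)"
      using inverse_square_shift[of s "x $ j"] assms by (cases "j = i") (simp_all add: axis_def)
  qed simp
  also have "\<dots> = 4 * weight x"
    by (simp only: prod.distrib weight_def) (simp add: prod.delta)
  finally show ?thesis .
qed

lemma weight_translate:
  fixes x y :: "real^'n::finite"
  assumes "\<And>i. \<bar>x $ i\<bar> \<le> 1"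
  shows "weight (x + y) \<le> 4 ^ CARD('n) * weight y"
proof -
  have "weight (x + y) \<le> (\<Prod>j\<in>UNIV. 4 * (1 / (1 + \<bar>y $ j\<bar>)\<^sup>2))"
    unfolding weight_def
  proof (rule prod_mono, intro conjI)
    fix j
    show "1 / (1 + \<bar>(x + y) $ j\<bar>)\<^sup>2 \<le> 4 * (1 / (1 + \<bar>y $ j\<bar>)\<^sup>2)"
      using inverse_square_shift[of "x $ j" "y $ j"] assms[of j] by (simp add: add.commute)
  qed simp
  also have "\<dots> = 4 ^ CARD('n) * weight y"
    by (simp only: prod.distrib weight_def prod_constant)
  finally show ?thesis .
qed

lemma inverse_power_le_weight:
  fixes x :: "real^'n::finite"
  shows "1 / (1 + norm x) ^ (2 * CARD('n)) \<le> weight x"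
proof -
  have "1 / (1 + norm x) ^ (2 * CARD('n)) = (\<Prod>i\<in>(UNIV::'n set). 1 / (1 + norm x)\<^sup>2)"
    by (simp add: power_mult power_one_over)
  also have "\<dots> \<le> weight x"
    unfolding weight_def
  proof (rule prod_mono, intro conjI)
    fix i
    have "0 < (1 + \<bar>x $ i\<bar>)\<^sup>2" by (simp add: add_pos_nonneg)
    moreover have "(1 + \<bar>x $ i\<bar>)\<^sup>2 \<le> (1 + norm x)\<^sup>2"
      using component_le_norm_cart[of x i] by (intro power_mono) auto
    ultimately show "1 / (1 + norm x)\<^sup>2 \<le> 1 / (1 + \<bar>x $ i\<bar>)\<^sup>2"
      by (intro divide_left_mono mult_pos_pos) auto
  qed simp
  finally show ?thesis .
qed

lemma summable_inverse_squares: "summable (\<lambda>n. 1 / (1 + real n)\<^sup>2)"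
  using inverse_power_summable[of 2, where 'a=real] summable_Suc_iff[of "\<lambda>n. inverse (real n ^ 2)"]
  by (simp add: inverse_eq_divide add.commute)

text \<open>Counted from the integer part of y, the numbers |y + j| are at least 0, 1, 2, ... on
  either side, whence the factor 2.\<close>

lemma sum_inverse_square_translates:
  fixes y :: real
  assumes "finite G"
  shows "(\<Sum>j\<in>G. 1 / (1 + \<bar>y + of_int j\<bar>)\<^sup>2) \<le> 2 * (\<Sum>n. 1 / (1 + real n)\<^sup>2)"
proof -
  define p where "p = \<lfloor>y\<rfloor>"
  define G1 where "G1 = {j \<in> G. j + p \<ge> 0}"
  define G2 where "G2 = {j \<in> G. j + p < 0}"
  have le: "1 / (1 + u)\<^sup>2 \<le> 1 / (1 + v)\<^sup>2" if "v \<le> u" "v \<ge> 0" for u v :: real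
  proof -
    have "0 < (1 + v)\<^sup>2" "(1 + v)\<^sup>2 \<le> (1 + u)\<^sup>2"
      using that by (auto intro!: power_mono simp: add_pos_nonneg)
    then show ?thesis by (intro divide_left_mono mult_pos_pos) auto
  qed
  have half: "(\<Sum>j\<in>G'. 1 / (1 + \<bar>y + of_int j\<bar>)\<^sup>2) \<le> (\<Sum>n. 1 / (1 + real n)\<^sup>2)"
    if "finite G'" "inj_on h G'" "\<And>j. j \<in> G' \<Longrightarrow> real (h j) \<le> \<bar>y + of_int j\<bar>" for G' h
  proof -
    have "(\<Sum>j\<in>G'. 1 / (1 + \<bar>y + of_int j\<bar>)\<^sup>2) \<le> (\<Sum>j\<in>G'. 1 / (1 + real (h j))\<^sup>2)"
      using that(3) by (intro sum_mono le) auto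
    also have "\<dots> = (\<Sum>n\<in>h ` G'. 1 / (1 + real n)\<^sup>2)"
      by (simp add: sum.reindex[OF that(2)])
    also have "\<dots> \<le> (\<Sum>n. 1 / (1 + real n)\<^sup>2)"
      using that(1) by (intro sum_le_suminf summable_inverse_squares) auto
    finally show ?thesis .
  qed
  have "(\<Sum>j\<in>G1. 1 / (1 + \<bar>y + of_int j\<bar>)\<^sup>2) \<le> (\<Sum>n. 1 / (1 + real n)\<^sup>2)"
  proof (rule half[of _ "\<lambda>j. nat (j + p)"])
    show "real (nat (j + p)) \<le> \<bar>y + of_int j\<bar>" if "j \<in> G1" for j
    proof -
      have "real (nat (j + p)) = of_int (j + p)" using that by (simp add: G1_def)
      then show ?thesis unfolding p_def by linarith
    qed
  qed (auto simp: G1_def assms inj_on_def)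
  moreover have "(\<Sum>j\<in>G2. 1 / (1 + \<bar>y + of_int j\<bar>)\<^sup>2) \<le> (\<Sum>n. 1 / (1 + real n)\<^sup>2)"
  \<comment> \<open>For negative j + p the bound is one less than -(j + p), since y may lie just
    below p + 1.\<close>
  proof (rule half[of _ "\<lambda>j. nat (- (j + p) - 1)"])
    show "real (nat (- (j + p) - 1)) \<le> \<bar>y + of_int j\<bar>" if "j \<in> G2" for j
    proof -
      have "real (nat (- (j + p) - 1)) = of_int (- (j + p) - 1)" using that by (simp add: G2_def)
      then show ?thesis unfolding p_def by linarith
    qed
  qed (auto simp: G2_def assms inj_on_def)
  moreover have "(\<Sum>j\<in>G. 1 / (1 + \<bar>y + of_int j\<bar>)\<^sup>2) =
      (\<Sum>j\<in>G1. 1 / (1 + \<bar>y + of_int j\<bar>)\<^sup>2) + (\<Sum>j\<in>G2. 1 / (1 + \<bar>y + of_int j\<bar>)\<^sup>2)"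
    using assms by (subst sum.union_disjoint[symmetric]) (auto simp: G1_def G2_def intro!: sum.cong)
  ultimately show ?thesis by linarith
qed

definition weight_const :: "nat \<Rightarrow> real" where
  "weight_const n = (2 * (\<Sum>k. 1 / (1 + real k)\<^sup>2)) ^ n"

lemma weight_const_nonneg: "weight_const n \<ge> 0"
  unfolding weight_const_def
  by (intro zero_le_power mult_nonneg_nonneg suminf_nonneg summable_inverse_squares) auto

text \<open>\<open>F\<close> lies in a finite grid, on which the sum of the products is the product
  of the one-dimensional sums.\<close>

lemma sum_weight_lattice:
  fixes x :: "real^'n::finite"
  assumes "finite F"
  shows "(\<Sum>k\<in>F. weight (x + lattice k)) \<le> weight_const CARD('n)"
proof -
  define G where "G = (\<Union>k\<in>F. range (\<lambda>i. k $ i))"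
  have G: "finite G" using assms by (auto simp: G_def)
  have fin: "finite (PiE (UNIV::'n set) (\<lambda>_. G))" using G by (intro finite_PiE) auto
  have sub: "F \<subseteq> vec_lambda ` PiE UNIV (\<lambda>_. G)"
  proof
    fix k assume "k \<in> F"
    then show "k \<in> vec_lambda ` PiE UNIV (\<lambda>_. G)"
      by (intro image_eqI[of _ _ "vec_nth k"]) (auto simp: G_def)
  qed
  have "(\<Sum>k\<in>F. weight (x + lattice k)) \<le> (\<Sum>k\<in>vec_lambda ` PiE UNIV (\<lambda>_. G). weight (x + lattice k))"
    using weight_pos by (intro sum_mono2[OF finite_imageI[OF fin] sub]) (auto intro: less_imp_le)
  also have "\<dots> = (\<Sum>g\<in>PiE UNIV (\<lambda>_. G). weight (x + lattice (vec_lambda g)))"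
    by (subst sum.reindex) (auto simp: inj_on_def vec_lambda_inject)
  also have "\<dots> = (\<Sum>g\<in>PiE UNIV (\<lambda>_. G). \<Prod>i\<in>UNIV. 1 / (1 + \<bar>x $ i + of_int (g i)\<bar>)\<^sup>2)"
    by (simp add: weight_def)
  also have "\<dots> = (\<Prod>i\<in>UNIV. \<Sum>j\<in>G. 1 / (1 + \<bar>x $ i + of_int j\<bar>)\<^sup>2)"
    by (rule prod_sum_PiE[symmetric]) (auto simp: G)
  also have "\<dots> \<le> (\<Prod>i\<in>(UNIV::'n set). 2 * (\<Sum>k. 1 / (1 + real k)\<^sup>2))"
    using sum_inverse_square_translates[OF G] by (intro prod_mono) (auto intro!: sum_nonneg)
  also have "\<dots> = weight_const CARD('n)"
    by (simp add: weight_const_def)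
  finally show ?thesis .
qed

lemma summable_bounded_partial_sums:
  fixes f :: "'a \<Rightarrow> complex"
  assumes "\<And>F. finite F \<Longrightarrow> (\<Sum>k\<in>F. norm (f k)) \<le> W"
  shows "(\<lambda>k. norm (f k)) summable_on UNIV" "(\<Sum>\<^sub>\<infinity>k. norm (f k)) \<le> W" "norm (\<Sum>\<^sub>\<infinity>k. f k) \<le> W"
proof -
  show 1: "(\<lambda>k. norm (f k)) summable_on UNIV"
    using assms by (intro nonneg_bdd_above_summable_on bdd_aboveI2[of _ _ W]) auto
  show 2: "(\<Sum>\<^sub>\<infinity>k. norm (f k)) \<le> W"
    using assms by (intro infsum_le_finite_sums 1) auto
  show "norm (\<Sum>\<^sub>\<infinity>k. f k) \<le> W"
    using norm_infsum_bound[OF 1] 2 by linarith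
qed

text \<open>Unfolding turns the integral of |g| into the integral of its lattice sums over the unit
  cell, at most W times the volume of the cell. The integrability of Fourier transforms is obtained
  in this way.\<close>

lemma integrable_by_unfolding:
  fixes g :: "real^'n::finite \<Rightarrow> complex"
  assumes g: "g \<in> borel_measurable borel"
    and W: "\<And>a F. finite F \<Longrightarrow> (\<Sum>k\<in>F. norm (g (a + lattice k))) \<le> W"
  shows "integrable lborel g"
proof (rule integrableI_bounded)
  show "g \<in> borel_measurable lborel" using g by simp
  have gm: "(\<lambda>x. ennreal (norm (g x))) \<in> borel_measurable borel" using g by measurable
  have part: "(\<Sum>n. ennreal (norm (g (a + lattice (enum n))))) \<le> ennreal W" for a
  proof (rule suminf_le_const[OF summableI])
    fix N
    have inj: "inj_on (enum :: nat \<Rightarrow> int^'n) {..<N}"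
      using bij_enum[OF infinite_vec] by (meson bij_betw_def inj_on_subset subset_UNIV)
    have "(\<Sum>n<N. norm (g (a + lattice (enum n)))) = (\<Sum>k\<in>enum ` {..<N}. norm (g (a + lattice k)))"
      by (simp add: sum.reindex[OF inj])
    also have "\<dots> \<le> W" by (rule W) simp
    finally have "ennreal (\<Sum>n<N. norm (g (a + lattice (enum n)))) \<le> ennreal W"
      by (rule ennreal_leI)
    also have "ennreal (\<Sum>n<N. norm (g (a + lattice (enum n)))) = (\<Sum>n<N. ennreal (norm (g (a + lattice (enum n)))))"
      by (rule sum_ennreal[symmetric]) (rule norm_ge_zero)
    finally show "(\<Sum>n<N. ennreal (norm (g (a + lattice (enum n))))) \<le> ennreal W" .
  qed
  have "(\<integral>\<^sup>+ x. norm (g x) \<partial>lborel) =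
      (\<integral>\<^sup>+ x. indicator unit_cell x * (\<Sum>n. ennreal (norm (g (x + lattice (enum n))))) \<partial>lborel)"
    by (rule nn_integral_unfold[OF gm, symmetric])
  also have "\<dots> \<le> (\<integral>\<^sup>+ x. ennreal W * indicator unit_cell (x::real^'n) \<partial>lborel)"
  proof (rule nn_integral_mono)
    fix x :: "real^'n"
    show "indicator unit_cell x * (\<Sum>n. ennreal (norm (g (x + lattice (enum n))))) \<le> ennreal W * indicator unit_cell x"
      by (subst mult.commute) (rule mult_right_mono[OF part], rule zero_le)
  qed
  also have "\<dots> = ennreal W * emeasure lborel (unit_cell :: (real^'n) set)"
    by (rule nn_integral_cmult_indicator) simp
  also have "\<dots> < \<infinity>"
  proof -
    have "emeasure lborel (unit_cell :: (real^'n) set) \<le> emeasure lborel (cbox 0 (1::real^'n))"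
      by (rule emeasure_mono) (auto simp: unit_cell_def mem_box_cart less_imp_le)
    also have "\<dots> < \<infinity>" by (rule emeasure_lborel_cbox_finite)
    finally show ?thesis by (simp add: ennreal_mult_less_top)
  qed
  finally show "(\<integral>\<^sup>+ x. norm (g x) \<partial>lborel) < \<infinity>" .
qed

lemma periodic_periodization: "Z_periodic (periodization f)" for f :: "real^'n::finite \<Rightarrow> complex"
  unfolding Z_periodic_def
proof (intro allI)
  fix l :: "int^'n" and x :: "real^'n"
  have "bij_betw (\<lambda>k. l + k) UNIV UNIV"
    by (rule bij_betw_byWitness[of _ "\<lambda>k. k - l"]) auto
  from infsum_reindex_bij_betw[OF this, of "\<lambda>k. f (x + lattice k)"]
  show "periodization f (x + lattice l) = periodization f x"
    by (simp add: periodization_def add.assoc)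
qed

lemma periodization_mult:
  assumes "Z_periodic h"
  shows "periodization (\<lambda>x. h x * f x) = (\<lambda>x. h x * periodization f x)"
  using assms unfolding periodization_def Z_periodic_def by (simp add: infsum_cmult_right')

section \<open>Continuous functions dominated by the weight\<close>

text \<open>The constant is a parameter because the estimates keep track of it: it carries a power
  of t for finite differences and the seminorm for Schwartz functions.\<close>

locale decaying =
  fixes f :: "real^'n::finite \<Rightarrow> complex" and C :: real
  assumes cont: "continuous_on UNIV f" and C: "C \<ge> 0" and bound: "\<And>x. norm (f x) \<le> C * weight x"
begin

lemma partial_sums:
  "finite F \<Longrightarrow> (\<Sum>k\<in>F. norm (f (x + lattice k))) \<le> C * weight_const CARD('n)"
proof -
  assume F: "finite F"
  have "(\<Sum>k\<in>F. norm (f (x + lattice k))) \<le> (\<Sum>k\<in>F. C * weight (x + lattice k))"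
    by (intro sum_mono bound)
  also have "\<dots> \<le> C * weight_const CARD('n)"
    unfolding sum_distrib_left[symmetric] by (intro mult_left_mono sum_weight_lattice F C)
  finally show ?thesis .
qed

lemmas summable = summable_bounded_partial_sums(1)[OF partial_sums]

lemma norm_periodization_le: "norm (periodization f x) \<le> C * weight_const CARD('n)"
  unfolding periodization_def by (rule summable_bounded_partial_sums(3)[OF partial_sums])

lemma integrable: "integrable lborel f"
  by (rule integrable_by_unfolding[OF borel_measurable_continuous_onI[OF cont] partial_sums])

text \<open>Uniform convergence is obtained on the cube (-1,1)^n, where the weight at x + k is
  bounded by a multiple of the weight at k; periodicity carries continuity to all other
  points.\<close>

lemma continuous_periodization: "continuous_on UNIV (periodization f)"
proof -
  define U where "U = {x :: real^'n. \<forall>i. \<bar>x $ i\<bar> < 1}"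
  have "open U"
  proof -
    have "U = (\<Inter>i. {x. \<bar>x $ i\<bar> < 1})" by (auto simp: U_def)
    moreover have "open {x :: real^'n. \<bar>x $ i\<bar> < 1}" for i
      by (intro open_Collect_less continuous_intros)
    ultimately show ?thesis by (simp add: open_INT)
  qed
  \<comment> \<open>\<open>q k\<close> bounds the k-th term on \<open>U\<close>, and C + 1 keeps it
    positive. Dividing by it gives the normalized terms \<open>E\<close> that
    \<open>continuous_on_infsum\<close> asks for, set to 0 outside \<open>U\<close> so that their
    bound is global.\<close>
  define q where "q k = (C + 1) * 4 ^ CARD('n) * weight (lattice k :: real^'n)" for k
  have q: "q k > 0" for k
    unfolding q_def using C by (intro mult_pos_pos weight_pos) auto
  define E where "E k x = (if x \<in> U then f (x + lattice k) / of_real (q k) else 0)" for k x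
  have fq: "norm (f (x + lattice k)) \<le> q k" if "x \<in> U" for x k
  proof -
    have "norm (f (x + lattice k)) \<le> C * weight (x + lattice k)" by (rule bound)
    also have "\<dots> \<le> C * (4 ^ CARD('n) * weight (lattice k :: real^'n))"
      using that C by (intro mult_left_mono weight_translate) (auto simp: U_def less_imp_le)
    also have "\<dots> \<le> q k"
      using weight_pos[of "lattice k :: real^'n"] by (simp add: q_def algebra_simps)
    finally show ?thesis .
  qed
  have "continuous_on U (\<lambda>x. \<Sum>\<^sub>\<infinity>k. of_real (q k) * E k x)"
  proof (rule continuous_on_infsum[OF infinite_vec])
    have "(\<Sum>k\<in>F. norm (complex_of_real (q k))) \<le> (C + 1) * 4 ^ CARD('n) * weight_const CARD('n)"
      if "finite F" for F
    proof -
      have "(\<Sum>k\<in>F. norm (complex_of_real (q k))) = (\<Sum>k\<in>F. q k)"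
        using q by (intro sum.cong) (auto simp del: of_real_mult simp: less_imp_le)
      also have "\<dots> = (C + 1) * 4 ^ CARD('n) * (\<Sum>k\<in>F. weight (lattice k :: real^'n))"
        by (simp add: q_def sum_distrib_left)
      also have "\<dots> \<le> (C + 1) * 4 ^ CARD('n) * weight_const CARD('n)"
        using sum_weight_lattice[OF that, of "0 :: real^'n"] C by (intro mult_left_mono) auto
      finally show ?thesis .
    qed
    then show "(\<lambda>k. norm (complex_of_real (q k))) summable_on UNIV"
      by (rule summable_bounded_partial_sums(1))
    show "norm (E k x) \<le> 1" for k x
      using fq[of x k] q[of k] by (simp add: E_def norm_divide)
    fix k
    have "continuous_on U (\<lambda>x. f (x + lattice k) / of_real (q k))"
      using q[of k] by (intro continuous_intros continuous_on_compose2[OF cont]) auto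
    then show "continuous_on U (E k)"
      by (rule continuous_on_cong[THEN iffD1, rotated 2]) (auto simp: E_def)
  qed
  moreover have "(\<Sum>\<^sub>\<infinity>k. of_real (q k) * E k x) = periodization f x" if "x \<in> U" for x
    unfolding periodization_def using that q by (intro infsum_cong) (simp add: E_def less_imp_neq[symmetric])
  ultimately have contU: "continuous_on U (periodization f)"
    by (rule continuous_on_cong[THEN iffD1, rotated 2, OF _ refl]) auto
  have "isCont (periodization f) x" for x
  proof -
    have "x + lattice (\<chi> i. - \<lfloor>x $ i\<rfloor>) \<in> unit_cell" by (simp only: unit_cell_translate)
    then obtain k where "x + lattice k \<in> unit_cell" by blast
    then have "x + lattice k \<in> U" by (auto simp: unit_cell_def U_def)
    with contU \<open>open U\<close> have "isCont (periodization f) (x + lattice k)"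
      by (simp add: continuous_on_eq_continuous_at)
    then have "isCont (\<lambda>y. periodization f (y + lattice k)) x"
      by (intro isCont_o2[where g = "periodization f" and f = "\<lambda>y. y + lattice k"]) (auto intro!: continuous_intros)
    then show ?thesis
      using periodic_periodization[of f] by (simp add: Z_periodic_def)
  qed
  then show ?thesis by (simp add: continuous_on_eq_continuous_at)
qed

end

lemma decaying_ech_mult:
  assumes "decaying f C"
  shows "decaying (\<lambda>x. ech v x * f x) C"
  using assms by (auto simp: decaying_def norm_mult intro!: continuous_intros)

section \<open>Fourier inversion\<close>

text \<open>\<open>fourier\<close> has no 2 pi in its exponent while the characters have; the two
  conventions agree after scaling the frequency by 2 pi.\<close>

lemma exp_ech: "exp (- \<i> * of_real (y \<bullet> ((2 * pi) *\<^sub>R x))) = ech (- x) y"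
  "exp (\<i> * of_real (y \<bullet> ((2 * pi) *\<^sub>R x))) = ech x y"
  by (simp_all add: ech_def cis_conv_exp inner_commute mult_ac)

lemma fourier_ech: "fourier f ((2 * pi) *\<^sub>R x) = (\<integral>y. ech (- x) y * f y \<partial>lborel)"
  by (simp only: fourier_def exp_ech)

lemma integrable_ech_mult: "integrable lborel f \<Longrightarrow> integrable lborel (\<lambda>y. ech v y * f y)"
  by (rule Bochner_Integration.integrable_bound[of _ f]) (auto simp: norm_mult)

text \<open>Poisson summation in coefficient form: unfolding the torus integral gives the Fourier
  transform, and the modulation by \<open>ech (- a)\<close> moves the sampling points from m to m +
  a.\<close>

lemma fcoef_periodization:
  assumes "integrable lborel f"
  shows "fcoef (periodization (\<lambda>y. ech (- a) y * f y)) m = fourier f ((2 * pi) *\<^sub>R (lattice m + a))"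
proof -
  have "fcoef (periodization (\<lambda>y. ech (- a) y * f y)) m =
      torus_integral (\<lambda>x. ech (lattice (- m)) x * periodization (\<lambda>y. ech (- a) y * f y) x)"
    by (simp add: fcoef_def)
  also have "\<dots> = torus_integral (periodization (\<lambda>y. ech (lattice (- m)) y * (ech (- a) y * f y)))"
    by (simp only: periodization_mult[OF periodic_ech[of "- m"]])
  also have "\<dots> = (\<integral>y. ech (lattice (- m)) y * (ech (- a) y * f y) \<partial>lborel)"
    by (intro torus_integral_periodization integrable_ech_mult assms)
  also have "\<dots> = fourier f ((2 * pi) *\<^sub>R (lattice m + a))"
    by (simp add: fourier_ech ech_add_left[of "- lattice m" "- a", symmetric] mult.assoc[symmetric])
  finally show ?thesis .
qed

lemma integrable_shift_diff: "integrable lborel f \<Longrightarrow> integrable lborel (shift_diff i t f)"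
  for f :: "real^'n::finite \<Rightarrow> complex"
  unfolding shift_diff_def by (intro Bochner_Integration.integrable_diff lborel_translate)

lemma fourier_shift_diff:
  fixes f :: "real^'n::finite \<Rightarrow> complex"
  assumes f: "integrable lborel f"
  shows "fourier (shift_diff i t f) ((2 * pi) *\<^sub>R x) =
    (cis (2 * pi * (t * x $ i)) - 1) * fourier f ((2 * pi) *\<^sub>R x)"
proof -
  have "fourier (shift_diff i t f) ((2 * pi) *\<^sub>R x) =
      (\<integral>y. ech x (axis i t) * (ech (- x) (y + axis i t) * f (y + axis i t)) - ech (- x) y * f y \<partial>lborel)"
    unfolding fourier_ech shift_diff_def ech_add_right right_diff_distrib
    by (intro Bochner_Integration.integral_cong refl) (simp add: mult.assoc[symmetric] mult.commute[of _ "ech (- x) (axis i t)"] mult.left_commute)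
  also have "\<dots> = ech x (axis i t) * (\<integral>y. ech (- x) (y + axis i t) * f (y + axis i t) \<partial>lborel) - (\<integral>y. ech (- x) y * f y \<partial>lborel)"
    using lborel_translate(3)[OF integrable_ech_mult[OF f], of "- x" "axis i t"] integrable_ech_mult[OF f]
    by (subst Bochner_Integration.integral_diff) auto
  also have "(\<integral>y. ech (- x) (y + axis i t) * f (y + axis i t) \<partial>lborel) = (\<integral>y. ech (- x) y * f y \<partial>lborel)"
    using borel_measurable_integrable[OF integrable_ech_mult[OF f, of "- x"]]
    by (intro lborel_translate(2)) simp
  also have "ech x (axis i t) = cis (2 * pi * (t * x $ i))"
    by (simp add: ech_def inner_axis mult.commute)
  finally show ?thesis by (simp only: fourier_ech[of f] left_diff_distrib mult_1_left)
qed

lemma fourier_shift_diff_iter: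
  fixes f :: "real^'n::finite \<Rightarrow> complex"
  assumes f: "integrable lborel f"
  shows "integrable lborel ((shift_diff i t ^^ K) f) \<and>
    fourier ((shift_diff i t ^^ K) f) ((2 * pi) *\<^sub>R x) =
      (cis (2 * pi * (t * x $ i)) - 1) ^ K * fourier f ((2 * pi) *\<^sub>R x)"
  by (induction K) (auto simp: f integrable_shift_diff fourier_shift_diff)

lemma fourier_measurable:
  fixes f :: "real^'n::finite \<Rightarrow> complex"
  assumes [measurable]: "f \<in> borel_measurable borel"
  shows "fourier f \<in> borel_measurable borel"
proof -
  have "(\<lambda>p :: (real^'n) \<times> (real^'n). exp (- \<i> * of_real (snd p \<bullet> fst p)) :: complex) \<in> borel_measurable borel"
    by (intro borel_measurable_continuous_onI continuous_intros)
  then have [measurable]: "(\<lambda>p :: (real^'n) \<times> (real^'n). exp (- \<i> * of_real (snd p \<bullet> fst p)) :: complex)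
      \<in> borel_measurable (borel \<Otimes>\<^sub>M borel)"
    by (simp only: borel_prod)
  have "(\<lambda>p :: (real^'n) \<times> (real^'n). exp (- \<i> * of_real (snd p \<bullet> fst p)) * f (snd p)) \<in> borel_measurable (borel \<Otimes>\<^sub>M lborel)"
    by measurable
  then show ?thesis
    unfolding fourier_def[abs_def]
    by (intro lborel.borel_measurable_lebesgue_integral) (simp add: case_prod_beta)
qed

section \<open>Integrability of the Fourier transform, and inversion\<close>

text \<open>The derivatives are the pure ones of order n, because \<open>bernstein_sum\<close>
  treats each shell by differences in one coordinate direction; its exponent is n, which exceeds
  n/2.\<close>

locale smooth_decaying = decaying f C for f :: "real^'n::finite \<Rightarrow> complex" and C +
  assumes Ck: "C_k CARD('n) f"
    and bound_partials: "\<And>i x. norm (partials (replicate CARD('n) i) f x) \<le> C * weight x"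
begin

definition W where
  "W = C * 4 ^ CARD('n) * weight_const CARD('n) * bernstein_const CARD('n) (real CARD('n))"

text \<open>The bound is uniform in a, so that it can be integrated over the unit cell.\<close>

lemma sum_fourier_le:
  assumes F: "finite F"
  shows "(\<Sum>m\<in>F. norm (fourier f ((2 * pi) *\<^sub>R (lattice m + a)))) \<le> W"
proof -
  let ?n = "CARD('n)"
  let ?B = "C * 4 ^ ?n * weight_const ?n"
  let ?c = "\<lambda>m. fourier f ((2 * pi) *\<^sub>R (lattice m + a))"
  have n: "real ?n > real ?n / 2" by simp
  have B: "?B \<ge> 0" using C weight_const_nonneg by simp
  have "(\<Sum>m\<in>F. norm (?c m)) \<le> ?B * bernstein_const ?n (real ?n)"
  proof (rule bernstein_sum[OF n B F, where a = a and K = ?n])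
    fix m
    interpret e: decaying "\<lambda>y. ech (- a) y * f y" C
      by (rule decaying_ech_mult) (rule decaying_axioms)
    have "norm (?c m) = norm (fcoef (periodization (\<lambda>y. ech (- a) y * f y)) m)"
      by (simp only: fcoef_periodization[OF integrable])
    also have "\<dots> \<le> C * weight_const ?n"
      unfolding fcoef_def
      by (intro norm_torus_integral_le torus_integrable_continuous continuous_intros e.continuous_periodization)
         (simp add: norm_mult e.norm_periodization_le)
    also have "\<dots> \<le> ?B"
      using mult_right_mono[of 1 "4 ^ ?n :: real" "C * weight_const ?n"] C weight_const_nonneg[of ?n]
      by (simp add: mult_ac)
    finally show "norm (?c m) \<le> ?B" .
  next
    fix i :: 'n and t :: real assume t: "0 < t" "t \<le> 1/4"
    let ?D = "(shift_diff i t ^^ ?n) f"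
    have D: "continuous_on UNIV ?D"
    proof -
      have "C_k ?n ((shift_diff i t ^^ j) f)" for j
        by (induction j) (auto intro: Ck C_k_shift_diff)
      then show ?thesis by (rule C_k_continuous)
    qed
    have "norm (?D x) \<le> C * 4 ^ ?n * t ^ ?n * weight x" for x
      by (rule norm_shift_diff_iter_le)
         (use t C in \<open>auto intro: Ck bound_partials weight_shift less_imp_le[OF weight_pos]\<close>)
    then interpret d: decaying ?D "C * 4 ^ ?n * t ^ ?n"
      by unfold_locales (use D C t in auto)
    interpret e: decaying "\<lambda>y. ech (- a) y * ?D y" "C * 4 ^ ?n * t ^ ?n"
      by (rule decaying_ech_mult) (rule d.decaying_axioms)
    note fs = fourier_shift_diff_iter[OF integrable, where i = i and t = t and K = ?n]
    \<comment> \<open>The differences act on f before the modulation, so their multiplier is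
      evaluated at m + a rather than at m.\<close>
    have "fcoef (periodization (\<lambda>y. ech (- a) y * ?D y)) m =
        (cis (2 * pi * (t * (of_int (m $ i) + a $ i))) - 1) ^ ?n * ?c m" for m
      using fs[of "lattice m + a"] fcoef_periodization[OF d.integrable, of a m] by simp
    then have "(\<Sum>m\<in>F. norm (cis (2 * pi * (t * (of_int (m $ i) + a $ i))) - 1) ^ (2 * ?n) * (norm (?c m))\<^sup>2)
        = (\<Sum>m\<in>F. (norm (fcoef (periodization (\<lambda>y. ech (- a) y * ?D y)) m))\<^sup>2)"
      by (intro sum.cong) (auto simp: norm_mult norm_power power_mult_distrib power_mult[symmetric] mult.commute)
    also have "\<dots> \<le> (C * 4 ^ ?n * t ^ ?n * weight_const ?n)\<^sup>2"
      by (rule bessel_bound[OF F e.continuous_periodization e.norm_periodization_le])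
    also have "C * 4 ^ ?n * t ^ ?n * weight_const ?n = ?B * t powr real ?n"
      using t by (simp add: powr_realpow mult_ac)
    finally show "(\<Sum>m\<in>F. norm (cis (2 * pi * (t * (of_int (m $ i) + a $ i))) - 1) ^ (2 * ?n) * (norm (?c m))\<^sup>2)
        \<le> (?B * t powr real ?n)\<^sup>2" .
  qed
  then show ?thesis by (simp add: W_def)
qed

lemma integrable_fourier_scaled: "integrable lborel (\<lambda>x. fourier f ((2 * pi) *\<^sub>R x))"
proof (rule integrable_by_unfolding)
  show "(\<lambda>x. fourier f ((2 * pi) *\<^sub>R x)) \<in> borel_measurable borel"
    using measurable_compose[OF _ fourier_measurable[OF borel_measurable_continuous_onI[OF cont]], of "\<lambda>x. (2 * pi) *\<^sub>R x" borel]
    by simp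
  show "(\<Sum>k\<in>F. norm (fourier f ((2 * pi) *\<^sub>R (a + lattice k)))) \<le> W" if "finite F" for a F
    using sum_fourier_le[OF that, of a] by (simp add: add.commute)
qed

text \<open>The Poisson summation formula for \<open>ech (- a) \<cdot> f\<close> is integrated over the parameter \<open>a\<close> in the
  unit cube. The left-hand side unfolds to an integral over the whole space, and on the right-hand
  side the integral removes all terms but one.\<close>

lemma inversion_scaled: "(\<integral>x. fourier f ((2 * pi) *\<^sub>R x) * ech x \<xi> \<partial>lborel) = f \<xi>"
proof -
  let ?H = "\<lambda>x. fourier f ((2 * pi) *\<^sub>R x)"
  have Hint: "integrable lborel (\<lambda>x. ?H x * ech x \<xi>)"
    using integrable_ech_mult[OF integrable_fourier_scaled, of \<xi>]
    by (simp add: ech_commute[of \<xi>] mult.commute)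
  have "periodization (\<lambda>x. ?H x * ech x \<xi>) a = (\<Sum>\<^sub>\<infinity>k. f (\<xi> + lattice k) * ech (lattice (- k)) a)" for a
  proof -
    let ?P = "periodization (\<lambda>y. ech (- a) y * f y)"
    interpret e: decaying "\<lambda>y. ech (- a) y * f y" C
      by (rule decaying_ech_mult) (rule decaying_axioms)
    have coef: "fcoef ?P m = ?H (lattice m + a)" for m
      by (rule fcoef_periodization[OF integrable])
    have "(\<lambda>m. norm (fcoef ?P m)) summable_on UNIV"
      unfolding coef by (rule summable_bounded_partial_sums(1)[OF sum_fourier_le])
    from fourier_series[OF e.continuous_periodization periodic_periodization this, of \<xi>]
    have P: "?P \<xi> = (\<Sum>\<^sub>\<infinity>m. ?H (lattice m + a) * ech (lattice m) \<xi>)"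
      by (simp only: coef)
    have "periodization (\<lambda>x. ?H x * ech x \<xi>) a =
        (\<Sum>\<^sub>\<infinity>m. ech a \<xi> * (?H (lattice m + a) * ech (lattice m) \<xi>))"
      unfolding periodization_def ech_add_left by (simp only: mult_ac add.commute)
    also have "\<dots> = ech a \<xi> * ?P \<xi>"
      unfolding P by (rule infsum_cmult_right')
    also have "\<dots> = (\<Sum>\<^sub>\<infinity>k. ech a \<xi> * (ech (- a) (\<xi> + lattice k) * f (\<xi> + lattice k)))"
      unfolding periodization_def by (rule infsum_cmult_right'[symmetric])
    also have "\<dots> = (\<Sum>\<^sub>\<infinity>k. f (\<xi> + lattice k) * ech (lattice (- k)) a)"
    proof (rule infsum_cong)
      fix k
      have "ech a \<xi> * (ech (- a) (\<xi> + lattice k) * f (\<xi> + lattice k)) =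
          (ech a \<xi> * ech (- a) \<xi>) * (ech (- a) (lattice k) * f (\<xi> + lattice k))"
        by (simp only: ech_add_right mult_ac)
      also have "ech (- a) (lattice k) = ech (lattice (- k)) a"
        by (simp add: ech_def inner_commute)
      finally show "ech a \<xi> * (ech (- a) (\<xi> + lattice k) * f (\<xi> + lattice k)) =
          f (\<xi> + lattice k) * ech (lattice (- k)) a"
        by (simp add: mult.commute)
    qed
    finally show ?thesis .
  qed
  \<comment> \<open>The factor 1 is the test function in
    \<open>torus_integral_infsum\<close>.\<close>
  then have per: "periodization (\<lambda>x. ?H x * ech x \<xi>) = (\<lambda>a. (\<Sum>\<^sub>\<infinity>k. f (\<xi> + lattice k) * ech (lattice (- k)) a) * 1)"
    by (simp add: fun_eq_iff)
  have "(\<integral>x. ?H x * ech x \<xi> \<partial>lborel) = torus_integral (periodization (\<lambda>x. ?H x * ech x \<xi>))"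
    by (rule torus_integral_periodization(2)[OF Hint, symmetric])
  also have "\<dots> = (\<Sum>\<^sub>\<infinity>k. f (\<xi> + lattice k) * torus_integral (\<lambda>a. ech (lattice (- k)) a * 1))"
    unfolding per
    by (rule torus_integral_infsum[OF infinite_vec summable])
       (auto intro!: torus_integrable_continuous continuous_intros)
  also have "\<dots> = (\<Sum>\<^sub>\<infinity>k\<in>{0}. f (\<xi> + lattice k))"
    by (rule infsum_cong_neutral) (auto simp: torus_integral_ech simp del: lattice_simps(3))
  also have "\<dots> = f \<xi>" by simp
  finally show ?thesis .
qed

end

lemma lborel_scale:
  fixes g :: "real^'n::finite \<Rightarrow> complex"
  assumes c: "c > 0" and int: "integrable lborel (\<lambda>x. g (c *\<^sub>R x))" and [measurable]: "g \<in> borel_measurable borel"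
  shows "integrable lborel g"
    and "(\<integral>x. g x \<partial>lborel) = of_real (c ^ CARD('n)) * (\<integral>x. g (c *\<^sub>R x) \<partial>lborel)"
proof -
  have l: "lborel = density (distr lborel borel (\<lambda>x::real^'n. c *\<^sub>R x)) (\<lambda>_. ennreal (c ^ CARD('n)))"
    using lborel_affine[of c "0::real^'n"] c by simp
  have m: "(\<lambda>x::real^'n. c *\<^sub>R x) \<in> measurable lborel borel" by simp
  have "integrable (density (distr lborel borel (\<lambda>x::real^'n. c *\<^sub>R x)) (\<lambda>_. ennreal (c ^ CARD('n)))) g"
    using c int by (subst integrable_density) (auto simp: integrable_distr_eq)
  then show "integrable lborel g" using l by simp
  have "(\<integral>x. g x \<partial>density (distr lborel borel (\<lambda>x::real^'n. c *\<^sub>R x)) (\<lambda>_. ennreal (c ^ CARD('n))))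
      = of_real (c ^ CARD('n)) * (\<integral>x. g (c *\<^sub>R x) \<partial>lborel)"
    using c by (subst integral_density) (auto simp: integral_distr scaleR_conv_of_real)
  then show "(\<integral>x. g x \<partial>lborel) = of_real (c ^ CARD('n)) * (\<integral>x. g (c *\<^sub>R x) \<partial>lborel)"
    using l by simp
qed

context smooth_decaying
begin

lemma integrable_fourier: "integrable lborel (fourier f)"
  by (rule lborel_scale(1)[of "2 * pi", OF _ integrable_fourier_scaled
      fourier_measurable[OF borel_measurable_continuous_onI[OF cont]]]) simp

lemma inversion: "(\<integral>x. exp (\<i> * of_real (x \<bullet> \<xi>)) * fourier f x \<partial>lborel) = of_real ((2 * pi) ^ CARD('n)) * f \<xi>"
proof -
  let ?g = "\<lambda>x. exp (\<i> * of_real (x \<bullet> \<xi>)) * fourier f x"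
  have [measurable]: "fourier f \<in> borel_measurable borel"
    by (rule fourier_measurable[OF borel_measurable_continuous_onI[OF cont]])
  have "(\<lambda>x. exp (\<i> * of_real (x \<bullet> \<xi>))) \<in> borel_measurable borel"
    by (intro borel_measurable_continuous_onI continuous_intros)
  then have m: "?g \<in> borel_measurable borel" by measurable
  have s: "?g ((2 * pi) *\<^sub>R x) = ech \<xi> x * fourier f ((2 * pi) *\<^sub>R x)" for x
    by (simp add: ech_def cis_conv_exp inner_commute mult_ac)
  have "(\<integral>x. ?g x \<partial>lborel) = of_real ((2 * pi) ^ CARD('n)) * (\<integral>x. ?g ((2 * pi) *\<^sub>R x) \<partial>lborel)"
    by (rule lborel_scale(2)[OF _ _ m]) (simp_all only: s integrable_ech_mult[OF integrable_fourier_scaled], simp)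
  also have "(\<integral>x. ?g ((2 * pi) *\<^sub>R x) \<partial>lborel) = f \<xi>"
    unfolding s using inversion_scaled[of \<xi>] by (simp add: ech_commute[of \<xi>] mult.commute)
  finally show ?thesis .
qed

end

section \<open>Hyperbolic unimodular integer matrices\<close>

abbreviation of_int_matrix :: "int^'n^'n \<Rightarrow> 'a::ring_1^'n^'n" where
  "of_int_matrix \<equiv> map_matrix of_int"

definition of_int_vec :: "int^'n \<Rightarrow> 'a::ring_1^'n" where
  "of_int_vec k = (\<chi> i. of_int (k $ i))"

lemma of_int_matrix_mult: "(of_int_matrix (A ** B) :: 'a::comm_ring_1^'n^'n::finite) = of_int_matrix A ** of_int_matrix B"
  by (simp add: vec_eq_iff map_matrix_def matrix_matrix_mult_def)

lemma of_int_matrix_one: "(of_int_matrix (mat 1) :: 'a::comm_ring_1^'n^'n::finite) = mat 1"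
  by (simp add: vec_eq_iff map_matrix_def mat_def)

lemma of_int_matrix_vector: "of_int_matrix A *v (of_int_vec k :: 'a::comm_ring_1^'n::finite) = of_int_vec (A *v k)"
  by (simp add: vec_eq_iff map_matrix_def matrix_vector_mult_def of_int_vec_def)

lemma of_int_matrix_inj:
  assumes "(of_int_matrix A :: real^'n^'n) = of_int_matrix B"
  shows "A = B"
  using assms by (simp add: vec_eq_iff map_matrix_def)

lemma det_of_int_matrix: "det (of_int_matrix A :: 'a::comm_ring_1^'n^'n::finite) = of_int (det A)"
  by (simp add: det_def map_matrix_def)

text \<open>By Cramer's rule the entries of the inverse are integer determinants divided by the
  determinant, which is 1 or -1.\<close>

lemma unimodular_inverse:
  fixes M :: "int^'n^'n::finite"
  assumes "unimodular M"
  obtains M' where "M ** M' = mat 1" "M' ** M = mat 1"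
proof -
  let ?A = "of_int_matrix M :: real^'n^'n"
  have d: "det ?A = 1 \<or> det ?A = -1"
    using assms unfolding unimodular_def det_of_int_matrix by auto
  have "\<exists>x :: int^'n. ?A *v of_int_vec x = axis j 1" for j
  proof -
    have "det ?A \<noteq> 0" using d by auto
    then obtain x where x: "?A *v x = axis j 1"
      using cramer[of ?A _ "axis j 1"] by blast
    have "\<exists>z::int. x $ k = of_int z" for k
    proof -
      let ?B = "(\<chi> i l. if l = k then (if i = j then 1 else 0) else M $ i $ l) :: int^'n^'n"
      have "(\<chi> i l. if l = k then (?A *v x) $ i else ?A $ i $ l) = (of_int_matrix ?B :: real^'n^'n)"
        unfolding x by (auto simp: vec_eq_iff map_matrix_def axis_def)
      then have "x $ k * det ?A = of_int (det ?B)"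
        using cramer_lemma[of k ?A x] det_of_int_matrix[of ?B, where 'a=real] by (simp only:)
      with d have "x $ k = of_int (det ?B) \<or> x $ k = of_int (- det ?B)" by (elim disjE) auto
      then show ?thesis by blast
    qed
    then obtain z where "\<And>k. x $ k = of_int (z k)" by metis
    then have "x = of_int_vec (\<chi> k. z k)" by (simp add: vec_eq_iff of_int_vec_def)
    with x show ?thesis by blast
  qed
  then obtain X where X: "\<And>j. ?A *v of_int_vec (X j) = axis j 1" by metis
  define M' where "M' = (\<chi> i j. X j $ i)"
  have "?A ** of_int_matrix M' = mat 1"
  proof -
    have "(?A ** of_int_matrix M') $ i $ j = (?A *v of_int_vec (X j)) $ i" for i j
      by (simp add: matrix_matrix_mult_def matrix_vector_mult_def M'_def map_matrix_def of_int_vec_def)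
    then show ?thesis unfolding X by (simp add: vec_eq_iff mat_def axis_def)
  qed
  moreover from this have "of_int_matrix M' ** ?A = mat 1"
    by (simp only: matrix_left_right_inverse)
  ultimately show thesis
    by (intro that[of M'] of_int_matrix_inj)
       (simp_all only: of_int_matrix_mult of_int_matrix_one)
qed

text \<open>A - \<mu> is invertible exactly if its transpose is.\<close>

lemma eigenvalue_transpose:
  fixes A :: "complex^'n::finite^'n"
  assumes "v \<noteq> 0" "transpose A *v v = \<mu> *s v"
  shows "\<exists>w. w \<noteq> 0 \<and> A *v w = \<mu> *s w"
proof (rule ccontr)
  assume none: "\<not> ?thesis"
  have mat: "mat \<mu> *v x = \<mu> *s x" for x :: "complex^'n"
    by (simp add: vec_eq_iff mat_def matrix_vector_mult_def if_distrib[of "\<lambda>a. a * _"] cong: if_cong)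
  have "x = 0" if "(A - mat \<mu>) *v x = 0" for x
    using that none by (auto simp: matrix_vector_mult_diff_rdistrib mat)
  then obtain B where "B ** (A - mat \<mu>) = mat 1"
    using matrix_left_invertible_ker[of "A - mat \<mu>"] by blast
  then have "(A - mat \<mu>) ** B = mat 1"
    by (simp only: matrix_left_right_inverse)
  then have "transpose B ** transpose (A - mat \<mu>) = mat 1"
    by (metis matrix_transpose_mul transpose_mat)
  then have "x = 0" if "transpose (A - mat \<mu>) *v x = 0" for x
    using that matrix_left_invertible_ker[of "transpose (A - mat \<mu>)"] by blast
  moreover have "transpose (A - mat \<mu>) = transpose A - mat \<mu>"
    by (auto simp: vec_eq_iff transpose_def mat_def)
  ultimately show False
    using assms by (simp add: matrix_vector_mult_diff_rdistrib mat)
qed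

lemma norm_of_int_vec: "norm (of_int_vec k :: complex^'n::finite) = norm (lattice k)"
  by (simp add: norm_vec_def of_int_vec_def)

lemma funpow_of_int_vec:
  "((*v) (of_int_matrix A) ^^ j) (of_int_vec k :: 'a::comm_ring_1^'n::finite) = of_int_vec (((*v) A ^^ j) k)"
  by (induction j) (simp_all add: of_int_matrix_vector)

text \<open>Frequencies are moved by the transpose. The two sums run over the times j \<ge> 0 and j
  < 0 of one two-sided orbit, hence the common constant and the successor in the second sum.\<close>

lemma hyperbolic_sum_bump_lattice:
  fixes M M' :: "int^'n^'n::finite"
  assumes hyp: "hyperbolic M" and inv: "M ** M' = mat 1" "M' ** M = mat 1"
  shows "\<exists>C. \<forall>k s F. k \<noteq> 0 \<longrightarrow> s > 0 \<longrightarrow> finite F \<longrightarrow>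
    (\<Sum>j\<in>F. bump (norm (lattice (((*v) (transpose M) ^^ j) k))) s) \<le> C \<and>
    (\<Sum>j\<in>F. bump (norm (lattice (((*v) (transpose M') ^^ Suc j) k))) s) \<le> C"
proof -
  let ?A = "of_int_matrix (transpose M) :: complex^'n^'n" and ?A' = "of_int_matrix (transpose M') :: complex^'n^'n"
  have inv': "?A ** ?A' = mat 1" "?A' ** ?A = mat 1"
    by (simp_all only: of_int_matrix_mult[symmetric] matrix_transpose_mul[symmetric] inv transpose_mat of_int_matrix_one)
  have tr: "?A = transpose (of_int_matrix M)"
    by (simp add: vec_eq_iff transpose_def map_matrix_def)
  have "cmod \<mu> \<noteq> 1" if "v \<noteq> 0" "?A *v v = \<mu> *s v" for \<mu> v
    using eigenvalue_transpose[OF that(1) that(2)[unfolded tr]] hyp unfolding hyperbolic_def by blast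
  then obtain C where C: "\<And>v s F. v \<noteq> 0 \<Longrightarrow> s > 0 \<Longrightarrow> finite F \<Longrightarrow>
      (\<Sum>j\<in>F. bump (norm (orbit ?A ?A' v j)) s) \<le> C"
    using hyperbolic_sum_bump[OF inv'] by blast
  have "(\<Sum>j\<in>F. bump (norm (lattice (((*v) (transpose M) ^^ j) k))) s) \<le> C \<and>
    (\<Sum>j\<in>F. bump (norm (lattice (((*v) (transpose M') ^^ Suc j) k))) s) \<le> C"
    if "k \<noteq> 0" "s > 0" "finite F" for k s and F :: "nat set"
  proof
    let ?v = "of_int_vec k :: complex^'n"
    have v: "?v \<noteq> 0" using \<open>k \<noteq> 0\<close> by (auto simp: of_int_vec_def vec_eq_iff)
    have "norm (lattice (((*v) (transpose M) ^^ j) k)) = norm (orbit ?A ?A' ?v (int j))" for j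
      by (simp only: norm_of_int_vec[symmetric] funpow_of_int_vec[symmetric]) (simp add: orbit_def)
    then have "(\<Sum>j\<in>F. bump (norm (lattice (((*v) (transpose M) ^^ j) k))) s) =
        (\<Sum>j\<in>int ` F. bump (norm (orbit ?A ?A' ?v j)) s)"
      by (subst sum.reindex) auto
    also have "\<dots> \<le> C" using C[OF v] that by simp
    finally show "(\<Sum>j\<in>F. bump (norm (lattice (((*v) (transpose M) ^^ j) k))) s) \<le> C" .
    have "norm (lattice (((*v) (transpose M') ^^ Suc j) k)) = norm (orbit ?A ?A' ?v (- int (Suc j)))" for j
    proof -
      have "orbit ?A ?A' ?v (- int (Suc j)) = ((*v) ?A' ^^ Suc j) ?v"
        unfolding orbit_def by (simp only: minus_minus nat_int) simp
      then show ?thesis by (simp only: norm_of_int_vec[symmetric] funpow_of_int_vec[symmetric])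
    qed
    then have "(\<Sum>j\<in>F. bump (norm (lattice (((*v) (transpose M') ^^ Suc j) k))) s) =
        (\<Sum>j\<in>(\<lambda>j. - int (Suc j)) ` F. bump (norm (orbit ?A ?A' ?v j)) s)"
      by (subst sum.reindex) (auto simp: inj_on_def simp del: funpow.simps of_nat_Suc)
    also have "\<dots> \<le> C" using C[OF v] that by simp
    finally show "(\<Sum>j\<in>F. bump (norm (lattice (((*v) (transpose M') ^^ Suc j) k))) s) \<le> C" .
  qed
  then show ?thesis by blast
qed

text \<open>By duality the map acts on characters through the transpose, which keeps integer
  frequencies integer.\<close>

lemma ech_toral_map:
  fixes M :: "int^'n::finite^'n"
  shows "ech (lattice k) (toral_map M x) = ech (lattice (transpose M *v k)) x"
proof -
  have "(A *v x) \<bullet> y = x \<bullet> (transpose A *v y)" for A :: "real^'n::finite^'n" and x y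
    by (simp add: dot_lmul_matrix[symmetric] inner_commute)
  moreover have "transpose (of_int_matrix M) *v lattice k = (lattice (transpose M *v k) :: real^'n)"
    using of_int_matrix_vector[of "transpose M" k, where 'a=real]
    by (simp add: vec_eq_iff transpose_def map_matrix_def of_int_vec_def matrix_vector_mult_def)
  ultimately show ?thesis
    by (simp add: ech_def toral_map_def inner_commute)
qed

lemma ech_toral_map_iter:
  "ech (lattice k) ((toral_map M ^^ j) x) = ech (lattice (((*v) (transpose M) ^^ j) k)) x"
proof (induction j arbitrary: k)
  case (Suc j)
  have "ech (lattice k) ((toral_map M ^^ Suc j) x) = ech (lattice (transpose M *v k)) ((toral_map M ^^ j) x)"
    by (simp only: funpow.simps o_apply ech_toral_map)
  also have "\<dots> = ech (lattice (((*v) (transpose M) ^^ j) (transpose M *v k))) x"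
    by (rule Suc.IH)
  finally show ?case by (simp only: funpow.simps o_apply funpow_swap1)
qed simp

lemma inv_toral_map:
  assumes "M ** M' = mat 1" "M' ** M = mat 1"
  shows "inv (toral_map M) = toral_map M'" "toral_map M (toral_map M' x) = x" "toral_map M' (toral_map M x) = x"
proof -
  show 1: "toral_map M (toral_map M' x) = x" for x
    unfolding toral_map_def matrix_vector_mul_assoc of_int_matrix_mult[symmetric] assms of_int_matrix_one by simp
  show 2: "toral_map M' (toral_map M x) = x" for x
    unfolding toral_map_def matrix_vector_mul_assoc of_int_matrix_mult[symmetric] assms of_int_matrix_one by simp
  show "inv (toral_map M) = toral_map M'"
    by (rule inv_unique_comp) (auto simp: fun_eq_iff 1 2)
qed

lemma continuous_toral_map: "continuous_on S (toral_map M)"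
  unfolding toral_map_def by (rule matrix_vector_mult_linear_continuous_on)

lemma continuous_toral_map_iter: "continuous_on S (toral_map M ^^ j)"
proof (induction j)
  case (Suc j)
  then show ?case
    unfolding funpow.simps by (intro continuous_on_compose continuous_toral_map)
qed (simp add: continuous_on_id id_def)

section \<open>Sums of correlations\<close>

text \<open>This is \<open>fcoef\<close> at -m: pairing \<phi> with the Fourier series of R produces
  characters without conjugation.\<close>

definition dual_coef :: "(real^'n::finite \<Rightarrow> complex) \<Rightarrow> int^'n \<Rightarrow> complex" where
  "dual_coef \<phi> m = torus_integral (\<lambda>x. ech (lattice m) x * \<phi> x)"

lemma bump_nonneg: "t \<ge> 0 \<Longrightarrow> s > 0 \<Longrightarrow> bump t s \<ge> 0"
  by (simp add: bump_def)

lemma norm_lattice_ge_1: "m \<noteq> 0 \<Longrightarrow> norm (lattice m) \<ge> 1"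
proof -
  assume "m \<noteq> 0"
  then obtain i where "m $ i \<noteq> 0" by (auto simp: vec_eq_iff)
  then have "1 \<le> \<bar>lattice m $ i\<bar>" by (simp add: lattice_def)
  then show ?thesis using component_le_norm_cart[of "lattice m" i] by linarith
qed

text \<open>The difference with half a period t = 1/(2 |m_i|) in the largest coordinate multiplies
  the coefficient by -2, while the Lipschitz bound gives L t; so the coefficient is O(1/|m|). This
  is phrased by \<open>bump\<close> at scale 1 in order to be summed along orbits.\<close>

lemma norm_fcoef_le:
  fixes \<phi> :: "real^'n::finite \<Rightarrow> complex"
  assumes cont: "continuous_on UNIV \<phi>" and per: "Z_periodic \<phi>" and L: "L \<ge> 0"
    and lip: "\<And>i t x. 0 < t \<Longrightarrow> t \<le> 1 \<Longrightarrow> norm (shift_diff i t \<phi> x) \<le> L * t"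
    and m: "m \<noteq> 0"
  shows "norm (fcoef \<phi> m) \<le> L * real CARD('n) * bump (norm (lattice m)) 1"
proof -
  let ?n = "real CARD('n)"
  have "Max (range (\<lambda>j. \<bar>m $ j\<bar>)) \<in> range (\<lambda>j. \<bar>m $ j\<bar>)" by (rule Max_in) auto
  then obtain i where "Max (range (\<lambda>j. \<bar>m $ j\<bar>)) = \<bar>m $ i\<bar>" by (elim rangeE)
  then have max: "\<bar>m $ j\<bar> \<le> \<bar>m $ i\<bar>" for j
    using Max_ge[of "range (\<lambda>j. \<bar>m $ j\<bar>)" "\<bar>m $ j\<bar>"] by simp
  have mi: "\<bar>m $ i\<bar> \<ge> 1"
  proof (rule ccontr)
    assume "\<not> \<bar>m $ i\<bar> \<ge> 1"
    then have "m $ j = 0" for j using max[of j] by simp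
    with m show False by (simp add: vec_eq_iff)
  qed
  define a where "a = \<bar>real_of_int (m $ i)\<bar>"
  have a: "a \<ge> 1" unfolding a_def using mi by (simp only: of_int_abs[symmetric] of_int_1_le_iff)
  have "norm (lattice m) \<le> (\<Sum>j\<in>UNIV. \<bar>lattice m $ j\<bar>)" by (rule norm_le_l1_cart)
  also have "\<dots> \<le> (\<Sum>j\<in>(UNIV::'n set). a)"
    unfolding a_def using max by (intro sum_mono) (simp only: lattice_simps of_int_abs[symmetric] of_int_le_iff)
  finally have nl: "norm (lattice m) \<le> ?n * a" by simp
  define t where "t = 1 / (2 * a)"
  have t: "0 < t" "t \<le> 1" using a by (auto simp: t_def)
  have "cis (2 * pi * (t * of_int (m $ i))) = -1"
  proof (cases "m $ i \<ge> 0")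
    case True
    then have e: "2 * pi * (t * of_int (m $ i)) = pi" using a by (simp add: t_def a_def)
    show ?thesis unfolding e by simp
  next
    case False
    then have e: "2 * pi * (t * of_int (m $ i)) = - pi" using a by (simp add: t_def a_def)
    show ?thesis unfolding e by (simp add: complex_eq_iff)
  qed
  then have "2 * norm (fcoef \<phi> m) = norm (fcoef (shift_diff i t \<phi>) m)"
    unfolding fcoef_shift_diff[OF cont per] by (simp add: norm_mult)
  also have "\<dots> \<le> L * t"
    unfolding fcoef_def
  proof (rule norm_torus_integral_le)
    have "continuous_on UNIV (shift_diff i t \<phi>)" using C_k_shift_diff[of 0 \<phi>] cont by simp
    then show "set_integrable lborel (cbox 0 1) (\<lambda>x. ech (- lattice m) x * shift_diff i t \<phi> x)"
      by (intro torus_integrable_continuous continuous_intros)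
  qed (simp add: norm_mult lip t)
  finally have f: "norm (fcoef \<phi> m) \<le> L * (1 / (4 * a))" by (simp add: t_def)
  define r where "r = norm (lattice m)"
  have r: "r \<ge> 1" unfolding r_def by (rule norm_lattice_ge_1[OF m])
  have "1 / (4 * a) \<le> ?n * (1 / (4 * r))"
    using nl a r by (simp add: r_def[symmetric] field_simps)
  also have "\<dots> \<le> ?n * bump r 1"
  proof (rule mult_left_mono)
    have "(r + 1)\<^sup>2 \<le> (2 * r)\<^sup>2" using r by (intro power_mono) auto
    then have "(r + 1)\<^sup>2 \<le> r * (4 * r)" by (simp add: power2_eq_square)
    moreover have "1 / (4 * r) \<le> r / q" if "q \<le> r * (4 * r)" "q > 0" for q
      using that r by (simp add: field_simps)
    moreover have "(r + 1)\<^sup>2 > 0" using r by simp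
    ultimately show "1 / (4 * r) \<le> bump r 1" unfolding bump_def by simp
  qed simp
  finally have "L * (1 / (4 * a)) \<le> L * (?n * bump r 1)" using L by (rule mult_left_mono)
  with f show ?thesis by (simp add: r_def mult.assoc)
qed

text \<open>Treats both Birkhoff sums at once: \<open>g j\<close> will be the j-th iterate of f, or
  the (j + 1)-st of its inverse, and \<open>A j\<close> its action on frequencies. In both cases the
  zero frequency is fixed, and \<open>R0\<close> removes its contribution.\<close>

locale correlation_sum =
  fixes R :: "real^'n::finite \<Rightarrow> complex" and A :: "nat \<Rightarrow> int^'n \<Rightarrow> int^'n"
    and g :: "nat \<Rightarrow> real^'n \<Rightarrow> real^'n" and C :: real
  assumes contR: "continuous_on UNIV R" and perR: "Z_periodic R"
    and summable_R: "(\<lambda>k. norm (fcoef R k)) summable_on UNIV" and R0: "fcoef R 0 = 0"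
    and contg: "\<And>j. continuous_on UNIV (g j)"
    and dual: "\<And>j k x. ech (lattice k) (g j x) = ech (lattice (A j k)) x"
    and nonzero: "\<And>j k. k \<noteq> 0 \<Longrightarrow> A j k \<noteq> 0"
    and sum_bump: "\<And>k s F. k \<noteq> 0 \<Longrightarrow> s > 0 \<Longrightarrow> finite F \<Longrightarrow>
      (\<Sum>j\<in>F. bump (norm (lattice (A j k))) s) \<le> C"
begin

definition T :: "(real^'n \<Rightarrow> complex) \<Rightarrow> nat \<Rightarrow> complex" where
  "T \<phi> j = torus_integral (\<lambda>x. \<phi> x * R (g j x))"

definition S :: real where "S = (\<Sum>\<^sub>\<infinity>k. norm (fcoef R k))"

lemma C_nonneg: "C \<ge> 0"
  using sum_bump[of "axis undefined 1" 1 "{}"] by (simp add: axis_eq_0_iff)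

lemma T_eq:
  assumes "set_integrable lborel (cbox 0 1) \<phi>"
  shows "T \<phi> j = (\<Sum>\<^sub>\<infinity>k. fcoef R k * dual_coef \<phi> (A j k))"
proof -
  have "T \<phi> j = torus_integral (\<lambda>x. (\<Sum>\<^sub>\<infinity>k. fcoef R k * ech (lattice (A j k)) x) * \<phi> x)"
    unfolding T_def fourier_series[OF contR perR summable_R, of "g j _"] dual by (simp add: mult.commute)
  also have "\<dots> = (\<Sum>\<^sub>\<infinity>k. fcoef R k * dual_coef \<phi> (A j k))"
    unfolding dual_coef_def by (rule torus_integral_infsum[OF infinite_vec summable_R _ _ assms]) auto
  finally show ?thesis .
qed

text \<open>After \<open>P\<close> is enlarged to a product set, the sum over time comes first: it
  is at most D for every nonzero frequency, and the coefficient of R at 0 vanishes. The family d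
  will be the coefficients of a test function or the values of a multiplier.\<close>

lemma pair_partial_sums:
  assumes D: "\<And>k F. k \<noteq> 0 \<Longrightarrow> finite F \<Longrightarrow> (\<Sum>j\<in>F. norm (d j k)) \<le> D" and "D \<ge> 0" and P: "finite P"
  shows "(\<Sum>p\<in>P. norm (fcoef R (snd p) * d (fst p) (snd p))) \<le> D * S"
proof -
  have "(\<Sum>p\<in>P. norm (fcoef R (snd p) * d (fst p) (snd p))) \<le>
      (\<Sum>p\<in>fst ` P \<times> snd ` P. norm (fcoef R (snd p) * d (fst p) (snd p)))"
    using P by (intro sum_mono2) (auto intro: rev_image_eqI)
  also have "\<dots> = (\<Sum>j\<in>fst ` P. \<Sum>k\<in>snd ` P. norm (fcoef R k * d j k))"
    by (simp add: sum.cartesian_product case_prod_beta)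
  also have "\<dots> = (\<Sum>k\<in>snd ` P. norm (fcoef R k) * (\<Sum>j\<in>fst ` P. norm (d j k)))"
    by (subst sum.swap) (simp add: norm_mult sum_distrib_left)
  also have "\<dots> \<le> (\<Sum>k\<in>snd ` P. norm (fcoef R k) * D)"
  proof (rule sum_mono)
    fix k
    show "norm (fcoef R k) * (\<Sum>j\<in>fst ` P. norm (d j k)) \<le> norm (fcoef R k) * D"
      using D[of k "fst ` P"] P R0 by (cases "k = 0") (auto intro: mult_left_mono)
  qed
  also have "\<dots> = (\<Sum>k\<in>snd ` P. norm (fcoef R k)) * D"
    by (simp add: sum_distrib_right)
  also have "\<dots> \<le> S * D"
    unfolding S_def using P by (intro mult_right_mono finite_sum_le_infsum summable_R \<open>D \<ge> 0\<close>) auto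
  finally show ?thesis by (simp add: mult.commute)
qed

text \<open>Absolute summability over the pairs (j, k) permits summing over k first, which gives
  \<open>T\<close>. The function \<phi> is merely integrable, because periodized convolutions will
  enter here as test functions.\<close>

lemma T_sums:
  assumes \<phi>: "set_integrable lborel (cbox 0 1) \<phi>"
    and D: "\<And>k F. k \<noteq> 0 \<Longrightarrow> finite F \<Longrightarrow> (\<Sum>j\<in>F. norm (dual_coef \<phi> (A j k))) \<le> D" and "D \<ge> 0"
  shows "summable (T \<phi>)"
    and "(\<Sum>j. T \<phi> j) = (\<Sum>\<^sub>\<infinity>p. fcoef R (snd p) * dual_coef \<phi> (A (fst p) (snd p)))"
    and "norm (\<Sum>j. T \<phi> j) \<le> D * S"
proof -
  let ?f = "\<lambda>p. fcoef R (snd p) * dual_coef \<phi> (A (fst p) (snd p))"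
  note ps = pair_partial_sums[of "\<lambda>j k. dual_coef \<phi> (A j k)", OF D \<open>D \<ge> 0\<close>]
  note sm = summable_bounded_partial_sums[of ?f, OF ps]
  have s: "?f summable_on (UNIV \<times> UNIV)"
    using abs_summable_summable[OF sm(1)] by simp
  have Tj: "T \<phi> j = (\<Sum>\<^sub>\<infinity>k. ?f (j, k))" for j
    by (simp add: T_eq[OF \<phi>])
  have "T \<phi> summable_on UNIV"
    unfolding Tj[abs_def] using summable_on_Sigma_banach[of "\<lambda>j k. ?f (j, k)" UNIV "\<lambda>_. UNIV"] s
    by (simp add: case_prod_unfold)
  then have "T \<phi> sums (\<Sum>\<^sub>\<infinity>j. T \<phi> j)"
    by (intro has_sum_imp_sums has_sum_infsum)
  moreover have "(\<Sum>\<^sub>\<infinity>j. T \<phi> j) = infsum ?f (UNIV \<times> UNIV)"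
    unfolding Tj by (rule infsum_Sigma_banach[OF s])
  ultimately have "T \<phi> sums infsum ?f UNIV" by simp
  then show "summable (T \<phi>)" "(\<Sum>j. T \<phi> j) = infsum ?f UNIV" "norm (\<Sum>j. T \<phi> j) \<le> D * S"
    using sm(3) by (auto simp: sums_iff)
qed

text \<open>Lipschitz functions have coefficients O(1/|m|), which are summable along orbits. Smooth
  functions on the torus and periodizations of Schwartz functions are both covered, and L becomes a
  seminorm in the continuity estimates.\<close>

lemma T_sums_lipschitz:
  assumes cont: "continuous_on UNIV \<phi>" and per: "Z_periodic \<phi>" and L: "L \<ge> 0"
    and lip: "\<And>i t x. 0 < t \<Longrightarrow> t \<le> 1 \<Longrightarrow> norm (shift_diff i t \<phi> x) \<le> L * t"
  shows "summable (T \<phi>)" and "norm (\<Sum>j. T \<phi> j) \<le> L * (real CARD('n) * C * S)"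
proof -
  have "(\<Sum>j\<in>F. norm (dual_coef \<phi> (A j k))) \<le> L * real CARD('n) * C" if k: "k \<noteq> 0" and F: "finite F" for k F
  proof -
    have "norm (dual_coef \<phi> (A j k)) \<le> L * real CARD('n) * bump (norm (lattice (A j k))) 1" for j
      using norm_fcoef_le[OF cont per L lip, of "- A j k"] nonzero[OF k, of j]
      by (simp add: dual_coef_def fcoef_def)
    then have "(\<Sum>j\<in>F. norm (dual_coef \<phi> (A j k))) \<le> (\<Sum>j\<in>F. L * real CARD('n) * bump (norm (lattice (A j k))) 1)"
      by (rule sum_mono)
    also have "\<dots> \<le> L * real CARD('n) * C"
      unfolding sum_distrib_left[symmetric] using L by (intro mult_left_mono sum_bump k F) auto
    finally show ?thesis .
  qed
  note * = T_sums[OF torus_integrable_continuous[OF cont] this]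
  show "summable (T \<phi>)" by (rule *) (use L C_nonneg in auto)
  have "norm (\<Sum>j. T \<phi> j) \<le> L * real CARD('n) * C * S" by (rule *(3)) (use L C_nonneg in auto)
  then show "norm (\<Sum>j. T \<phi> j) \<le> L * (real CARD('n) * C * S)" by (simp add: mult_ac)
qed

lemma continuous_R_g: "continuous_on UNIV (\<lambda>x. R (g j x))"
  by (rule continuous_on_compose2[OF contR contg]) auto

end

section \<open>Littlewood-Paley pieces\<close>

lemma partial_of_has_derivative:
  assumes "\<And>x. (f has_derivative f' x) (at x)"
  shows "partial i f = (\<lambda>x. f' x (axis i 1))"
  unfolding partial_def by (simp only: frechet_derivative_at[OF assms, symmetric])

lemma C_k_diff: "C_k k f \<Longrightarrow> C_k k g \<Longrightarrow> C_k k (\<lambda>x. f x - g x)"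
proof (induction k arbitrary: f g)
  case 0
  then show ?case by (auto intro: continuous_intros)
next
  case (Suc k)
  then have d: "\<And>x. f differentiable (at x)" "\<And>x. g differentiable (at x)"
    and C: "\<And>i. C_k k (partial i f)" "\<And>i. C_k k (partial i g)" by simp_all
  show ?case
    unfolding C_k.simps partial_diff[OF d]
    by (intro conjI allI differentiable_diff Suc.IH d C)
qed

lemma C_k_scaleR: "C_k k f \<Longrightarrow> C_k k (\<lambda>x. c *\<^sub>R f x)"
proof (induction k arbitrary: f)
  case 0
  then show ?case by (auto intro: continuous_intros)
next
  case (Suc k)
  then have d: "\<And>x. (f has_derivative frechet_derivative f (at x)) (at x)"
    and C: "\<And>i. C_k k (partial i f)" by (simp_all add: frechet_derivative_works)
  have e: "((\<lambda>x. c *\<^sub>R f x) has_derivative (\<lambda>h. c *\<^sub>R frechet_derivative f (at x) h)) (at x)" for x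
    by (intro has_derivative_scaleR_right d)
  have p: "partial i (\<lambda>x. c *\<^sub>R f x) = (\<lambda>x. c *\<^sub>R partial i f x)" for i
    by (subst partial_of_has_derivative[OF e]) (simp add: partial_def)
  show ?case
    unfolding C_k.simps p using e by (intro conjI allI Suc.IH C) (auto simp: differentiable_def)
qed

lemma C_k_dilate: "C_k k f \<Longrightarrow> C_k k (\<lambda>x. f (c *\<^sub>R x))"
proof (induction k arbitrary: f)
  case 0
  then show ?case by (auto intro!: continuous_on_compose2[of UNIV f UNIV] continuous_intros)
next
  case (Suc k)
  then have d: "\<And>x. (f has_derivative frechet_derivative f (at x)) (at x)"
    and C: "\<And>i. C_k k (partial i f)" by (simp_all add: frechet_derivative_works)
  have e: "((\<lambda>x. f (c *\<^sub>R x)) has_derivative (\<lambda>h. frechet_derivative f (at (c *\<^sub>R x)) (c *\<^sub>R h))) (at x)" for x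
    by (rule has_derivative_compose[OF _ d]) (auto intro!: derivative_eq_intros)
  have "partial i (\<lambda>x. f (c *\<^sub>R x)) = (\<lambda>x. c *\<^sub>R partial i f (c *\<^sub>R x))" for i
    by (subst partial_of_has_derivative[OF e])
       (simp add: partial_def linear_scale[OF has_derivative_linear[OF d]])
  then show ?case
    unfolding C_k.simps using e by (auto simp: differentiable_def intro!: C_k_scaleR Suc.IH C)
qed

lemma C_k_of_real: "C_k k f \<Longrightarrow> C_k k (\<lambda>x. complex_of_real (f x))"
proof (induction k arbitrary: f)
  case 0
  then show ?case by (auto intro: continuous_intros)
next
  case (Suc k)
  then have d: "\<And>x. (f has_derivative frechet_derivative f (at x)) (at x)"
    and C: "\<And>i. C_k k (partial i f)" by (simp_all add: frechet_derivative_works)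
  have e: "((\<lambda>x. complex_of_real (f x)) has_derivative (\<lambda>h. of_real (frechet_derivative f (at x) h))) (at x)" for x
    by (rule has_derivative_of_real[OF d])
  have p: "partial i (\<lambda>x. complex_of_real (f x)) = (\<lambda>x. of_real (partial i f x))" for i
    by (subst partial_of_has_derivative[OF e]) (simp add: partial_def)
  show ?case
    unfolding C_k.simps p using e by (intro conjI allI Suc.IH C) (auto simp: differentiable_def)
qed

lemma C_k_partials: "C_k (k + length ds) f \<Longrightarrow> C_k k (partials ds f)"
proof (induction ds arbitrary: k)
  case Nil
  then show ?case by (simp add: partials_def)
next
  case (Cons i ds)
  have "C_k (Suc k) (partials ds f)" by (rule Cons.IH) (use Cons.prems in simp)
  then show ?case by (simp add: partials_def)
qed

lemma partial_eq_zero: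
  fixes f :: "real^'n::finite \<Rightarrow> 'b::real_normed_vector"
  assumes "\<And>x. norm x > r \<Longrightarrow> f x = 0" "norm x > r"
  shows "partial i f x = 0"
proof -
  have "open {x :: real^'n. norm x > r}"
    by (intro open_Collect_less continuous_intros)
  then have "(f has_derivative (\<lambda>h. 0)) (at x)"
    using assms has_derivative_transform_within_open[of "\<lambda>x. 0" "\<lambda>h. 0" x UNIV "{x. norm x > r}" f]
    by auto
  from frechet_derivative_at[OF this] show ?thesis by (simp add: partial_def fun_eq_iff)
qed

lemma partials_eq_zero:
  fixes f :: "real^'n::finite \<Rightarrow> 'b::real_normed_vector"
  assumes "\<And>x. norm x > r \<Longrightarrow> f x = 0"
  shows "norm x > r \<Longrightarrow> partials ds f x = 0"
proof (induction ds arbitrary: x)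
  case (Cons i ds)
  then show ?case
    using partial_eq_zero[of r "partials ds f" x i] by (simp add: partials_def)
qed (simp add: assms partials_def)

lemma compact_support_le_weight:
  fixes f :: "real^'n::finite \<Rightarrow> 'b::real_normed_vector"
  assumes "continuous_on UNIV f" "\<And>x. norm x > r \<Longrightarrow> f x = 0"
  obtains C where "C \<ge> 0" "\<And>x. norm (f x) \<le> C * weight x"
proof -
  define R where "R = max r 0"
  have "compact (f ` cball 0 R)"
    by (intro compact_continuous_image continuous_on_subset[OF assms(1)]) auto
  then obtain B where B: "\<And>x. norm x \<le> R \<Longrightarrow> norm (f x) \<le> B"
    using compact_imp_bounded bounded_iff by (metis imageI mem_cball_0)
  have B0: "B \<ge> 0" using order_trans[OF norm_ge_zero B[of 0]] by (simp add: R_def)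
  let ?N = "2 * CARD('n)"
  have "norm (f x) \<le> B * (1 + R) ^ ?N * weight x" for x
  proof (cases "norm x \<le> R")
    case True
    have p: "(1 + norm x) ^ ?N > 0" by (intro zero_less_power add_pos_nonneg) auto
    have "(1 + norm x) ^ ?N \<le> (1 + R) ^ ?N" using True by (intro power_mono) auto
    then have "1 \<le> (1 + R) ^ ?N * (1 / (1 + norm x) ^ ?N)" using p by simp
    also have "\<dots> \<le> (1 + R) ^ ?N * weight x"
      by (intro mult_left_mono inverse_power_le_weight) (auto simp: R_def)
    finally have "1 \<le> (1 + R) ^ ?N * weight x" .
    from mult_left_mono[OF this B0] B[OF True] show ?thesis by (simp add: mult.assoc)
  next
    case False
    then have "f x = 0" by (intro assms(2)) (simp add: R_def)
    then show ?thesis using B0 weight_pos[of x] by (simp add: R_def)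
  qed
  then show thesis using B0 by (intro that[of "B * (1 + R) ^ ?N"]) (auto simp: R_def)
qed

text \<open>Makes the dyadic pieces eligible for Fourier inversion; compact support turns
  boundedness of the derivatives into decay.\<close>

lemma compact_support_smooth_decaying:
  fixes \<eta> :: "real^'n::finite \<Rightarrow> real"
  assumes "C_inf \<eta>" "\<And>x. norm x > r \<Longrightarrow> \<eta> x = 0"
  obtains C where "smooth_decaying (\<lambda>x. of_real (\<eta> x)) C"
proof -
  let ?n = "CARD('n)"
  define f where "f x = complex_of_real (\<eta> x)" for x
  have Ck: "C_k k f" for k
    unfolding f_def using assms(1) by (intro C_k_of_real) (simp add: C_inf_def)
  have z: "norm x > r \<Longrightarrow> f x = 0" for x using assms(2) by (simp add: f_def)
  have "\<exists>C\<ge>0. \<forall>x. norm (partials ds f x) \<le> C * weight x" for ds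
  proof (rule compact_support_le_weight[of "partials ds f" r])
    show "continuous_on UNIV (partials ds f)"
      by (rule C_k_continuous[OF C_k_partials[of 0, OF Ck]])
    show "partials ds f x = 0" if "norm x > r" for x
      using z that by (rule partials_eq_zero)
  qed blast
  then obtain C where C: "\<And>ds. C ds \<ge> 0" "\<And>ds x. norm (partials ds f x) \<le> C ds * weight x"
    by metis
  define D where "D = C [] + (\<Sum>i\<in>UNIV. C (replicate ?n i))"
  have "C (replicate ?n i) \<le> (\<Sum>i\<in>UNIV. C (replicate ?n i))" for i
    by (rule member_le_sum) (auto simp: C)
  then have le: "C [] \<le> D" "C (replicate ?n i) \<le> D" for i
    using C(1)[of "[]"] sum_nonneg[of UNIV "\<lambda>i. C (replicate ?n i)"] C(1)
    unfolding D_def by (auto intro: add_increasing)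
  have "norm (f x) \<le> D * weight x" "norm (partials (replicate ?n i) f x) \<le> D * weight x" for i x
    using C(2)[of "[]" x] C(2)[of "replicate ?n i" x]
      mult_right_mono[OF le(1), of "weight x"] mult_right_mono[OF le(2)[of i], of "weight x"] weight_pos[of x]
    by (auto simp: partials_def intro: order_trans)
  then have "smooth_decaying f D"
    using C(1)[of "[]"] le(1) Ck[of ?n] C_k_continuous[OF Ck[of 0]] by unfold_locales auto
  then show thesis using that[of D] by (simp add: f_def[abs_def])
qed

section \<open>Size and support of the dyadic pieces\<close>

lemma radial_cutoff_bounds:
  assumes "radial_cutoff \<psi>0"
  shows "0 \<le> \<psi>0 x" "\<psi>0 x \<le> 1"
proof -
  have mono: "0 \<le> s \<Longrightarrow> s \<le> t \<Longrightarrow> \<psi>0 (t *\<^sub>R x) \<le> \<psi>0 (s *\<^sub>R x)"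
    and one: "norm y < 1 \<Longrightarrow> \<psi>0 y = 1" and zero: "norm y > 2 \<Longrightarrow> \<psi>0 y = 0" for x y s t
    using assms unfolding radial_cutoff_def by blast+
  show "\<psi>0 x \<le> 1" using mono[of 0 1 x] one[of 0] by simp
  show "0 \<le> \<psi>0 x"
  proof (cases "x = 0")
    case True
    then show ?thesis using one[of 0] by simp
  next
    case False
    \<comment> \<open>Beyond radius 2 the cutoff vanishes, and t \<ge> 1 is what monotonicity along
      the ray asks for.\<close>
    define t where "t = max 1 (3 / norm x)"
    have "3 / norm x * norm x \<le> t * norm x" by (intro mult_right_mono) (auto simp: t_def)
    then have "norm (t *\<^sub>R x) > 2" using False by (simp add: t_def)
    then show ?thesis using mono[of 1 t x] zero by (simp add: t_def)
  qed
qed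

text \<open>For l > 0 the piece lives on 2^(l-1) \<le> |x| \<le> 2^(l+1): outside, the two dilated
  cutoffs are both 0 or both 1.\<close>

lemma dyadic_piece_props:
  fixes \<psi>0 :: "real^'n::finite \<Rightarrow> real"
  assumes \<psi>: "radial_cutoff \<psi>0"
  shows "C_inf (dyadic_piece \<psi>0 l)" "norm x > 2 ^ Suc l \<Longrightarrow> dyadic_piece \<psi>0 l x = 0"
    and "norm (dyadic_piece \<psi>0 l x) \<le> 1"
    and "l > 0 \<Longrightarrow> norm x < 2 ^ l / 2 \<Longrightarrow> dyadic_piece \<psi>0 l x = 0"
proof -
  have C: "C_inf \<psi>0" and one: "norm y < 1 \<Longrightarrow> \<psi>0 y = 1" and zero: "norm y > 2 \<Longrightarrow> \<psi>0 y = 0" for y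
    using \<psi> unfolding radial_cutoff_def by blast+
  have eq: "dyadic_piece \<psi>0 l = (\<lambda>x. \<psi>0 ((1 / 2 ^ l) *\<^sub>R x) - \<psi>0 ((2 / 2 ^ l) *\<^sub>R x))" if "l > 0"
    using that by (auto simp: dyadic_piece_def Let_def fun_eq_iff)
  have eq0: "dyadic_piece \<psi>0 0 = \<psi>0" by (auto simp: dyadic_piece_def fun_eq_iff)
  show "C_inf (dyadic_piece \<psi>0 l)"
    using C eq eq0 unfolding C_inf_def by (cases "l = 0") (auto intro!: C_k_diff C_k_dilate)
  show "dyadic_piece \<psi>0 l x = 0" if "norm x > 2 ^ Suc l"
  proof (cases "l = 0")
    case False
    have "norm x > 2 ^ l" using that by (rule le_less_trans[rotated]) simp
    then have "2 < norm x / 2 ^ l" "2 < 2 * norm x / 2 ^ l" using that by (auto simp: field_simps)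
    then show ?thesis using False zero by (simp add: eq)
  qed (use that zero eq0 in simp)
  show "norm (dyadic_piece \<psi>0 l x) \<le> 1"
    using radial_cutoff_bounds[OF \<psi>, of x] radial_cutoff_bounds[OF \<psi>, of "(1 / 2 ^ l) *\<^sub>R x"]
      radial_cutoff_bounds[OF \<psi>, of "(2 / 2 ^ l) *\<^sub>R x"]
    by (cases "l = 0") (auto simp: eq eq0 abs_le_iff)
  show "dyadic_piece \<psi>0 l x = 0" if "l > 0" "norm x < 2 ^ l / 2"
  proof -
    have "norm x < 2 ^ l" using that(2) by (rule less_le_trans) simp
    then have "norm x / 2 ^ l < 1" "2 * norm x / 2 ^ l < 1" using that(2) by (auto simp: field_simps)
    then show ?thesis using that(1) one by (simp add: eq)
  qed
qed

text \<open>On the support of the piece, |m| and s = 2^l/(2 pi) differ at most by a factor 2, so the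
  bump is at least 1/5, while the piece is at most 1.\<close>

lemma dyadic_piece_le_bump:
  fixes \<psi>0 :: "real^'n::finite \<Rightarrow> real"
  assumes \<psi>: "radial_cutoff \<psi>0" and m: "m \<noteq> 0"
  shows "norm (dyadic_piece \<psi>0 l ((2 * pi) *\<^sub>R lattice m)) \<le> 5 * bump (norm (lattice m)) (2 ^ l / (2 * pi))"
proof -
  let ?x = "(2 * pi) *\<^sub>R lattice m"
  define r where "r = norm (lattice m)"
  have r: "r \<ge> 1" unfolding r_def by (rule norm_lattice_ge_1[OF m])
  have nx: "norm ?x = 2 * pi * r" by (simp add: r_def)
  define s :: real where "s = 2 ^ l / (2 * pi)"
  have s: "s > 0" by (simp add: s_def)
  have b0: "bump r s \<ge> 0" using r s by (intro bump_nonneg) auto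
  have "norm (dyadic_piece \<psi>0 l ?x) \<le> 5 * bump r s"
  proof (cases "dyadic_piece \<psi>0 l ?x = 0")
    case False
    then have "norm ?x \<le> 2 ^ Suc l"
      using dyadic_piece_props(2)[OF \<psi>, of l ?x] by (meson not_le)
    then have le: "2 * pi * r \<le> 2 ^ Suc l" by (simp only: nx)
    then have up: "r \<le> 2 * s" by (simp add: s_def field_simps)
    \<comment> \<open>For l = 0 the cutoff vanishes at every nonzero frequency, since |2 pi m| >
      2.\<close>
    have l: "l > 0"
    proof (rule ccontr)
      assume "\<not> l > 0"
      then have "2 * pi * r \<le> 2" using le by simp
      moreover have "pi * 1 \<le> pi * r" using r by (intro mult_left_mono) auto
      moreover have "pi > 3" by (rule pi_gt3)
      ultimately show False by simp
    qed
    have "\<not> norm ?x < 2 ^ l / 2"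
      using dyadic_piece_props(4)[OF \<psi> l, of ?x] False by blast
    then have "2 ^ l / 2 \<le> 2 * pi * r" by (simp only: nx not_less)
    then have low: "s \<le> 2 * r" by (simp add: s_def field_simps)
    have "(r + s)\<^sup>2 \<le> 5 * (r * s)"
    proof -
      \<comment> \<open>As r/s lies between 1/2 and 2, this product is nonnegative; it bounds r^2 +
        s^2 by (5/2) r s.\<close>
      have "0 \<le> (2 * r - s) * (2 * s - r)" using up low by simp
      then have "2 * (r * r) + 2 * (s * s) \<le> 5 * (r * s)" by (simp add: algebra_simps)
      moreover have "0 \<le> (r - s) * (r - s)" by simp
      then have "2 * (r * s) \<le> r * r + s * s" by (simp add: algebra_simps)
      ultimately have "r * r + s * s + 2 * (r * s) \<le> 5 * (r * s)"
        by (simp add: algebra_simps)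
      then show ?thesis by (simp add: power2_eq_square algebra_simps)
    qed
    then have "1 \<le> 5 * bump r s"
      using r s by (simp add: bump_def add_pos_pos)
    then show ?thesis using dyadic_piece_props(3)[OF \<psi>, of l ?x] by linarith
  qed (use b0 in simp)
  then show ?thesis by (simp add: r_def s_def)
qed

section \<open>Fourier multipliers\<close>

lemma integrable_product:
  fixes f g :: "real^'n::finite \<Rightarrow> complex" and e :: "(real^'n) \<times> (real^'n) \<Rightarrow> complex"
  assumes f: "integrable lborel f" and g: "integrable lborel g"
    and e: "e \<in> borel_measurable borel" "\<And>p. norm (e p) = 1"
  shows "integrable (lborel \<Otimes>\<^sub>M lborel) (\<lambda>p. e p * (f (fst p) * g (snd p)))"
proof (rule lborel_pair.Fubini_integrable)
  have [measurable]: "f \<in> borel_measurable borel" "g \<in> borel_measurable borel" "e \<in> borel_measurable (borel \<Otimes>\<^sub>M borel)"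
    using f g e(1) by (simp_all add: borel_prod borel_measurable_integrable)
  show "(\<lambda>p. e p * (f (fst p) * g (snd p))) \<in> borel_measurable (lborel \<Otimes>\<^sub>M lborel)"
    by measurable
  have "(\<integral>y. norm (e (x, y) * (f (fst (x, y)) * g (snd (x, y)))) \<partial>lborel) = norm (f x) * (\<integral>y. norm (g y) \<partial>lborel)" for x
    by (simp add: norm_mult e(2))
  then show "integrable lborel (\<lambda>x. \<integral>y. norm (e (x, y) * (f (fst (x, y)) * g (snd (x, y)))) \<partial>lborel)"
    using f by simp
  show "AE x in lborel. integrable lborel (\<lambda>y. e (x, y) * (f (fst (x, y)) * g (snd (x, y))))"
  proof (rule AE_I2)
    fix x
    have "integrable lborel (\<lambda>y. f x * g y)" using g by simp
    then show "integrable lborel (\<lambda>y. e (x, y) * (f (fst (x, y)) * g (snd (x, y))))"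
      by (rule Bochner_Integration.integrable_bound) (simp_all add: norm_mult e(2))
  qed
qed

text \<open>After Fubini the exponential splits by x = (x - y) + y, and translation invariance
  removes y from the inner integral.\<close>

lemma convolution_integral:
  fixes \<phi> h :: "real^'n::finite \<Rightarrow> complex"
  assumes \<phi>: "integrable lborel \<phi>" and h: "integrable lborel h"
  shows "integrable lborel (\<lambda>x. \<integral>y. \<phi> y * h (x - y) \<partial>lborel)"
    and "(\<integral>x. exp (\<i> * of_real (x \<bullet> z)) * (\<integral>y. \<phi> y * h (x - y) \<partial>lborel) \<partial>lborel) =
      (\<integral>y. exp (\<i> * of_real (y \<bullet> z)) * \<phi> y \<partial>lborel) * (\<integral>x. exp (\<i> * of_real (x \<bullet> z)) * h x \<partial>lborel)"
proof -
  have [measurable]: "\<phi> \<in> borel_measurable borel" "h \<in> borel_measurable borel"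
    using \<phi> h by (simp_all add: borel_measurable_integrable)
  have tr: "integrable lborel (\<lambda>x. h (x - y))" for y
    using lborel_translate(3)[OF h, of "- y"] by simp
  have int: "integrable (lborel \<Otimes>\<^sub>M lborel) (\<lambda>(y, x). e x * (\<phi> y * h (x - y)))"
    if [measurable]: "e \<in> borel_measurable borel" and e1: "\<And>x. norm (e x) = 1" for e :: "real^'n \<Rightarrow> complex"
  proof (rule lborel_pair.Fubini_integrable)
    show "(\<lambda>(y, x). e x * (\<phi> y * h (x - y))) \<in> borel_measurable (lborel \<Otimes>\<^sub>M lborel)"
      by measurable
    have "(\<integral>x. norm (h (x - y)) \<partial>lborel) = (\<integral>x. norm (h x) \<partial>lborel)" for y
    proof -
      have "complex_of_real (\<integral>x. norm (h (x - y)) \<partial>lborel) = complex_of_real (\<integral>x. norm (h x) \<partial>lborel)"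
        using lborel_translate(2)[of "\<lambda>x. complex_of_real (norm (h x))" "- y"]
        by (simp add: integral_complex_of_real)
      then show ?thesis by (simp only: of_real_eq_iff)
    qed
    then have "(\<lambda>y. \<integral>x. norm (case (y, x) of (y, x) \<Rightarrow> e x * (\<phi> y * h (x - y))) \<partial>lborel) =
        (\<lambda>y. norm (\<phi> y) * (\<integral>x. norm (h x) \<partial>lborel))"
      by (simp add: norm_mult e1)
    then show "integrable lborel (\<lambda>y. \<integral>x. norm (case (y, x) of (y, x) \<Rightarrow> e x * (\<phi> y * h (x - y))) \<partial>lborel)"
      using \<phi> by simp
    show "AE y in lborel. integrable lborel (\<lambda>x. case (y, x) of (y, x) \<Rightarrow> e x * (\<phi> y * h (x - y)))"
    proof (rule AE_I2)
      fix y
      have "integrable lborel (\<lambda>x. \<phi> y * h (x - y))" using tr by simp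
      then show "integrable lborel (\<lambda>x. case (y, x) of (y, x) \<Rightarrow> e x * (\<phi> y * h (x - y)))"
        by (rule Bochner_Integration.integrable_bound) (simp_all add: norm_mult e1)
    qed
  qed
  show "integrable lborel (\<lambda>x. \<integral>y. \<phi> y * h (x - y) \<partial>lborel)"
    using lborel_pair.integrable_snd[OF int[of "\<lambda>x. 1"]] by simp
  let ?e = "\<lambda>x. exp (\<i> * complex_of_real (x \<bullet> z))"
  have e: "?e \<in> borel_measurable borel" "norm (?e x) = 1" for x
    by (auto intro!: borel_measurable_continuous_onI continuous_intros)
  have "(\<integral>x. ?e x * (\<integral>y. \<phi> y * h (x - y) \<partial>lborel) \<partial>lborel) = (\<integral>x. (\<integral>y. ?e x * (\<phi> y * h (x - y)) \<partial>lborel) \<partial>lborel)"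
    by simp
  also have "\<dots> = (\<integral>y. (\<integral>x. ?e x * (\<phi> y * h (x - y)) \<partial>lborel) \<partial>lborel)"
    by (rule lborel_pair.Fubini_integral[OF int[OF e]])
  also have "\<dots> = (\<integral>y. ?e y * \<phi> y * (\<integral>x. ?e x * h x \<partial>lborel) \<partial>lborel)"
  proof (rule Bochner_Integration.integral_cong[OF refl])
    fix y
    have "(\<integral>x. ?e x * (\<phi> y * h (x - y)) \<partial>lborel) = (\<integral>x. ?e y * \<phi> y * (?e (x - y) * h (x - y)) \<partial>lborel)"
      by (intro Bochner_Integration.integral_cong refl)
         (simp add: inner_diff_left right_diff_distrib exp_diff mult_ac)
    also have "\<dots> = ?e y * \<phi> y * (\<integral>x. ?e (x - y) * h (x - y) \<partial>lborel)" by simp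
    also have "(\<integral>x. ?e (x - y) * h (x - y) \<partial>lborel) = (\<integral>x. ?e x * h x \<partial>lborel)"
    proof -
      have "(\<lambda>x. ?e x * h x) \<in> borel_measurable borel" using e(1) by measurable
      from lborel_translate(2)[OF this, of "- y"] show ?thesis by simp
    qed
    finally show "(\<integral>x. ?e x * (\<phi> y * h (x - y)) \<partial>lborel) = ?e y * \<phi> y * (\<integral>x. ?e x * h x \<partial>lborel)" .
  qed
  also have "\<dots> = (\<integral>y. ?e y * \<phi> y \<partial>lborel) * (\<integral>x. ?e x * h x \<partial>lborel)" by simp
  finally show "(\<integral>x. ?e x * (\<integral>y. \<phi> y * h (x - y) \<partial>lborel) \<partial>lborel) =
    (\<integral>y. ?e y * \<phi> y \<partial>lborel) * (\<integral>x. ?e x * h x \<partial>lborel)" .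
qed

context smooth_decaying
begin

text \<open>Rewrites the function that a multiplier hands to a distribution as a convolution, from
  which its integrability and its Fourier coefficients can be read off.\<close>

lemma fourier_multiplier_kernel:
  fixes \<phi> :: "real^'n \<Rightarrow> complex"
  assumes \<phi>: "integrable lborel \<phi>"
  shows "fourier (\<lambda>\<xi>. f \<xi> * inv_fourier \<phi> \<xi>) x =
    (\<integral>y. \<phi> y * fourier f (x - y) \<partial>lborel) / of_real ((2 * pi) ^ CARD('n))"
proof -
  let ?c = "complex_of_real ((2 * pi) ^ CARD('n))"
  let ?k = "\<lambda>\<xi> y. exp (- \<i> * of_real ((x - y) \<bullet> \<xi>))"
  have "?k \<xi> y = exp (- \<i> * of_real (x \<bullet> \<xi>)) * exp (\<i> * of_real (\<xi> \<bullet> y))" for \<xi> y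
    by (simp add: exp_add[symmetric] inner_diff_left inner_commute algebra_simps)
  then have "(\<integral>y. ?k \<xi> y * (f \<xi> * \<phi> y) \<partial>lborel) =
      (\<integral>y. (exp (- \<i> * of_real (x \<bullet> \<xi>)) * f \<xi>) * (exp (\<i> * of_real (\<xi> \<bullet> y)) * \<phi> y) \<partial>lborel)" for \<xi>
    by (simp only: mult_ac)
  then have "(\<integral>y. ?k \<xi> y * (f \<xi> * \<phi> y) \<partial>lborel) =
      (exp (- \<i> * of_real (x \<bullet> \<xi>)) * f \<xi>) * (\<integral>y. exp (\<i> * of_real (\<xi> \<bullet> y)) * \<phi> y \<partial>lborel)" for \<xi>
    by (simp only: integral_mult_right_zero)
  then have k: "exp (- \<i> * of_real (x \<bullet> \<xi>)) * (f \<xi> * inv_fourier \<phi> \<xi>) = (\<integral>y. ?k \<xi> y * (f \<xi> * \<phi> y) \<partial>lborel) / ?c" for \<xi>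
    unfolding inv_fourier_def by (simp only: times_divide_eq_right mult.assoc)
  have e: "(\<lambda>p. ?k (fst p) (snd p)) \<in> borel_measurable borel" "norm (?k (fst p) (snd p)) = 1" for p
    by (auto intro!: borel_measurable_continuous_onI continuous_intros simp del: inner_diff_left)
  have "fourier (\<lambda>\<xi>. f \<xi> * inv_fourier \<phi> \<xi>) x = (\<integral>\<xi>. (\<integral>y. ?k \<xi> y * (f \<xi> * \<phi> y) \<partial>lborel) / ?c \<partial>lborel)"
    unfolding fourier_def inner_commute[of _ x] by (simp only: k)
  also have "\<dots> = (\<integral>\<xi>. (\<integral>y. ?k \<xi> y * (f \<xi> * \<phi> y) \<partial>lborel) \<partial>lborel) / ?c"
    by simp
  also have "(\<integral>\<xi>. (\<integral>y. ?k \<xi> y * (f \<xi> * \<phi> y) \<partial>lborel) \<partial>lborel) = (\<integral>y. (\<integral>\<xi>. ?k \<xi> y * (f \<xi> * \<phi> y) \<partial>lborel) \<partial>lborel)"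
    using integrable_product[OF integrable \<phi> e]
    by (intro lborel_pair.Fubini_integral[symmetric]) (simp add: case_prod_beta')
  also have "\<dots> = (\<integral>y. \<phi> y * fourier f (x - y) \<partial>lborel)"
  proof (rule Bochner_Integration.integral_cong[OF refl])
    fix y
    have "(\<integral>\<xi>. ?k \<xi> y * (f \<xi> * \<phi> y) \<partial>lborel) = (\<integral>\<xi>. \<phi> y * (?k \<xi> y * f \<xi>) \<partial>lborel)"
      by (simp only: mult_ac)
    then show "(\<integral>\<xi>. ?k \<xi> y * (f \<xi> * \<phi> y) \<partial>lborel) = \<phi> y * fourier f (x - y)"
      unfolding fourier_def inner_commute[of _ "x - y"] by simp
  qed
  finally show ?thesis .
qed

text \<open>Unfolding and the convolution theorem give a product of two integrals; Fourier inversion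
  evaluates the second to f(2 pi m), and the powers of 2 pi cancel. Thus the multiplier acts on
  coefficients through its symbol.\<close>

lemma dual_coef_multiplier:
  fixes \<phi> :: "real^'n \<Rightarrow> complex"
  assumes \<phi>: "integrable lborel \<phi>"
  defines "\<Phi> \<equiv> periodization (fourier (\<lambda>\<xi>. f \<xi> * inv_fourier \<phi> \<xi>))"
  shows "set_integrable lborel (cbox 0 1) \<Phi>"
    and "dual_coef \<Phi> m = f ((2 * pi) *\<^sub>R lattice m) * (\<integral>y. ech (lattice m) y * \<phi> y \<partial>lborel)"
proof -
  let ?c = "complex_of_real ((2 * pi) ^ CARD('n))"
  let ?\<Psi> = "fourier (\<lambda>\<xi>. f \<xi> * inv_fourier \<phi> \<xi>)"
  let ?z = "(2 * pi) *\<^sub>R lattice m"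
  note conv = convolution_integral[OF \<phi> integrable_fourier]
  have eq: "?\<Psi> = (\<lambda>x. (\<integral>y. \<phi> y * fourier f (x - y) \<partial>lborel) / ?c)"
    using fourier_multiplier_kernel[OF \<phi>] by (rule ext)
  have int: "integrable lborel ?\<Psi>"
    unfolding eq using conv(1) by simp
  then show "set_integrable lborel (cbox 0 1) \<Phi>"
    unfolding \<Phi>_def by (rule torus_integral_periodization)
  have "dual_coef \<Phi> m = torus_integral (periodization (\<lambda>x. ech (lattice m) x * ?\<Psi> x))"
    unfolding dual_coef_def \<Phi>_def by (simp only: periodization_mult[OF periodic_ech])
  also have "\<dots> = (\<integral>x. ech (lattice m) x * ?\<Psi> x \<partial>lborel)"
    by (rule torus_integral_periodization(2)[OF integrable_ech_mult[OF int]])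
  also have "\<dots> = (\<integral>x. exp (\<i> * of_real (x \<bullet> ?z)) * (\<integral>y. \<phi> y * fourier f (x - y) \<partial>lborel) / ?c \<partial>lborel)"
    by (simp only: exp_ech eq times_divide_eq_right)
  also have "\<dots> = (\<integral>x. exp (\<i> * of_real (x \<bullet> ?z)) * (\<integral>y. \<phi> y * fourier f (x - y) \<partial>lborel) \<partial>lborel) / ?c"
    by (rule integral_divide_zero)
  also have "\<dots> = (\<integral>y. exp (\<i> * of_real (y \<bullet> ?z)) * \<phi> y \<partial>lborel) * f ?z"
    unfolding conv(2) inversion by simp
  finally show "dual_coef \<Phi> m = f ?z * (\<integral>y. ech (lattice m) y * \<phi> y \<partial>lborel)"
    by (simp only: exp_ech) (rule mult.commute)
qed

end

section \<open>Test functions\<close>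

lemma C_inf_partials: "C_inf f \<Longrightarrow> C_inf (partials ds f)"
  unfolding C_inf_def by (auto intro: C_k_partials)

lemma partial_periodic:
  assumes "\<And>x. f differentiable (at x)" "Z_periodic f"
  shows "Z_periodic (partial i f)"
proof -
  have "(\<lambda>x. f (x + lattice k)) = f" for k
    using assms(2) by (auto simp: Z_periodic_def)
  then have "partial i f (x + lattice k) = partial i f x" for k x
    using partial_translate(2)[OF assms(1), where h = "lattice k" and i = i] by (metis (no_types))
  then show ?thesis by (simp add: Z_periodic_def)
qed

lemma partials_periodic: "C_inf f \<Longrightarrow> Z_periodic f \<Longrightarrow> Z_periodic (partials ds f)"
proof (induction ds)
  case Nil
  then show ?case by (simp add: partials_def)
next
  case (Cons i ds)
  have "C_k (Suc 0) (partials ds f)"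
    using C_inf_partials[OF Cons.prems(1)] unfolding C_inf_def by blast
  then have "Z_periodic (partial i (partials ds f))"
    by (intro partial_periodic Cons) simp
  then show ?case by (simp add: partials_def)
qed

lemma finite_lists_le: "finite {ds :: 'n::finite list. length ds \<le> N}"
  using finite_lists_length_le[of "UNIV :: 'n set" N] by simp

lemma norm_partials_le_torus_seminorm:
  assumes \<phi>: "\<phi> \<in> torus_smooth" and ds: "length ds \<le> N"
  shows "norm (partials ds \<phi> x) \<le> torus_seminorm N \<phi>"
proof -
  have bdd: "bdd_above (range (\<lambda>x. norm (partials ds \<phi> x)))" for ds
  proof -
    have "continuous_on UNIV (partials ds \<phi>)" "Z_periodic (partials ds \<phi>)"
      using \<phi> partials_periodic C_inf_partials C_k_continuous
      unfolding torus_smooth_def C_inf_def by blast+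
    then obtain B where "\<And>x. norm (partials ds \<phi> x) \<le> B" by (rule periodic_bounded) blast
    then show ?thesis by (rule bdd_aboveI2)
  qed
  have le: "norm (partials ds \<phi> x) \<le> (SUP x. norm (partials ds \<phi> x))" for ds x
    by (rule cSUP_upper[OF UNIV_I bdd])
  also have "(SUP x. norm (partials ds \<phi> x)) \<le> torus_seminorm N \<phi>"
    unfolding torus_seminorm_def
    by (rule member_le_sum) (use ds finite_lists_le order_trans[OF norm_ge_zero le] in auto)
  finally show ?thesis .
qed

lemma torus_seminorm_nonneg: "\<phi> \<in> torus_smooth \<Longrightarrow> torus_seminorm N \<phi> \<ge> 0"
  using order_trans[OF norm_ge_zero norm_partials_le_torus_seminorm[of \<phi> "[]" N 0]] by simp

lemma torus_smooth_continuous: "\<phi> \<in> torus_smooth \<Longrightarrow> continuous_on UNIV \<phi>"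
  unfolding torus_smooth_def C_inf_def using C_k_continuous by blast

lemma torus_smooth_shift_diff:
  assumes "\<phi> \<in> torus_smooth" "0 < t"
  shows "norm (shift_diff i t \<phi> x) \<le> torus_seminorm 1 \<phi> * t"
proof (rule norm_shift_diff_le)
  have "C_k (Suc 0) \<phi>" using assms unfolding torus_smooth_def C_inf_def by blast
  then show "\<phi> differentiable (at x)" for x by simp
  show "norm (partial i \<phi> (x + axis i s)) \<le> torus_seminorm 1 \<phi>" for s
    using norm_partials_le_torus_seminorm[OF assms(1), of "[i]" 1] by (simp add: partials_def)
  show "torus_seminorm 1 \<phi> \<ge> 0" by (rule torus_seminorm_nonneg[OF assms(1)])
qed (use assms in auto)

text \<open>A smooth function lies in the Hoelder class of exponent n, which exceeds n/2.\<close>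

lemma torus_smooth_fcoef_summable:
  fixes \<phi> :: "real^'n::finite \<Rightarrow> complex"
  assumes \<phi>: "\<phi> \<in> torus_smooth"
  shows "(\<lambda>m. norm (fcoef \<phi> m)) summable_on UNIV"
proof (rule Holder_fcoef_summable[of _ "real CARD('n)"])
  have "norm (partials ds \<phi> x - partials ds \<phi> y) \<le>
      2 * torus_seminorm CARD('n) \<phi> * dist x y powr (real CARD('n) - \<lfloor>real CARD('n)\<rfloor>)"
    if "length ds = nat \<lfloor>real CARD('n)\<rfloor>" for ds x y
  \<comment> \<open>The fractional part of the exponent is 0 here, and \<open>0 powr 0\<close> is 0,
    so coinciding points are treated apart.\<close>
  proof (cases "x = y")
    case False
    have "norm (partials ds \<phi> x - partials ds \<phi> y) \<le> torus_seminorm CARD('n) \<phi> + torus_seminorm CARD('n) \<phi>"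
      using that by (intro order_trans[OF norm_triangle_ineq4] add_mono norm_partials_le_torus_seminorm[OF \<phi>]) auto
    with False show ?thesis by simp
  qed simp
  then show "\<phi> \<in> torus_Holder (real CARD('n))"
    using \<phi> unfolding torus_Holder_def torus_smooth_def C_inf_def by blast
qed simp

section \<open>Schwartz functions and their periodizations\<close>

lemma norm_partials_le_schwartz_seminorm:
  fixes \<phi> :: "real^'n::finite \<Rightarrow> complex"
  assumes \<phi>: "\<phi> \<in> schwartz" and ds: "length ds \<le> 2 * CARD('n)"
  shows "norm (partials ds \<phi> x) \<le> schwartz_seminorm (2 * CARD('n)) \<phi> * weight x"
    and "schwartz_seminorm (2 * CARD('n)) \<phi> \<ge> 0"
proof -
  let ?N = "2 * CARD('n)"
  let ?h = "\<lambda>ds x. (1 + norm x) ^ ?N * norm (partials ds \<phi> x)"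
  have bdd: "bdd_above (range (?h ds))" for ds
    using \<phi> by (simp add: schwartz_def)
  have le: "?h ds x \<le> (SUP x. ?h ds x)" for ds x
    by (rule cSUP_upper[OF UNIV_I bdd])
  have nn: "0 \<le> ?h ds x" for ds x by simp
  have "(SUP x. ?h ds x) \<le> schwartz_seminorm ?N \<phi>"
    unfolding schwartz_seminorm_def
    by (rule member_le_sum) (use ds finite_lists_le order_trans[OF nn le] in auto)
  with le have 1: "?h ds x \<le> schwartz_seminorm ?N \<phi>" for x by (rule order_trans)
  show 2: "schwartz_seminorm ?N \<phi> \<ge> 0" using order_trans[OF nn 1] .
  have "1 + norm x \<noteq> 0" using norm_ge_zero[of x] by linarith
  then have "norm (partials ds \<phi> x) = ?h ds x * (1 / (1 + norm x) ^ ?N)" by simp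
  also have "\<dots> \<le> schwartz_seminorm ?N \<phi> * weight x"
    by (intro mult_mono 1 2 inverse_power_le_weight) simp
  finally show "norm (partials ds \<phi> x) \<le> schwartz_seminorm ?N \<phi> * weight x" .
qed

lemma schwartz_decaying:
  fixes \<phi> :: "real^'n::finite \<Rightarrow> complex"
  assumes \<phi>: "\<phi> \<in> schwartz"
  shows "decaying \<phi> (schwartz_seminorm (2 * CARD('n)) \<phi>)"
proof
  show "continuous_on UNIV \<phi>" using \<phi> C_k_continuous unfolding schwartz_def C_inf_def by blast
  show "schwartz_seminorm (2 * CARD('n)) \<phi> \<ge> 0"
    by (rule norm_partials_le_schwartz_seminorm(2)[OF \<phi>, of "[]"]) simp
  show "norm (\<phi> x) \<le> schwartz_seminorm (2 * CARD('n)) \<phi> * weight x" for x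
    using norm_partials_le_schwartz_seminorm(1)[OF \<phi>, of "[]" x] by (simp add: partials_def)
qed

text \<open>The difference is taken under the lattice sum, where each term obeys the mean value
  inequality; the factor 4 is the variation of \<open>weight\<close> over a unit step.\<close>

lemma schwartz_periodization_shift_diff:
  fixes \<phi> :: "real^'n::finite \<Rightarrow> complex"
  assumes \<phi>: "\<phi> \<in> schwartz" and t: "0 < t" "t \<le> 1"
  shows "norm (shift_diff i t (periodization \<phi>) x) \<le>
    schwartz_seminorm (2 * CARD('n)) \<phi> * (4 * weight_const CARD('n)) * t"
proof -
  let ?S = "schwartz_seminorm (2 * CARD('n)) \<phi>"
  interpret decaying \<phi> ?S by (rule schwartz_decaying[OF \<phi>])
  have Ck: "C_k k \<phi>" for k using \<phi> by (simp add: schwartz_def C_inf_def)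
  have "norm ((shift_diff i t ^^ 1) \<phi> x) \<le> ?S * 4 ^ 1 * t ^ 1 * weight x" for x
  proof (rule norm_shift_diff_iter_le)
    show "norm (partials (replicate 1 i) \<phi> x) \<le> ?S * weight x" for x
      by (rule norm_partials_le_schwartz_seminorm(1)[OF \<phi>]) simp
    show "C_k 1 \<phi>" by (rule Ck)
  qed (use t C in \<open>auto intro: weight_shift less_imp_le[OF weight_pos]\<close>)
  then interpret d: decaying "shift_diff i t \<phi>" "?S * 4 * t"
    using t C C_k_shift_diff[of 0 \<phi>] cont by unfold_locales auto
  have "shift_diff i t (periodization \<phi>) x = periodization (shift_diff i t \<phi>) x"
  proof -
    have s: "(\<lambda>k. \<phi> (y + lattice k)) summable_on UNIV" for y
      by (rule abs_summable_summable[OF summable])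
    have e: "x + lattice k + axis i t = x + axis i t + lattice k" for k by simp
    show ?thesis
      unfolding periodization_def shift_diff_def e
      using infsum_add[OF s summable_on_uminus[THEN iffD2, OF s], of "x + axis i t" x]
      by (simp add: infsum_uminus)
  qed
  also have "norm \<dots> \<le> ?S * 4 * t * weight_const CARD('n)"
    by (rule d.norm_periodization_le)
  finally show ?thesis by (simp add: mult_ac)
qed

section \<open>The distributions defined by the sums\<close>

context correlation_sum
begin

lemma T_linear:
  assumes "continuous_on UNIV \<phi>"
  shows "continuous_on UNIV \<eta> \<Longrightarrow> T (\<lambda>x. \<phi> x + \<eta> x) j = T \<phi> j + T \<eta> j"
    and "T (\<lambda>x. c * \<phi> x) j = c * T \<phi> j"
proof -
  note ti = torus_integrable_continuous
  show "T (\<lambda>x. \<phi> x + \<eta> x) j = T \<phi> j + T \<eta> j" if "continuous_on UNIV \<eta>"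
    unfolding T_def distrib_right
    by (intro torus_integral_linear(1) ti continuous_intros continuous_R_g assms that)
  show "T (\<lambda>x. c * \<phi> x) j = c * T \<phi> j"
    unfolding T_def mult.assoc
    by (intro torus_integral_linear(3) ti continuous_intros continuous_R_g assms)
qed

lemma suminf_T_linear:
  assumes "continuous_on UNIV \<phi>" "summable (T \<phi>)"
  shows "continuous_on UNIV \<eta> \<Longrightarrow> summable (T \<eta>) \<Longrightarrow>
      (\<Sum>j. T (\<lambda>x. \<phi> x + \<eta> x) j) = (\<Sum>j. T \<phi> j) + (\<Sum>j. T \<eta> j)"
    and "(\<Sum>j. T (\<lambda>x. c * \<phi> x) j) = c * (\<Sum>j. T \<phi> j)"
  using assms by (simp_all add: T_linear suminf_add suminf_mult)

lemma smooth_sums: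
  assumes "\<phi> \<in> torus_smooth"
  shows "summable (T \<phi>)" "norm (\<Sum>j. T \<phi> j) \<le> torus_seminorm 1 \<phi> * (real CARD('n) * C * S)"
proof -
  have "torus_seminorm 1 \<phi> \<ge> 0" by (rule torus_seminorm_nonneg[OF assms])
  moreover have "Z_periodic \<phi>" using assms by (simp add: torus_smooth_def)
  ultimately show "summable (T \<phi>)" "norm (\<Sum>j. T \<phi> j) \<le> torus_seminorm 1 \<phi> * (real CARD('n) * C * S)"
    using T_sums_lipschitz[OF torus_smooth_continuous[OF assms]] torus_smooth_shift_diff[OF assms] by blast+
qed

text \<open>\<open>\<sigma>\<close> carries the sign in front of the series: -1 for
  \<open>u_alpha\<close> and 1 for \<open>u_omega\<close>.\<close>

lemma torus_distribution_sum:
  assumes "norm \<sigma> = 1"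
  shows "torus_distribution (\<lambda>\<phi>. \<sigma> * (\<Sum>j. T \<phi> j))"
  unfolding torus_distribution_def linear_functional_on_def
proof (intro conjI ballI allI)
  fix \<phi> \<eta> :: "real^'n \<Rightarrow> complex" assume "\<phi> \<in> torus_smooth" "\<eta> \<in> torus_smooth"
  then show "\<sigma> * (\<Sum>j. T (\<lambda>x. \<phi> x + \<eta> x) j) = \<sigma> * (\<Sum>j. T \<phi> j) + \<sigma> * (\<Sum>j. T \<eta> j)"
    by (simp add: suminf_T_linear torus_smooth_continuous smooth_sums distrib_left)
next
  fix c and \<phi> :: "real^'n \<Rightarrow> complex" assume "\<phi> \<in> torus_smooth"
  then show "\<sigma> * (\<Sum>j. T (\<lambda>x. c * \<phi> x) j) = c * (\<sigma> * (\<Sum>j. T \<phi> j))"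
    by (simp add: suminf_T_linear torus_smooth_continuous smooth_sums)
next
  show "\<exists>K N. \<forall>\<phi>\<in>torus_smooth. norm (\<sigma> * (\<Sum>j. T \<phi> j)) \<le> K * torus_seminorm N \<phi>"
    using smooth_sums(2) assms
    by (intro exI[of _ "real CARD('n) * C * S"] exI[of _ 1]) (simp add: norm_mult mult.commute)
qed

lemma schwartz_sums:
  assumes \<phi>: "\<phi> \<in> schwartz"
  shows "continuous_on UNIV (periodization \<phi>)" "summable (T (periodization \<phi>))"
    "norm (\<Sum>j. T (periodization \<phi>) j) \<le>
      schwartz_seminorm (2 * CARD('n)) \<phi> * (4 * weight_const CARD('n)) * (real CARD('n) * C * S)"
proof -
  interpret d: decaying \<phi> "schwartz_seminorm (2 * CARD('n)) \<phi>" by (rule schwartz_decaying[OF \<phi>])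
  show c: "continuous_on UNIV (periodization \<phi>)" by (rule d.continuous_periodization)
  have "schwartz_seminorm (2 * CARD('n)) \<phi> * (4 * weight_const CARD('n)) \<ge> 0"
    using d.C weight_const_nonneg by simp
  note T_sums_lipschitz[OF c periodic_periodization this schwartz_periodization_shift_diff[OF \<phi>]]
  then show "summable (T (periodization \<phi>))"
    "norm (\<Sum>j. T (periodization \<phi>) j) \<le>
      schwartz_seminorm (2 * CARD('n)) \<phi> * (4 * weight_const CARD('n)) * (real CARD('n) * C * S)"
    by blast+
qed

lemma periodization_linear:
  fixes \<phi> \<eta> :: "real^'n \<Rightarrow> complex"
  assumes "\<phi> \<in> schwartz"
  shows "\<eta> \<in> schwartz \<Longrightarrow> periodization (\<lambda>x. \<phi> x + \<eta> x) = (\<lambda>x. periodization \<phi> x + periodization \<eta> x)"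
    and "periodization (\<lambda>x. c * \<phi> x) = (\<lambda>x. c * periodization \<phi> x)"
proof -
  have s: "(\<lambda>k. \<phi> (x + lattice k)) summable_on UNIV" if "\<phi> \<in> schwartz" for \<phi> and x :: "real^'n"
    by (rule abs_summable_summable[OF decaying.summable[OF schwartz_decaying[OF that]]])
  show "periodization (\<lambda>x. \<phi> x + \<eta> x) = (\<lambda>x. periodization \<phi> x + periodization \<eta> x)" if "\<eta> \<in> schwartz"
    unfolding periodization_def by (intro ext infsum_add s[OF assms] s[OF that])
  show "periodization (\<lambda>x. c * \<phi> x) = (\<lambda>x. c * periodization \<phi> x)"
    unfolding periodization_def by (intro ext infsum_cmult_right')
qed

lemma tempered_distribution_sum:
  assumes "norm \<sigma> = 1"
  shows "tempered_distribution (periodic_extension (\<lambda>\<phi>. \<sigma> * (\<Sum>j. T \<phi> j)))"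
  unfolding tempered_distribution_def linear_functional_on_def periodic_extension_def
proof (intro conjI ballI allI)
  fix \<phi> \<eta> :: "real^'n \<Rightarrow> complex" assume "\<phi> \<in> schwartz" "\<eta> \<in> schwartz"
  then show "\<sigma> * (\<Sum>j. T (periodization (\<lambda>x. \<phi> x + \<eta> x)) j) =
      \<sigma> * (\<Sum>j. T (periodization \<phi>) j) + \<sigma> * (\<Sum>j. T (periodization \<eta>) j)"
    by (simp add: periodization_linear suminf_T_linear schwartz_sums distrib_left)
next
  fix c and \<phi> :: "real^'n \<Rightarrow> complex" assume "\<phi> \<in> schwartz"
  then show "\<sigma> * (\<Sum>j. T (periodization (\<lambda>x. c * \<phi> x)) j) = c * (\<sigma> * (\<Sum>j. T (periodization \<phi>) j))"
    by (simp add: periodization_linear suminf_T_linear schwartz_sums)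
next
  show "\<exists>K N. \<forall>\<phi>\<in>schwartz. norm (\<sigma> * (\<Sum>j. T (periodization \<phi>) j)) \<le> K * schwartz_seminorm N \<phi>"
    using schwartz_sums(3) assms
    by (intro exI[of _ "4 * weight_const CARD('n) * (real CARD('n) * C * S)"] exI[of _ "2 * CARD('n)"])
       (simp add: norm_mult mult_ac)
qed

text \<open>Up to the factor \<sigma>, psi_l(D)u is the trigonometric series over pairs (j, k) with
  coefficients R_k psi_l(2 pi m) at the frequency m = A_j k. Their absolute sum is at most 5 C S
  uniformly in l, which is the bound of order 0.\<close>

lemma Zygmund_sum:
  assumes \<psi>: "radial_cutoff \<psi>0" and \<sigma>: "norm \<sigma> = 1"
  shows "periodic_extension (\<lambda>\<phi>. \<sigma> * (\<Sum>j. T \<phi> j)) \<in> Zygmund \<psi>0 0"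
proof -
  let ?u = "periodic_extension (\<lambda>\<phi>. \<sigma> * (\<Sum>j. T \<phi> j))"
  have "\<exists>h. continuous_on UNIV h \<and> represented_by (fourier_multiplier (dyadic_piece \<psi>0 l) ?u) h \<and>
      (\<forall>x. 2 powr (real l * 0) * norm (h x) \<le> 5 * C * S)" for l
  proof -
    let ?\<eta> = "dyadic_piece \<psi>0 l"
    let ?f = "\<lambda>x. complex_of_real (?\<eta> x)"
    obtain K where "smooth_decaying ?f K"
      using compact_support_smooth_decaying[OF dyadic_piece_props(1,2)[OF \<psi>]] by blast
    then interpret f: smooth_decaying ?f K .
    define d where "d j k = ?f ((2 * pi) *\<^sub>R lattice (A j k))" for j k
    define q where "q p = fcoef R (snd p) * d (fst p) (snd p)" for p
    define E where "E p = ech (lattice (A (fst p) (snd p)))" for p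
    have d: "(\<Sum>j\<in>F. norm (d j k)) \<le> 5 * C" if k: "k \<noteq> 0" and F: "finite F" for k F
    proof -
      have "(\<Sum>j\<in>F. norm (d j k)) \<le> (\<Sum>j\<in>F. 5 * bump (norm (lattice (A j k))) (2 ^ l / (2 * pi)))"
        unfolding d_def norm_of_real real_norm_def[symmetric]
        by (intro sum_mono dyadic_piece_le_bump \<psi> nonzero k)
      also have "\<dots> \<le> 5 * C"
        unfolding sum_distrib_left[symmetric] by (intro mult_left_mono sum_bump k F) auto
      finally show ?thesis .
    qed
    have ps: "(\<Sum>p\<in>P. norm (q p)) \<le> 5 * C * S" if "finite P" for P
      unfolding q_def using C_nonneg by (intro pair_partial_sums d that) auto
    note sq = summable_bounded_partial_sums(1)[of q, OF ps]
    have inf: "infinite (UNIV :: (nat \<times> (int^'n)) set)"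
      using infinite_vec by (simp add: finite_prod)
    define h where "h x = \<sigma> * (\<Sum>\<^sub>\<infinity>p. q p * E p x)" for x
    have "continuous_on UNIV h"
      unfolding h_def E_def
      by (intro continuous_on_mult_left continuous_on_infsum[OF inf sq] continuous_intros) simp_all
    moreover have "norm (h x) \<le> 5 * C * S" for x
    proof -
      have "(\<Sum>p\<in>P. norm (q p * E p x)) \<le> 5 * C * S" if "finite P" for P
        using ps[OF that] by (simp add: norm_mult E_def)
      from summable_bounded_partial_sums(3)[OF this] show ?thesis
        by (simp add: h_def norm_mult \<sigma>)
    qed
    moreover have "represented_by (fourier_multiplier ?\<eta> ?u) h"
      unfolding represented_by_def
    proof
      fix \<phi> :: "real^'n \<Rightarrow> complex" assume "\<phi> \<in> schwartz"
      then have \<phi>: "integrable lborel \<phi>"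
        by (rule decaying.integrable[OF schwartz_decaying])
      \<comment> \<open>The function that \<open>?u\<close> receives: duality moves both Fourier
        transforms and the cutoff from the distribution to \<phi>.\<close>
      define \<Phi> where "\<Phi> = periodization (fourier (\<lambda>\<xi>. ?f \<xi> * inv_fourier \<phi> \<xi>))"
      define I where "I m = (\<integral>y. ech (lattice m) y * \<phi> y \<partial>lborel)" for m :: "int^'n"
      have \<Phi>: "set_integrable lborel (cbox 0 1) \<Phi>" and dc: "dual_coef \<Phi> (A j k) = d j k * I (A j k)" for j k
        unfolding \<Phi>_def d_def I_def by (rule f.dual_coef_multiplier[OF \<phi>])+
      have I: "norm (I m) \<le> (\<integral>y. norm (\<phi> y) \<partial>lborel)" for m
        unfolding I_def using integral_norm_bound[of lborel "\<lambda>y. ech (lattice m) y * \<phi> y"]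
        by (simp add: norm_mult)
      have D: "(\<Sum>j\<in>F. norm (dual_coef \<Phi> (A j k))) \<le> 5 * C * (\<integral>y. norm (\<phi> y) \<partial>lborel)"
        if k: "k \<noteq> 0" and F: "finite F" for k F
      proof -
        have "(\<Sum>j\<in>F. norm (dual_coef \<Phi> (A j k))) \<le> (\<Sum>j\<in>F. norm (d j k) * (\<integral>y. norm (\<phi> y) \<partial>lborel))"
          unfolding dc norm_mult by (intro sum_mono mult_left_mono I) auto
        also have "\<dots> = (\<Sum>j\<in>F. norm (d j k)) * (\<integral>y. norm (\<phi> y) \<partial>lborel)"
          by (rule sum_distrib_right[symmetric])
        also have "\<dots> \<le> 5 * C * (\<integral>y. norm (\<phi> y) \<partial>lborel)"
          by (intro mult_right_mono d k F) (simp add: integral_nonneg_AE)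
        finally show ?thesis .
      qed
      have "fourier_multiplier ?\<eta> ?u \<phi> = \<sigma> * (\<Sum>j. T \<Phi> j)"
        unfolding fourier_multiplier_def distr_inv_fourier_def distr_mult_def distr_fourier_def
          periodic_extension_def \<Phi>_def ..
      also have "(\<Sum>j. T \<Phi> j) = (\<Sum>\<^sub>\<infinity>p. q p * (\<integral>y. E p y * \<phi> y \<partial>lborel))"
        using T_sums(2)[OF \<Phi> D] C_nonneg
        by (simp add: dc q_def E_def I_def[symmetric] mult.assoc integral_nonneg_AE)
      also have "\<dots> = (\<integral>y. (\<Sum>\<^sub>\<infinity>p. q p * E p y) * \<phi> y \<partial>lborel)"
        by (rule integral_infsum(2)[OF inf sq _ _ \<phi>, symmetric]) (auto simp: E_def)
      finally show "fourier_multiplier ?\<eta> ?u \<phi> = (\<integral>x. h x * \<phi> x \<partial>lborel)"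
        by (simp add: h_def mult.assoc)
    qed
    ultimately show ?thesis by (intro exI[of _ h]) simp
  qed
  then show ?thesis
    unfolding Zygmund_def using tempered_distribution_sum[OF \<sigma>] by blast
qed

end

section \<open>The cohomological equation\<close>

text \<open>A change of variables on the torus, carried out on the Fourier side: \<phi> is replaced
  by its absolutely convergent series, the map permutes the characters, and orthogonality selects
  the frequency l = - (transpose M) m.\<close>

lemma dual_coef_comp_toral_map:
  fixes \<phi> :: "real^'n::finite \<Rightarrow> complex"
  assumes \<phi>: "\<phi> \<in> torus_smooth" and inv: "M ** M' = mat 1" "M' ** M = mat 1"
  shows "dual_coef (\<phi> \<circ> toral_map M') m = dual_coef \<phi> (transpose M *v m)"
proof -
  note cont = torus_smooth_continuous[OF \<phi>]
  note sum = torus_smooth_fcoef_summable[OF \<phi>]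
  have per: "Z_periodic \<phi>" using \<phi> by (simp add: torus_smooth_def)
  have eq: "transpose M' *v l + m = 0 \<longleftrightarrow> l = - (transpose M *v m)" for l
  proof -
    have tr: "transpose M *v (transpose M' *v x) = x" "transpose M' *v (transpose M *v x) = x" for x
      unfolding matrix_vector_mul_assoc matrix_transpose_mul[symmetric] inv by (simp_all add: transpose_mat)
    have "transpose M' *v l + m = 0 \<longleftrightarrow> transpose M *v (transpose M' *v l + m) = 0"
      using tr(2)[of "transpose M' *v l + m"] by (metis matrix_vector_mult_0_right)
    also have "\<dots> \<longleftrightarrow> l + transpose M *v m = 0"
      unfolding matrix_vector_right_distrib tr ..
    finally show ?thesis by (simp add: eq_neg_iff_add_eq_0)
  qed
  have "dual_coef (\<phi> \<circ> toral_map M') m =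
      torus_integral (\<lambda>x. (\<Sum>\<^sub>\<infinity>l. fcoef \<phi> l * ech (lattice (transpose M' *v l)) x) * ech (lattice m) x)"
    unfolding dual_coef_def o_apply fourier_series[OF cont per sum, of "toral_map M' _"] ech_toral_map
    by (simp only: mult.commute)
  also have "\<dots> = (\<Sum>\<^sub>\<infinity>l. fcoef \<phi> l * torus_integral (\<lambda>x. ech (lattice (transpose M' *v l)) x * ech (lattice m) x))"
    by (rule torus_integral_infsum[OF infinite_vec sum])
       (auto intro!: torus_integrable_continuous continuous_intros)
  also have "\<dots> = (\<Sum>\<^sub>\<infinity>l\<in>{- (transpose M *v m)}. fcoef \<phi> l)"
  proof (rule infsum_cong_neutral)
    have ti: "torus_integral (\<lambda>x. ech (lattice (transpose M' *v l)) x * ech (lattice m) x) =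
        (if l = - (transpose M *v m) then 1 else 0)" for l
    proof -
      have "(\<lambda>x. ech (lattice (transpose M' *v l)) x * ech (lattice m) x) = ech (lattice (transpose M' *v l + m))"
        by (rule ext) (simp only: lattice_simps ech_add_left)
      then show ?thesis by (simp only: torus_integral_ech eq)
    qed
    show "fcoef \<phi> l * torus_integral (\<lambda>x. ech (lattice (transpose M' *v l)) x * ech (lattice m) x) = 0"
      if "l \<in> UNIV - {- (transpose M *v m)}" for l using that unfolding ti by simp
    show "fcoef \<phi> l * torus_integral (\<lambda>x. ech (lattice (transpose M' *v l)) x * ech (lattice m) x) = fcoef \<phi> l"
      if "l \<in> UNIV \<inter> {- (transpose M *v m)}" for l
      using that unfolding ti by simp
  qed auto
  also have "\<dots> = dual_coef \<phi> (transpose M *v m)"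
    by (simp add: fcoef_def dual_coef_def)
  finally show ?thesis .
qed

theorem theorem2:
  fixes M :: "int^'n^'n::finite" and R :: "real^'n \<Rightarrow> complex" and \<beta> :: real
    and \<psi>0 :: "real^'n \<Rightarrow> real"
  assumes "unimodular M" and "hyperbolic M"
    and "\<beta> > real CARD('n) / 2"
    and "R \<in> torus_Holder \<beta>"
    and "torus_integral R = 0"
    and "radial_cutoff \<psi>0"
  shows "(\<forall>\<phi>\<in>torus_smooth. summable (alpha_term M R \<phi>)) \<and>
         (\<forall>\<phi>\<in>torus_smooth. summable (\<lambda>j. omega_term M R \<phi> (Suc j))) \<and>
         torus_distribution (u_alpha M R) \<and>
         torus_distribution (u_omega M R) \<and>
         periodic_extension (u_alpha M R) \<in> Zygmund \<psi>0 0 \<and>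
         periodic_extension (u_omega M R) \<in> Zygmund \<psi>0 0 \<and>
         weak_solution M R (u_alpha M R) \<and>
         weak_solution M R (u_omega M R)"
proof -
  obtain M' where inv: "M ** M' = mat 1" "M' ** M = mat 1"
    using unimodular_inverse[OF assms(1)] by blast
  obtain C where C: "\<And>k s F. k \<noteq> 0 \<Longrightarrow> s > 0 \<Longrightarrow> finite F \<Longrightarrow>
      (\<Sum>j\<in>F. bump (norm (lattice (((*v) (transpose M) ^^ j) k))) s) \<le> C \<and>
      (\<Sum>j\<in>F. bump (norm (lattice (((*v) (transpose M') ^^ Suc j) k))) s) \<le> C"
    using hyperbolic_sum_bump_lattice[OF assms(2) inv] by blast
  have cont: "continuous_on UNIV R" and per: "Z_periodic R"
    using assms(4) C_k_continuous by (auto simp: torus_Holder_def)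
  note sumR = Holder_fcoef_summable[OF assms(4,3)]
  have R0: "fcoef R 0 = 0" using assms(5) by (simp add: fcoef_def)
  have tr: "transpose M *v (transpose M' *v x) = x" "transpose M' *v (transpose M *v x) = x" for x
    unfolding matrix_vector_mul_assoc matrix_transpose_mul[symmetric] inv by (simp_all add: transpose_mat)
  have nz1: "transpose M *v v \<noteq> 0" "transpose M' *v v \<noteq> 0" if "v \<noteq> 0" for v
    using that tr[of v] by (metis matrix_vector_mult_0_right)+
  have nz: "((*v) (transpose M) ^^ j) k \<noteq> 0" "((*v) (transpose M') ^^ j) k \<noteq> 0" if "k \<noteq> 0" for j k
  proof -
    show "((*v) (transpose M) ^^ j) k \<noteq> 0"
      by (induction j) (simp_all only: funpow.simps o_apply id_apply that not_False_eq_True nz1)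
    show "((*v) (transpose M') ^^ j) k \<noteq> 0"
      by (induction j) (simp_all only: funpow.simps o_apply id_apply that not_False_eq_True nz1)
  qed
  interpret \<alpha>: correlation_sum R "\<lambda>j. (*v) (transpose M) ^^ j" "\<lambda>j. toral_map M ^^ j" C
    by unfold_locales (use cont per sumR R0 C nz in \<open>auto simp: ech_toral_map_iter continuous_toral_map_iter\<close>)
  \<comment> \<open>\<open>u_omega\<close> starts at j = 1, hence the successors in both the map and
    the action on frequencies.\<close>
  interpret \<omega>: correlation_sum R "\<lambda>j. (*v) (transpose M') ^^ Suc j" "\<lambda>j. toral_map M' ^^ Suc j" C
    by unfold_locales
       (use cont per sumR R0 C nz(2)[of _ "Suc _"] in
         \<open>auto simp: ech_toral_map_iter continuous_toral_map_iter simp del: funpow.simps\<close>)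
  note invM = inv_toral_map[OF inv]
  have at: "alpha_term M R \<phi> = \<alpha>.T \<phi>" for \<phi>
    by (rule ext) (simp add: alpha_term_def \<alpha>.T_def)
  have ot: "(\<lambda>j. omega_term M R \<phi> (Suc j)) = \<omega>.T \<phi>" for \<phi>
    unfolding omega_term_def \<omega>.T_def[abs_def] invM ..
  have ua: "u_alpha M R = (\<lambda>\<phi>. (-1) * (\<Sum>j. \<alpha>.T \<phi> j))"
    by (rule ext) (simp add: u_alpha_def at)
  have uo: "u_omega M R = (\<lambda>\<phi>. 1 * (\<Sum>j. \<omega>.T \<phi> j))"
    by (rule ext) (simp add: u_omega_def ot)
  have da: "torus_distribution (u_alpha M R)" and do: "torus_distribution (u_omega M R)"
    unfolding ua uo by (rule \<alpha>.torus_distribution_sum \<omega>.torus_distribution_sum, simp)+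
  have za: "periodic_extension (u_alpha M R) \<in> Zygmund \<psi>0 0" and zo: "periodic_extension (u_omega M R) \<in> Zygmund \<psi>0 0"
    unfolding ua uo by (rule \<alpha>.Zygmund_sum[OF assms(6)] \<omega>.Zygmund_sum[OF assms(6)], simp)+
  have sa: "summable (\<alpha>.T \<phi>)" and so: "summable (\<omega>.T \<phi>)" if "\<phi> \<in> torus_smooth" for \<phi>
    using that \<alpha>.smooth_sums(1) \<omega>.smooth_sums(1) by blast+
  have weak: "u_alpha M R (\<phi> \<circ> inv (toral_map M)) - u_alpha M R \<phi> = torus_integral (\<lambda>x. R x * \<phi> x)"
    "u_omega M R (\<phi> \<circ> inv (toral_map M)) - u_omega M R \<phi> = torus_integral (\<lambda>x. R x * \<phi> x)"
    if \<phi>: "\<phi> \<in> torus_smooth" for \<phi>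
  proof -
    have c: "set_integrable lborel (cbox 0 1) \<phi>"
      by (rule torus_integrable_continuous[OF torus_smooth_continuous[OF \<phi>]])
    have "continuous_on UNIV (\<phi> \<circ> toral_map M')"
      by (intro continuous_on_compose continuous_toral_map continuous_on_subset[OF torus_smooth_continuous[OF \<phi>]]) auto
    then have c': "set_integrable lborel (cbox 0 1) (\<phi> \<circ> toral_map M')"
      by (rule torus_integrable_continuous)
    note dc = dual_coef_comp_toral_map[OF \<phi> inv]
    have T0: "\<alpha>.T \<phi> 0 = torus_integral (\<lambda>x. R x * \<phi> x)"
      unfolding \<alpha>.T_def by (simp add: mult.commute)
    \<comment> \<open>Composition with the inverse map advances the index by one, so the two sums
      differ by the term j = 0; the minus sign of \<open>u_alpha\<close> turns this loss into
      +R.\<close>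
    have "\<alpha>.T (\<phi> \<circ> toral_map M') j = \<alpha>.T \<phi> (Suc j)" for j
      unfolding \<alpha>.T_eq[OF c] \<alpha>.T_eq[OF c'] dc by simp
    then have "(\<Sum>j. \<alpha>.T (\<phi> \<circ> toral_map M') j) = (\<Sum>j. \<alpha>.T \<phi> j) - \<alpha>.T \<phi> 0"
      using suminf_split_head[OF sa[OF \<phi>]] by simp
    then show "u_alpha M R (\<phi> \<circ> inv (toral_map M)) - u_alpha M R \<phi> = torus_integral (\<lambda>x. R x * \<phi> x)"
      unfolding ua invM by (simp add: T0)
    \<comment> \<open>Here the shift goes the other way: transpose M cancels one factor transpose
      M', and the composed series gains the term of R itself in front.\<close>
    have o0: "\<omega>.T (\<phi> \<circ> toral_map M') 0 = \<alpha>.T \<phi> 0"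
      unfolding \<omega>.T_eq[OF c'] \<alpha>.T_eq[OF c] dc by (simp only: funpow.simps o_apply id_apply tr)
    have oS: "\<omega>.T (\<phi> \<circ> toral_map M') (Suc j) = \<omega>.T \<phi> j" for j
      unfolding \<omega>.T_eq[OF c'] \<omega>.T_eq[OF c] dc by (simp only: funpow.simps o_apply tr)
    have "(\<Sum>j. \<omega>.T (\<phi> \<circ> toral_map M') j) = \<alpha>.T \<phi> 0 + (\<Sum>j. \<omega>.T \<phi> j)"
    proof -
      \<comment> \<open>Convergence for the composed function is read off its tail, which is the
        series for \<phi>.\<close>
      have "summable (\<omega>.T (\<phi> \<circ> toral_map M'))"
        using so[OF \<phi>] by (subst summable_Suc_iff[symmetric]) (simp only: oS)
      from suminf_split_head[OF this] show ?thesis by (simp add: oS o0 del: funpow.simps)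
    qed
    then show "u_omega M R (\<phi> \<circ> inv (toral_map M)) - u_omega M R \<phi> = torus_integral (\<lambda>x. R x * \<phi> x)"
      unfolding uo invM by (simp add: T0)
  qed
  show ?thesis
    unfolding weak_solution_def using da do za zo weak sa so at ot by simp
qed

end
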